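(* Let $X=(X_1,\dots,X_n)$ have components $X_i$ that are independent $\mathbb{R}^d$-valued random vectors, and let $Z=(Z_1,\dots,Z_n)$ have components $Z_i$ that are independent random vectors, each $Z_i$ being uniformly distributed on the origin-symmetric Euclidean ball in $\mathbb{R}^d$ whose radius is determined by $M(Z_i)=M(X_i)$ (with the understanding that $Z_i$ has the Dirac delta distribution at $0$ if $M(X_i)=\infty$). Let $T:\mathbb{R}^n\to\mathbb{R}^k$ be a linear map and $I_d$ the identity map on $\mathbb{R}^d$. Then $$M\big((T\otimes I_d)(X)\big)\le M\big((T\otimes I_d)(Z)\big).$$
   Context: For a random vector $Y$ taking values in a finite-dimensional Euclidean space with Lebesgue measure $\alpha$, $M(Y)=\sup\{\mathbb{P}(Y\in A)/\alpha(A): A \text{ Borel},\ \alpha(A)>0\}\in[0,\infty]$; if $M(Y)<\infty$ then $Y$ has a density and $M(Y)$ is its essential supremum. Here $M(X_i),M(Z_i)$ are with respect to Lebesgue measure on $\mathbb{R}^d$, and $M((T\otimes I_d)(\cdot))$ is with respect to Lebesgue measure on $(\mathbb{R}^d)^k$. Writing $T=(T_{ij})$ in the standard bases, $T\otimes I_d:(\mathbb{R}^d)^n\to(\mathbb{R}^d)^k$ is the Kronecker product, $((T\otimes I_d)(x_1,\dots,x_n))_i=\sum_{j=1}^n T_{ij}x_j$. *)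

theory Defs
  imports "HOL-Probability.Probability"
begin

text \<open>
  The supremum of the ratios \<open>\<P>(Y \<in> A) / \<alpha>(A)\<close> over Borel sets of positive Lebesgue measure, as an
  extended nonnegative real.  A set of infinite Lebesgue measure contributes the ratio 0.
\<close>

definition max_density :: "'w measure \<Rightarrow> ('w \<Rightarrow> 'b::euclidean_space) \<Rightarrow> ennreal" where
  "max_density P Y =
     (SUP A \<in> {A \<in> sets borel. emeasure lborel A > 0}.
        emeasure P (Y -` A \<inter> space P) / emeasure lborel A)"

text \<open>
  \<open>T \<otimes> I\<^sub>d\<close>.  An element of \<open>(\<real>\<^sup>d)\<^sup>n\<close> is a vector \<open>x :: (real ^ 'd) ^ 'n\<close> with \<open>x $ j \<in> \<real>\<^sup>d\<close>.
\<close>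

definition kron_id :: "(real ^ 'n \<Rightarrow> real ^ 'k) \<Rightarrow> (real ^ 'd) ^ 'n \<Rightarrow> (real ^ 'd) ^ 'k" where
  "kron_id T x = (\<chi> i. \<Sum>j\<in>UNIV. (matrix T $ i $ j) *\<^sub>R (x $ j))"

end

theory Submission
  imports Defs
begin

text \<open>
  It suffices to compare \<open>\<P>(\<parallel>(T \<otimes> I) X - b\<parallel> \<le> \<epsilon>)\<close> with \<open>\<P>(\<parallel>(T \<otimes> I) Z\<parallel> \<le> \<epsilon>)\<close> for all \<open>b\<close> and \<open>\<epsilon>\<close>, because convolving
  with uniform laws on small balls transfers the bound from balls to open sets.  The components with
  \<open>M(X\<^sub>i) = \<infinity>\<close> are integrated out, and \<open>b\<close> is projected to the range of \<open>T \<otimes> I\<close> and absorbed into the \<open>X\<^sub>i\<close>.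
  What remains is the Rogers--Brascamp--Lieb--Luttinger inequality for densities \<open>0 \<le> f\<^sub>i \<le> 1\<close> on the set
  \<open>\<parallel>(T \<otimes> I) x\<parallel> \<le> \<epsilon>\<close>.  On the real line it follows by sliding intervals towards the origin and merging them when
  they touch; each slide increases the functional by Anderson's inequality, a consequence of the
  Prekopa--Leindler inequality.  Applied on parallel lines this shows that Steiner symmetrization
  (combined with filling each line up to density 1) does not decrease the functional.  If a mass \<open>m\<close> of \<open>f\<^sub>i\<close>
  lies outside its target ball, then some direction, found by averaging over translations, moves an amount
  of order \<open>m\<^sup>2\<close> into the ball, so iterated symmetrizations drive all \<open>f\<^sub>i\<close> to the indicators of the balls.
\<close>

section \<open>The Prekopa--Leindler inequality on the real line\<close>

text \<open>The radius condition says that the ball of \<open>Z\<^sub>i\<close> has volume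
  \<open>1 / M(X\<^sub>i)\<close>. Multiplying the density of \<open>X\<^sub>i\<close> by that
  volume gives values in [0, 1] and total mass equal to the volume of the ball, so the given
  densities and the extremal indicators obey the same constraints and all normalising factors
  cancel.

  A line of mass \<open>L\<close> is replaced by the centred interval of length \<open>L\<close>,
  whatever the profile on it. Hence one symmetrization already yields indicators, and no level sets
  of the densities have to be rearranged separately.

  One direction has to serve all components at once, because the linear map couples them. A
  direction chosen for one component never increases the mass outside the ball for the others, so
  the sum of these masses is the right quantity to decrease. The square in the gain has two factors:
  the mass outside the ball and the unfilled room inside it, which is at least as large.

  For \<open>Z\<close> only balls centred at the origin are compared; their ratios are lower bounds
  for \<open>M\<close> straight from its definition.\<close>

lemma emeasure_le_if_initial_segments_le:
  fixes A :: "real set"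
  assumes [measurable]: "A \<in> sets borel" and le: "\<And>a. a \<in> A \<Longrightarrow> emeasure lborel (A \<inter> {..a}) \<le> K"
  shows "emeasure lborel A \<le> K"
proof -
  \<comment> \<open>The point \<open>s\<close> plays the role of the supremum: \<open>A\<close>
    without it is the increasing union of the parts cut at \<open>c n\<close>, each inside an
    initial segment ending at a point of \<open>A\<close>, and a single point is null.\<close>
  have main: "emeasure lborel A \<le> K"
    if s: "\<And>n::nat. \<exists>a\<in>A. c n \<le> a" "incseq c" "\<And>x. x \<in> A \<Longrightarrow> x \<noteq> s \<Longrightarrow> \<exists>n. x \<le> c n"
    for c :: "nat \<Rightarrow> real" and s :: real
  proof -
    have "emeasure lborel A \<le> emeasure lborel ((\<Union>n. A \<inter> {..c n}) \<union> {s})"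
      using s(3) by (intro emeasure_mono) auto
    also have "\<dots> \<le> emeasure lborel (\<Union>n. A \<inter> {..c n}) + emeasure lborel {s}"
      by (intro emeasure_subadditive) auto
    also have "\<dots> = emeasure lborel (\<Union>n. A \<inter> {..c n})" by simp
    also have "\<dots> = (SUP n. emeasure lborel (A \<inter> {..c n}))"
      using s(2) by (intro SUP_emeasure_incseq[symmetric]) (auto simp: incseq_def, force)
    also have "\<dots> \<le> K"
    proof (rule SUP_least)
      fix n
      obtain a where "a \<in> A" "c n \<le> a" using s(1) by blast
      then have "emeasure lborel (A \<inter> {..c n}) \<le> emeasure lborel (A \<inter> {..a})"
        by (intro emeasure_mono) auto
      then show "emeasure lborel (A \<inter> {..c n}) \<le> K" using le[OF \<open>a \<in> A\<close>] by simp
    qed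
    finally show ?thesis .
  qed
  show ?thesis
  proof (cases "A = {}")
    case ne: False
    show ?thesis
    proof (cases "bdd_above A")
      case True
      show ?thesis
      proof (rule main[of "\<lambda>n. Sup A - 1 / real (Suc n)" "Sup A"])
        show "\<exists>a\<in>A. Sup A - 1 / real (Suc n) \<le> a" for n
        proof -
          have "Sup A - 1 / real (Suc n) < Sup A" by (simp del: of_nat_Suc)
          then show ?thesis using less_cSupD[OF ne] less_imp_le by blast
        qed
        show "incseq (\<lambda>n. Sup A - 1 / real (Suc n))"
          by (auto simp: incseq_def frac_le)
        show "\<exists>n. x \<le> Sup A - 1 / real (Suc n)" if "x \<in> A" "x \<noteq> Sup A" for x
        proof -
          have "x < Sup A" using cSup_upper[OF that(1) True] that(2) by simp
          then obtain n where "inverse (real (Suc n)) < Sup A - x"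
            using reals_Archimedean[of "Sup A - x"] by auto
          then show ?thesis by (intro exI[of _ n]) (auto simp: inverse_eq_divide)
        qed
      qed
    next
      case False
      show ?thesis
      \<comment> \<open>An unbounded \<open>A\<close> is exhausted by the cuts at the natural
        numbers; the exceptional point 0 is a dummy.\<close>
      proof (rule main[of real 0])
        show "\<exists>a\<in>A. real n \<le> a" for n
          using False unfolding bdd_above_def by (meson linear)
        show "\<exists>n. x \<le> real n" for x using real_arch_simple by blast
      qed (auto simp: incseq_def)
    qed
  qed simp
qed

text \<open>For \<open>a\<close> in \<open>A\<close> and \<open>b\<close> in \<open>B\<close>, the
  midpoints of \<open>A \<inter> {..a}\<close> with \<open>b\<close> and those of \<open>a\<close>
  with \<open>B \<inter> {b..}\<close> lie in \<open>C\<close> on opposite sides of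
  \<open>(a + b) / 2\<close>, so their lengths add up. Then \<open>a\<close> runs to the supremum of
  \<open>A\<close> and \<open>b\<close> to the infimum of \<open>B\<close>.\<close>

lemma brunn_minkowski_midpoint_real:
  fixes A B C :: "real set"
  assumes [measurable]: "A \<in> sets borel" "B \<in> sets borel" "C \<in> sets borel"
    and ne: "A \<noteq> {}" "B \<noteq> {}"
    and mid: "\<And>x y. x \<in> A \<Longrightarrow> y \<in> B \<Longrightarrow> (x + y) / 2 \<in> C"
  shows "emeasure lborel A + emeasure lborel B \<le> 2 * emeasure lborel C"
proof -
  have aff: "(\<integral>\<^sup>+u. f u \<partial>lborel) * 2 = (\<integral>\<^sup>+x. f ((x + c) / 2) \<partial>lborel)"
    if [measurable]: "f \<in> borel_measurable borel" for f :: "real \<Rightarrow> ennreal" and c :: real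
  proof -
    have "(\<integral>\<^sup>+u. f u \<partial>lborel) = ennreal (1/2) * (\<integral>\<^sup>+x. f (c / 2 + 1 / 2 * x) \<partial>lborel)"
      using nn_integral_real_affine[of f "1/2" "c/2"] by simp
    also have "\<dots> * 2 = (\<integral>\<^sup>+x. f (c / 2 + 1 / 2 * x) \<partial>lborel) * (ennreal (1/2) * ennreal 2)"
      by (simp only: ennreal_numeral mult_ac)
    also have "ennreal (1/2) * ennreal 2 = 1"
      by (subst ennreal_mult[symmetric]) auto
    finally show ?thesis by (simp add: add_divide_distrib add.commute)
  qed
  have ref: "emeasure lborel (uminus -` S) = emeasure lborel S" if [measurable]: "S \<in> sets borel" for S :: "real set"
  proof -
    have "emeasure (distr lborel borel uminus) S = emeasure lborel (uminus -` S)"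
      by (subst emeasure_distr) auto
    then show ?thesis by (simp add: lborel_distr_uminus)
  qed
  have le_minus: "p \<le> r - q \<Longrightarrow> q \<le> r \<Longrightarrow> p + q \<le> r" for p q r :: ennreal
    by (metis add_right_mono diff_add_cancel_ennreal)
  have minus_le: "p + q \<le> r \<Longrightarrow> q \<noteq> \<infinity> \<Longrightarrow> p \<le> r - q" for p q r :: ennreal
    using ennreal_minus_mono[of "p + q" r q q] by simp
  have *: "emeasure lborel (A \<inter> {..a}) + emeasure lborel (B \<inter> {b..}) \<le> 2 * emeasure lborel C"
    if ab: "a \<in> A" "b \<in> B" for a b
  proof -
    \<comment> \<open>Dropping the null point \<open>b\<close> makes the two families of midpoints
      disjoint.\<close>
    have "emeasure lborel (B \<inter> {b..}) \<le> emeasure lborel (B \<inter> {b<..}) + emeasure lborel {b}"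
      by (subst emeasure_Un_Int) (auto intro!: emeasure_mono simp: less_le)
    then have 1: "emeasure lborel (B \<inter> {b..}) \<le> emeasure lborel (B \<inter> {b<..})" by simp
    have "emeasure lborel (A \<inter> {..a}) + emeasure lborel (B \<inter> {b<..})
       = (\<integral>\<^sup>+x. indicator (A \<inter> {..a}) x \<partial>lborel) + (\<integral>\<^sup>+x. indicator (B \<inter> {b<..}) x \<partial>lborel)"
      by simp
    also have "\<dots> \<le> (\<integral>\<^sup>+x. indicator (C \<inter> {..(a+b)/2}) ((x + b) / 2) \<partial>lborel)
        + (\<integral>\<^sup>+x. indicator (C \<inter> {(a+b)/2<..}) ((x + a) / 2) \<partial>lborel)"
      using ab mid mid[OF ab(1)]
      by (intro add_mono nn_integral_mono) (auto simp: add.commute[of _ a] split: split_indicator)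
    also have "\<dots> = (\<integral>\<^sup>+u. indicator (C \<inter> {..(a+b)/2}) u \<partial>lborel) * 2 + (\<integral>\<^sup>+u. indicator (C \<inter> {(a+b)/2<..}) u \<partial>lborel) * 2"
      by (subst (1 2) aff[symmetric]) auto
    also have "\<dots> = 2 * ((\<integral>\<^sup>+u. indicator (C \<inter> {..(a+b)/2}) u \<partial>lborel) + (\<integral>\<^sup>+u. indicator (C \<inter> {(a+b)/2<..}) u \<partial>lborel))"
      by (simp add: algebra_simps)
    also have "\<dots> = 2 * (\<integral>\<^sup>+u. indicator C u \<partial>lborel)"
    proof -
      have "(\<integral>\<^sup>+u. indicator (C \<inter> {..(a+b)/2}) u \<partial>lborel) + (\<integral>\<^sup>+u. indicator (C \<inter> {(a+b)/2<..}) u \<partial>lborel)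
         = (\<integral>\<^sup>+u. indicator (C \<inter> {..(a+b)/2}) u + indicator (C \<inter> {(a+b)/2<..}) u \<partial>lborel)"
        by (subst nn_integral_add) auto
      also have "\<dots> = (\<integral>\<^sup>+u. indicator C u \<partial>lborel)"
        by (intro nn_integral_cong) (auto split: split_indicator)
      finally show ?thesis by simp
    qed
    also have "(\<integral>\<^sup>+u. indicator C u \<partial>lborel) = emeasure lborel C" by simp
    finally show ?thesis by (rule order_trans[OF add_left_mono[OF 1]])
  qed
  have **: "emeasure lborel A + emeasure lborel (B \<inter> {b..}) \<le> 2 * emeasure lborel C" if "b \<in> B" for b
  proof (cases "2 * emeasure lborel C = \<infinity>")
    case False
    have fin: "emeasure lborel (B \<inter> {b..}) \<noteq> \<infinity>"
    proof -
      obtain a where "a \<in> A" using ne by auto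
      from *[OF this that] False show ?thesis by (auto simp: top_unique)
    qed
    have "emeasure lborel A \<le> 2 * emeasure lborel C - emeasure lborel (B \<inter> {b..})"
      by (rule emeasure_le_if_initial_segments_le[OF assms(1)], rule minus_le[OF *[OF _ that] fin])
    moreover obtain a where "a \<in> A" using ne by auto
    moreover have "emeasure lborel (B \<inter> {b..}) \<le> 2 * emeasure lborel C"
      by (rule order_trans[OF _ *[OF \<open>a \<in> A\<close> that]]) simp
    ultimately show ?thesis by (rule_tac le_minus)
  qed simp
  show ?thesis
  proof (cases "2 * emeasure lborel C = \<infinity>")
    case False
    obtain b where "b \<in> B" using ne by auto
    have fin: "emeasure lborel A \<noteq> \<infinity>"
      using **[OF \<open>b \<in> B\<close>] False by (auto simp: top_unique)
    \<comment> \<open>Letting \<open>b\<close> tend to the infimum of \<open>B\<close> is the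
      previous limit for the reflected set.\<close>
    have "emeasure lborel (uminus -` B) \<le> 2 * emeasure lborel C - emeasure lborel A"
    proof (rule emeasure_le_if_initial_segments_le)
      fix a assume a: "a \<in> uminus -` B"
      have "emeasure lborel (uminus -` B \<inter> {..a}) = emeasure lborel (uminus -` (B \<inter> {-a..}))"
        by (auto intro!: arg_cong[where f="emeasure lborel"])
      also have "\<dots> = emeasure lborel (B \<inter> {-a..})" by (rule ref) simp
      finally show "emeasure lborel (uminus -` B \<inter> {..a}) \<le> 2 * emeasure lborel C - emeasure lborel A"
        using **[of "-a"] a fin by (intro minus_le) (auto simp: add.commute)
    qed (rule measurable_sets_borel[where M=borel], measurable)
    then have "emeasure lborel B \<le> 2 * emeasure lborel C - emeasure lborel A" by (simp add: ref)
    moreover have "emeasure lborel A \<le> 2 * emeasure lborel C"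
      by (rule order_trans[OF _ **[OF \<open>b \<in> B\<close>]]) simp
    ultimately show ?thesis by (subst add.commute) (rule le_minus)
  qed simp
qed

text \<open>Layer-cake formula with the levels rescaled to the unit interval, so that functions with
  different suprema can be compared at the same relative level \<open>t\<close>.\<close>

lemma nn_integral_level_sets:
  fixes f :: "'a \<Rightarrow> ennreal"
  assumes [measurable]: "f \<in> borel_measurable M" and "sigma_finite_measure M"
    and "\<alpha> > 0" and le: "\<And>x. f x \<le> ennreal \<alpha>"
  shows "(\<integral>\<^sup>+x. f x \<partial>M) = ennreal \<alpha> * (\<integral>\<^sup>+t\<in>{0<..<1}. emeasure M {x\<in>space M. ennreal (t * \<alpha>) < f x} \<partial>lborel)"
proof -
  interpret sigma_finite_measure M by fact
  interpret pair_sigma_finite M lborel by unfold_locales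
  have *: "f x = ennreal \<alpha> * (\<integral>\<^sup>+t. indicator {0<..<1} t * indicator {x. ennreal (t * \<alpha>) < f x} x \<partial>lborel)" for x
  proof -
    obtain r where r: "f x = ennreal r" "0 \<le> r" "r \<le> \<alpha>"
      using le[of x] \<open>\<alpha> > 0\<close> by (cases "f x") (auto simp: top_unique)
    have "(\<integral>\<^sup>+t. indicator {0<..<1} t * indicator {x. ennreal (t * \<alpha>) < f x} x \<partial>lborel)
        = (\<integral>\<^sup>+t. indicator {0<..<r/\<alpha>} t \<partial>lborel)"
    proof (intro nn_integral_cong)
      fix t :: real
      have "t * \<alpha> < r \<Longrightarrow> t < 1"
        using r(3) \<open>\<alpha> > 0\<close> by (metis less_le_trans mult.commute mult.right_neutral mult_less_cancel_left_pos)
      then show "indicator {0<..<1} t * indicator {x. ennreal (t * \<alpha>) < f x} x = (indicator {0<..<r/\<alpha>} t :: ennreal)"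
        using r \<open>\<alpha> > 0\<close> by (auto simp: ennreal_less_iff field_simps split: split_indicator)
    qed
    also have "\<dots> = ennreal (r / \<alpha>)" using r \<open>\<alpha> > 0\<close> by simp
    finally show ?thesis using r \<open>\<alpha> > 0\<close> by (simp add: ennreal_mult[symmetric])
  qed
  have "(\<integral>\<^sup>+x. f x \<partial>M) = ennreal \<alpha> * (\<integral>\<^sup>+x. (\<integral>\<^sup>+t. indicator {0<..<1} t * indicator {x. ennreal (t * \<alpha>) < f x} x \<partial>lborel) \<partial>M)"
    by (subst *, rule nn_integral_cmult) measurable
  also have "(\<integral>\<^sup>+x. (\<integral>\<^sup>+t. indicator {0<..<1} t * indicator {x. ennreal (t * \<alpha>) < f x} x \<partial>lborel) \<partial>M)
    = (\<integral>\<^sup>+t. (\<integral>\<^sup>+x. indicator {0<..<1} t * indicator {x. ennreal (t * \<alpha>) < f x} x \<partial>M) \<partial>lborel)"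
    by (rule Fubini'[symmetric]) measurable
  also have "\<dots> = (\<integral>\<^sup>+t. indicator {0<..<1} t * emeasure M {x\<in>space M. ennreal (t * \<alpha>) < f x} \<partial>lborel)"
  proof (intro nn_integral_cong)
    fix t :: real
    have "(\<integral>\<^sup>+x. indicator {0<..<1} t * indicator {x. ennreal (t * \<alpha>) < f x} x \<partial>M)
       = indicator {0<..<1} t * (\<integral>\<^sup>+x. indicator {x\<in>space M. ennreal (t * \<alpha>) < f x} x \<partial>M)"
      by (subst nn_integral_cmult[symmetric]) (measurable, rule nn_integral_cong, simp split: split_indicator)
    then show "(\<integral>\<^sup>+x. indicator {0<..<1} t * indicator {x. ennreal (t * \<alpha>) < f x} x \<partial>M)
       = indicator {0<..<1} t * emeasure M {x\<in>space M. ennreal (t * \<alpha>) < f x}"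
      by (subst (asm) nn_integral_indicator) measurable
  qed
  finally show ?thesis by (simp add: mult.commute)
qed

lemma four_mult_le_square_add_ennreal: "4 * (a * b) \<le> (a + b)\<^sup>2" for a b :: ennreal
proof (cases a; cases b)
  fix r s assume *: "a = ennreal r" "0 \<le> r" "b = ennreal s" "0 \<le> s"
  have "4 * (r * s) \<le> (r + s)\<^sup>2"
    using zero_le_power2[of "r - s"] by (simp add: power2_eq_square algebra_simps)
  then have "ennreal (4 * (r * s)) \<le> ennreal ((r + s)\<^sup>2)" by (rule ennreal_leI)
  with * show ?thesis by (simp add: ennreal_mult ennreal_power[symmetric])
qed (auto simp: power2_eq_square ennreal_mult_top ennreal_top_mult)

text \<open>Superlevel sets are taken relative to the suprema, so that both are nonempty at the same levels.\<close>

lemma prekopa_leindler_midpoint_real_bounded: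
  fixes f g h :: "real \<Rightarrow> ennreal"
  assumes [measurable]: "f \<in> borel_measurable borel" "g \<in> borel_measurable borel" "h \<in> borel_measurable borel"
    and bounded: "(SUP x. f x) < \<infinity>" "(SUP x. g x) < \<infinity>"
    and mid: "\<And>x y. f x * g y \<le> (h ((x + y) / 2))\<^sup>2"
  shows "(\<integral>\<^sup>+x. f x \<partial>lborel) * (\<integral>\<^sup>+x. g x \<partial>lborel) \<le> (\<integral>\<^sup>+x. h x \<partial>lborel)\<^sup>2"
proof (cases "(SUP x. f x) = 0 \<or> (SUP x. g x) = 0")
  case True
  then have "(\<forall>x. f x = 0) \<or> (\<forall>x. g x = 0)"
    by (metis SUP_upper UNIV_I le_zero_eq)
  then show ?thesis by auto
next
  case False
  from bounded(1) False obtain \<alpha> where \<alpha>: "(SUP x. f x) = ennreal \<alpha>" "\<alpha> > 0"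
    by (cases "SUP x. f x") (auto simp: less_le)
  from bounded(2) False obtain \<beta> where \<beta>: "(SUP x. g x) = ennreal \<beta>" "\<beta> > 0"
    by (cases "SUP x. g x") (auto simp: less_le)
  \<comment> \<open>The geometric mean makes the levels match: \<open>(t * \<gamma>)\<^sup>2\<close>
    is the product of \<open>t * \<alpha>\<close> and \<open>t * \<beta>\<close>.\<close>
  define \<gamma> where "\<gamma> = sqrt (\<alpha> * \<beta>)"
  have \<gamma>: "\<gamma> > 0" "\<gamma> * \<gamma> = \<alpha> * \<beta>" using \<alpha>(2) \<beta>(2) by (auto simp: \<gamma>_def)
  define a b c where "a = (\<lambda>t. emeasure lborel {x. ennreal (t * \<alpha>) < f x})"
    and "b = (\<lambda>t. emeasure lborel {x. ennreal (t * \<beta>) < g x})"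
    and "c = (\<lambda>t. emeasure lborel {x. ennreal (t * \<gamma>) < h x})"
  have [measurable]: "a \<in> borel_measurable borel" "b \<in> borel_measurable borel" "c \<in> borel_measurable borel"
    unfolding a_def b_def c_def by measurable
  have f: "(\<integral>\<^sup>+x. f x \<partial>lborel) = ennreal \<alpha> * (\<integral>\<^sup>+t\<in>{0<..<1}. a t \<partial>lborel)"
    using nn_integral_level_sets[of f lborel \<alpha>] \<alpha> SUP_upper[of _ UNIV f]
    by (auto simp: a_def sigma_finite_lborel)
  have g: "(\<integral>\<^sup>+x. g x \<partial>lborel) = ennreal \<beta> * (\<integral>\<^sup>+t\<in>{0<..<1}. b t \<partial>lborel)"
    using nn_integral_level_sets[of g lborel \<beta>] \<beta> SUP_upper[of _ UNIV g]
    by (auto simp: b_def sigma_finite_lborel)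
  \<comment> \<open>\<open>h\<close> may exceed \<open>\<gamma>\<close>; capping it discards the
    levels that have no counterpart in \<open>f\<close> and \<open>g\<close>, and only lowers the
    integral.\<close>
  have "(\<integral>\<^sup>+x. min (h x) \<gamma> \<partial>lborel) = ennreal \<gamma> * (\<integral>\<^sup>+t\<in>{0<..<1}. emeasure lborel {x. ennreal (t * \<gamma>) < min (h x) \<gamma>} \<partial>lborel)"
    using nn_integral_level_sets[of "\<lambda>x. min (h x) \<gamma>" lborel \<gamma>] \<gamma> by (auto simp: sigma_finite_lborel)
  also have "(\<integral>\<^sup>+t\<in>{0<..<1}. emeasure lborel {x. ennreal (t * \<gamma>) < min (h x) \<gamma>} \<partial>lborel) = (\<integral>\<^sup>+t\<in>{0<..<1}. c t \<partial>lborel)"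
    using \<gamma> by (intro nn_integral_cong) (auto simp: c_def ennreal_less_iff split: split_indicator)
  finally have h: "ennreal \<gamma> * (\<integral>\<^sup>+t\<in>{0<..<1}. c t \<partial>lborel) \<le> (\<integral>\<^sup>+x. h x \<partial>lborel)"
    by (metis (no_types, lifting) min.cobounded1 nn_integral_mono)
  have "a t + b t \<le> 2 * c t" if t: "t \<in> {0<..<1}" for t
    unfolding a_def b_def c_def
  proof (rule brunn_minkowski_midpoint_real)
    have "ennreal (t * \<alpha>) < (SUP x. f x)" "ennreal (t * \<beta>) < (SUP x. g x)"
      using t \<alpha> \<beta> by (auto simp: ennreal_less_iff)
    then show "{x. ennreal (t * \<alpha>) < f x} \<noteq> {}" "{x. ennreal (t * \<beta>) < g x} \<noteq> {}"
      by (auto simp: less_SUP_iff)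
    fix x y assume xy: "x \<in> {x. ennreal (t * \<alpha>) < f x}" "y \<in> {x. ennreal (t * \<beta>) < g x}"
    have "ennreal ((t * \<gamma>)\<^sup>2) = ennreal (t * \<alpha>) * ennreal (t * \<beta>)"
    proof -
      have "(t * \<gamma>)\<^sup>2 = (t * t) * (\<gamma> * \<gamma>)" by (simp add: power2_eq_square)
      also have "\<dots> = (t * \<alpha>) * (t * \<beta>)" by (simp add: \<gamma>(2))
      finally show ?thesis using t \<alpha>(2) \<beta>(2) by (simp add: ennreal_mult)
    qed
    also have "\<dots> < f x * g y"
    proof -
      have "ennreal (t * \<alpha>) * ennreal (t * \<beta>) < f x * ennreal (t * \<beta>)"
        using xy t \<beta>(2) by (intro ennreal_mult_strict_right_mono) auto
      also have "\<dots> \<le> f x * g y" using xy by (intro mult_left_mono) auto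
      finally show ?thesis .
    qed
    also have "\<dots> \<le> (h ((x + y) / 2))\<^sup>2" by (rule mid)
    finally have "(ennreal (t * \<gamma>))\<^sup>2 < (h ((x + y) / 2))\<^sup>2"
      using t \<gamma> by (simp add: ennreal_power)
    then show "(x + y) / 2 \<in> {x. ennreal (t * \<gamma>) < h x}"
      by (simp add: linorder_not_le[symmetric]) (meson power_mono zero_le)
  qed measurable
  then have "(\<integral>\<^sup>+t\<in>{0<..<1}. a t \<partial>lborel) + (\<integral>\<^sup>+t\<in>{0<..<1}. b t \<partial>lborel) \<le> 2 * (\<integral>\<^sup>+t\<in>{0<..<1}. c t \<partial>lborel)"
    by (subst nn_integral_add[symmetric], measurable, subst nn_integral_cmult[symmetric], measurable)
       (auto intro!: nn_integral_mono split: split_indicator)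
  then have abc: "((\<integral>\<^sup>+t\<in>{0<..<1}. a t \<partial>lborel) + (\<integral>\<^sup>+t\<in>{0<..<1}. b t \<partial>lborel))\<^sup>2 \<le> 4 * (\<integral>\<^sup>+t\<in>{0<..<1}. c t \<partial>lborel)\<^sup>2"
    by (drule_tac power_mono[where n=2]) (auto simp: power_mult_distrib)
  have "4 * ((\<integral>\<^sup>+x. f x \<partial>lborel) * (\<integral>\<^sup>+x. g x \<partial>lborel))
     = ennreal \<gamma> ^ 2 * (4 * ((\<integral>\<^sup>+t\<in>{0<..<1}. a t \<partial>lborel) * (\<integral>\<^sup>+t\<in>{0<..<1}. b t \<partial>lborel)))"
  proof -
    have "ennreal \<alpha> * ennreal \<beta> = ennreal \<gamma> ^ 2"
      using \<alpha>(2) \<beta>(2) \<gamma> by (simp add: ennreal_mult[symmetric] power2_eq_square)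
    then show ?thesis unfolding f g by (metis (no_types, lifting) mult.assoc mult.left_commute)
  qed
  also have "\<dots> \<le> ennreal \<gamma> ^ 2 * (4 * (\<integral>\<^sup>+t\<in>{0<..<1}. c t \<partial>lborel)\<^sup>2)"
    by (intro mult_left_mono order_trans[OF four_mult_le_square_add_ennreal abc]) simp
  also have "\<dots> = 4 * (ennreal \<gamma> * (\<integral>\<^sup>+t\<in>{0<..<1}. c t \<partial>lborel))\<^sup>2"
    by (simp add: power_mult_distrib mult_ac)
  also have "\<dots> \<le> 4 * (\<integral>\<^sup>+x. h x \<partial>lborel)\<^sup>2"
    by (intro mult_left_mono power_mono h) auto
  finally show ?thesis
    by (subst (asm) ennreal_mult_le_mult_iff) auto
qed

text \<open>Truncating \<open>f\<close> and \<open>g\<close> at finite heights preserves the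
  hypothesis with the same \<open>h\<close>; monotone convergence then removes both
  truncations.\<close>

lemma prekopa_leindler_midpoint_real:
  fixes f g h :: "real \<Rightarrow> ennreal"
  assumes [measurable]: "f \<in> borel_measurable borel" "g \<in> borel_measurable borel" "h \<in> borel_measurable borel"
    and mid: "\<And>x y. f x * g y \<le> (h ((x + y) / 2))\<^sup>2"
  shows "(\<integral>\<^sup>+x. f x \<partial>lborel) * (\<integral>\<^sup>+x. g x \<partial>lborel) \<le> (\<integral>\<^sup>+x. h x \<partial>lborel)\<^sup>2"
proof -
  have trunc: "(SUP n::nat. \<integral>\<^sup>+x. min (u x) (of_nat n) \<partial>lborel) = (\<integral>\<^sup>+x. u x \<partial>lborel)"
    if [measurable]: "u \<in> borel_measurable borel" for u :: "real \<Rightarrow> ennreal"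
  proof -
    have "(SUP n::nat. min (u x) (of_nat n)) = u x" for x
    proof -
      have "(SUP n::nat. min (u x) (of_nat n)) = min (u x) (SUP n::nat. of_nat n)"
        by (simp add: min_def inf_min[symmetric] inf_SUP[symmetric] flip: inf_min)
      then show ?thesis by (simp add: ennreal_SUP_of_nat_eq_top)
    qed
    then show ?thesis
      by (subst nn_integral_monotone_convergence_SUP[symmetric])
         (auto simp: incseq_def le_fun_def intro!: min.coboundedI2)
  qed
  have "(SUP x. min (u x) (of_nat n)) < \<infinity>" for u :: "real \<Rightarrow> ennreal" and n :: nat
    by (rule le_less_trans[OF SUP_least[of _ _ "of_nat n"]]) (auto simp: of_nat_less_top)
  then have "(\<integral>\<^sup>+x. min (f x) (of_nat n) \<partial>lborel) * (\<integral>\<^sup>+x. min (g x) (of_nat m) \<partial>lborel) \<le> (\<integral>\<^sup>+x. h x \<partial>lborel)\<^sup>2" for n m :: nat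
    by (intro prekopa_leindler_midpoint_real_bounded order_trans[OF mult_mono mid]) auto
  then have "(SUP n::nat. \<integral>\<^sup>+x. min (f x) (of_nat n) \<partial>lborel) * (SUP m::nat. \<integral>\<^sup>+x. min (g x) (of_nat m) \<partial>lborel) \<le> (\<integral>\<^sup>+x. h x \<partial>lborel)\<^sup>2"
    by (auto simp: SUP_mult_left_ennreal SUP_mult_right_ennreal intro!: SUP_least)
  then show ?thesis by (simp add: trunc)
qed

section \<open>Anderson's inequality for boxes\<close>

interpretation lborel_product: product_sigma_finite "\<lambda>_. lborel :: 'a::euclidean_space measure"
  by standard

text \<open>Tensorisation: with one coordinate frozen, the induction hypothesis says that the
  section integrals of \<open>f\<close>, \<open>g\<close> and \<open>h\<close> satisfy the
  one-dimensional hypothesis. Midpoints are restricted to \<open>I\<close> because points of the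
  product space are \<open>undefined\<close> off \<open>I\<close>.\<close>

lemma prekopa_leindler_midpoint_PiM:
  fixes f g h :: "('i \<Rightarrow> real) \<Rightarrow> ennreal"
  assumes "finite I"
    and "f \<in> borel_measurable (Pi\<^sub>M I (\<lambda>_. lborel))" "g \<in> borel_measurable (Pi\<^sub>M I (\<lambda>_. lborel))"
      "h \<in> borel_measurable (Pi\<^sub>M I (\<lambda>_. lborel))"
    and "\<And>x y. x \<in> extensional I \<Longrightarrow> y \<in> extensional I \<Longrightarrow> f x * g y \<le> (h (\<lambda>i\<in>I. (x i + y i) / 2))\<^sup>2"
  shows "(\<integral>\<^sup>+x. f x \<partial>Pi\<^sub>M I (\<lambda>_. lborel)) * (\<integral>\<^sup>+x. g x \<partial>Pi\<^sub>M I (\<lambda>_. lborel))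
    \<le> (\<integral>\<^sup>+x. h x \<partial>Pi\<^sub>M I (\<lambda>_. lborel))\<^sup>2"
  using assms
proof (induction I arbitrary: f g h rule: finite_induct)
  case empty
  have "f (\<lambda>_. undefined) * g (\<lambda>_. undefined) \<le> (h (\<lambda>_. undefined))\<^sup>2"
    using empty.prems(4)[of "\<lambda>_. undefined" "\<lambda>_. undefined"] by (simp add: restrict_def)
  then show ?case by (simp add: lborel_product.nn_integral_empty)
next
  case (insert i I)
  let ?M = "\<lambda>_::'i. lborel :: real measure"
  interpret I: finite_product_sigma_finite ?M I by standard fact
  have [measurable]: "f \<in> borel_measurable (Pi\<^sub>M (insert i I) ?M)" "g \<in> borel_measurable (Pi\<^sub>M (insert i I) ?M)"
    "h \<in> borel_measurable (Pi\<^sub>M (insert i I) ?M)" using insert.prems by auto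
  have meas: "(\<lambda>s. \<integral>\<^sup>+x. u (x(i := s)) \<partial>Pi\<^sub>M I ?M) \<in> borel_measurable borel"
    if [measurable]: "u \<in> borel_measurable (Pi\<^sub>M (insert i I) ?M)" for u :: "('i \<Rightarrow> real) \<Rightarrow> ennreal"
  proof -
    have "(\<lambda>s. \<integral>\<^sup>+x. u (x(i := s)) \<partial>Pi\<^sub>M I ?M) \<in> borel_measurable lborel" by measurable
    then show ?thesis by simp
  qed
  have meas1: "(\<lambda>x. u (x(i := s))) \<in> borel_measurable (Pi\<^sub>M I ?M)"
    if [measurable]: "u \<in> borel_measurable (Pi\<^sub>M (insert i I) ?M)" for u :: "('i \<Rightarrow> real) \<Rightarrow> ennreal" and s
    by measurable
  have *: "(\<integral>\<^sup>+x. f (x(i := s)) \<partial>Pi\<^sub>M I ?M) * (\<integral>\<^sup>+x. g (x(i := t)) \<partial>Pi\<^sub>M I ?M)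
      \<le> (\<integral>\<^sup>+x. h (x(i := (s + t) / 2)) \<partial>Pi\<^sub>M I ?M)\<^sup>2" for s t
  proof (rule insert.IH)
    fix x y :: "'i \<Rightarrow> real" assume xy: "x \<in> extensional I" "y \<in> extensional I"
    have "f (x(i := s)) * g (y(i := t)) \<le> (h (\<lambda>j\<in>insert i I. ((x(i := s)) j + (y(i := t)) j) / 2))\<^sup>2"
      using xy by (intro insert.prems(4)) (auto simp: extensional_def)
    also have "(\<lambda>j\<in>insert i I. ((x(i := s)) j + (y(i := t)) j) / 2) = (\<lambda>j\<in>I. (x j + y j) / 2)(i := (s + t) / 2)"
      using insert.hyps(2) by (auto simp: fun_eq_iff)
    finally show "f (x(i := s)) * g (y(i := t)) \<le> (h ((\<lambda>j\<in>I. (x j + y j) / 2)(i := (s + t) / 2)))\<^sup>2" .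
  qed (rule meas1, fact)+
  show ?case
    unfolding lborel_product.product_nn_integral_insert_rev[OF insert.hyps(1,2) insert.prems(1)]
      lborel_product.product_nn_integral_insert_rev[OF insert.hyps(1,2) insert.prems(2)]
      lborel_product.product_nn_integral_insert_rev[OF insert.hyps(1,2) insert.prems(3)]
    by (rule prekopa_leindler_midpoint_real[OF meas meas meas *]) fact+
qed

text \<open>Common source of the translation and reflection invariance of the product
  measure.\<close>

lemma nn_integral_PiM_lborel_componentwise:
  fixes m :: "'n::finite \<Rightarrow> 'a::euclidean_space \<Rightarrow> 'a"
  assumes [measurable]: "\<And>i. m i \<in> borel_measurable borel" and m: "\<And>i. distr lborel borel (m i) = lborel"
    and [measurable]: "u \<in> borel_measurable (Pi\<^sub>M UNIV (\<lambda>_. lborel))"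
  shows "(\<integral>\<^sup>+x. u (\<lambda>i. m i (x i)) \<partial>Pi\<^sub>M UNIV (\<lambda>_. lborel)) = (\<integral>\<^sup>+x. u x \<partial>Pi\<^sub>M UNIV (\<lambda>_. lborel))"
proof -
  let ?P = "Pi\<^sub>M UNIV (\<lambda>_::'n. lborel :: 'a measure)"
  have [measurable]: "m i \<in> measurable lborel lborel" for i by simp
  have [measurable]: "(\<lambda>x i. m i (x i)) \<in> measurable ?P ?P"
    by (rule measurable_PiM_single') (auto simp: space_PiM)
  have "distr ?P ?P (\<lambda>x i. m i (x i)) = ?P"
  proof (rule lborel_product.PiM_eqI)
    fix A :: "'n \<Rightarrow> 'a set" assume A: "\<And>i. i \<in> UNIV \<Longrightarrow> A i \<in> sets lborel"
    have "emeasure (distr ?P ?P (\<lambda>x i. m i (x i))) (Pi\<^sub>E UNIV A) = emeasure ?P ((\<lambda>x i. m i (x i)) -` Pi\<^sub>E UNIV A \<inter> space ?P)"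
      using A by (subst emeasure_distr) (auto intro!: sets_PiM_I_finite)
    also have "(\<lambda>x i. m i (x i)) -` Pi\<^sub>E UNIV A \<inter> space ?P = Pi\<^sub>E UNIV (\<lambda>i. m i -` A i)"
      by (auto simp: space_PiM)
    also have "emeasure ?P \<dots> = (\<Prod>i\<in>UNIV. emeasure lborel (m i -` A i))"
      using A by (intro lborel_product.emeasure_PiM) (auto intro: measurable_sets_borel[where M=borel])
    also have "\<dots> = (\<Prod>i\<in>UNIV. emeasure (distr lborel borel (m i)) (A i))"
      using A by (intro prod.cong) (auto simp: emeasure_distr)
    finally show "emeasure (distr ?P ?P (\<lambda>x i. m i (x i))) (Pi\<^sub>E UNIV A) = (\<Prod>i\<in>UNIV. emeasure lborel (A i))"
      by (simp add: m)
  qed auto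
  then have "(\<integral>\<^sup>+x. u x \<partial>?P) = (\<integral>\<^sup>+x. u x \<partial>distr ?P ?P (\<lambda>x i. m i (x i)))" by simp
  also have "\<dots> = (\<integral>\<^sup>+x. u (\<lambda>i. m i (x i)) \<partial>?P)" by (subst nn_integral_distr) auto
  finally show ?thesis by simp
qed

lemma nn_integral_PiM_lborel_translate:
  fixes c :: "'n::finite \<Rightarrow> 'a::euclidean_space"
  assumes "u \<in> borel_measurable (Pi\<^sub>M UNIV (\<lambda>_. lborel))"
  shows "(\<integral>\<^sup>+x. u (\<lambda>i. x i + c i) \<partial>Pi\<^sub>M UNIV (\<lambda>_. lborel)) = (\<integral>\<^sup>+x. u x \<partial>Pi\<^sub>M UNIV (\<lambda>_. lborel))"
  using nn_integral_PiM_lborel_componentwise[of "\<lambda>i x. x + c i" u] assms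
    lborel_distr_plus[of "c _"] by (simp add: add.commute[of _ "c _"])

lemma nn_integral_PiM_lborel_uminus:
  assumes "u \<in> borel_measurable (Pi\<^sub>M UNIV (\<lambda>_::'n::finite. lborel :: real measure))"
  shows "(\<integral>\<^sup>+x. u (\<lambda>i. - x i) \<partial>Pi\<^sub>M UNIV (\<lambda>_. lborel)) = (\<integral>\<^sup>+x. u x \<partial>Pi\<^sub>M UNIV (\<lambda>_. lborel))"
  using nn_integral_PiM_lborel_componentwise[of "\<lambda>_. uminus" u] assms
  by (simp add: lborel_distr_uminus)

text \<open>A missing point \<open>s\<close> sits in a gap between the nearest points
  \<open>l\<close> and \<open>r\<close> of \<open>S\<close> on either side. The midpoint of
  \<open>l\<close> and \<open>r\<close> belongs to \<open>S\<close>, yet falls into this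
  gap.\<close>

lemma closed_midpoint_closed_real:
  fixes S :: "real set"
  assumes "closed S" and mid: "\<And>x y. x \<in> S \<Longrightarrow> y \<in> S \<Longrightarrow> (x + y) / 2 \<in> S" and "a \<in> S" "b \<in> S" "a \<le> b"
  shows "{a..b} \<subseteq> S"
proof (rule ccontr)
  assume "\<not> {a..b} \<subseteq> S"
  then obtain s where s: "a \<le> s" "s \<le> b" "s \<notin> S" unfolding subset_iff by auto
  define l r where "l = Sup (S \<inter> {a..s})" and "r = Inf (S \<inter> {s..b})"
  have "l \<in> S \<inter> {a..s}" unfolding l_def
    using \<open>closed S\<close> \<open>a \<in> S\<close> s by (intro closed_contains_Sup closed_Int) (auto intro!: bdd_aboveI[of _ s])
  moreover have "r \<in> S \<inter> {s..b}" unfolding r_def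
    using \<open>closed S\<close> \<open>b \<in> S\<close> s by (intro closed_contains_Inf closed_Int) (auto intro!: bdd_belowI[of _ s])
  ultimately have lr: "l \<in> S" "r \<in> S" "a \<le> l" "l < s" "s < r" "r \<le> b"
    using s(3) by (auto simp: less_le)
  show False
  proof (cases "(l + r) / 2 \<le> s")
    case True
    then have "(l + r) / 2 \<le> l"
      unfolding l_def[symmetric] using lr mid[OF lr(1,2)] unfolding l_def
      by (intro cSup_upper) (auto simp: l_def[symmetric] intro!: bdd_aboveI[of _ s])
    with lr show False by simp
  next
    case False
    then have "r \<le> (l + r) / 2"
      using lr mid[OF lr(1,2)] unfolding r_def
      by (intro cInf_lower) (auto simp: r_def[symmetric] intro!: bdd_belowI[of _ s])
    with lr show False by simp
  qed
qed

lemma prod_indicator_UNIV: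
  "(\<Prod>i\<in>UNIV. indicator (A i) (x i)) = (if \<forall>i::'n::finite. x i \<in> A i then 1 else (0::ennreal))"
  by (auto simp: prod.neutral indicator_def)

text \<open>As a function of \<open>s\<close> the volume is even, midpoint log-concave and upper semicontinuous.\<close>

lemma symmetric_midpoint_closed_Int_box_mono:
  fixes K :: "('n::finite \<Rightarrow> real) set" and c h :: "'n \<Rightarrow> real"
  assumes K[measurable]: "K \<in> sets (Pi\<^sub>M UNIV (\<lambda>_. lborel))"
    and K_mid: "\<And>x y. x \<in> K \<Longrightarrow> y \<in> K \<Longrightarrow> (\<lambda>i. (x i + y i) / 2) \<in> K"
    and K_sym: "\<And>x. x \<in> K \<Longrightarrow> (\<lambda>i. - x i) \<in> K"
    and s: "0 \<le> s" "s \<le> 1"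
  shows "(\<integral>\<^sup>+x. indicator K x * (\<Prod>i\<in>UNIV. indicator {c i - h i..c i + h i} (x i)) \<partial>Pi\<^sub>M UNIV (\<lambda>_. lborel))
    \<le> (\<integral>\<^sup>+x. indicator K x * (\<Prod>i\<in>UNIV. indicator {s * c i - h i..s * c i + h i} (x i)) \<partial>Pi\<^sub>M UNIV (\<lambda>_. lborel))"
proof -
  let ?P = "Pi\<^sub>M UNIV (\<lambda>_::'n. lborel :: real measure)"
  define \<phi> :: "real \<Rightarrow> ('n \<Rightarrow> real) \<Rightarrow> ennreal"
    where "\<phi> s x = indicator K x * (\<Prod>i\<in>UNIV. indicator {s * c i - h i..s * c i + h i} (x i))" for s x
  define \<psi> where "\<psi> s = (\<integral>\<^sup>+x. \<phi> s x \<partial>?P)" for s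
  have [measurable]: "\<phi> s \<in> borel_measurable ?P" for s unfolding \<phi>_def by measurable
  have \<phi>01: "\<phi> s x = (if x \<in> K \<and> (\<forall>i. \<bar>x i - s * c i\<bar> \<le> h i) then 1 else 0)" for s x
  proof -
    have "x i \<in> {s * c i - h i..s * c i + h i} \<longleftrightarrow> \<bar>x i - s * c i\<bar> \<le> h i" for i by auto
    then show ?thesis by (simp add: \<phi>_def prod_indicator_UNIV)
  qed
  \<comment> \<open>Log-concavity: \<open>K\<close> is midpoint closed, and the midpoint of points
    in the boxes for \<open>a\<close> and \<open>b\<close> lies in the box for
    \<open>(a + b) / 2\<close>.\<close>
  have mid: "\<psi> a * \<psi> b \<le> (\<psi> ((a + b) / 2))\<^sup>2" for a b
    unfolding \<psi>_def
  proof (rule prekopa_leindler_midpoint_PiM)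
    fix x y :: "'n \<Rightarrow> real"
    have "\<bar>(x i + y i) / 2 - (a + b) / 2 * c i\<bar> \<le> h i" if "\<bar>x i - a * c i\<bar> \<le> h i" "\<bar>y i - b * c i\<bar> \<le> h i" for i
      using that by (simp add: field_simps abs_le_iff)
    then show "\<phi> a x * \<phi> b y \<le> (\<phi> ((a + b) / 2) (\<lambda>i\<in>UNIV. (x i + y i) / 2))\<^sup>2"
      using K_mid[of x y] by (auto simp: \<phi>01 restrict_UNIV)
  qed auto
  have even: "\<psi> (- a) = \<psi> a" for a
  proof -
    have *: "(\<lambda>i. - x i) \<in> K \<longleftrightarrow> x \<in> K" for x using K_sym[of x] K_sym[of "\<lambda>i. - x i"] by auto
    have **: "\<bar>- x - (- a * c)\<bar> = \<bar>x - a * c\<bar>" for x c :: real by simp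
    have "\<psi> (- a) = (\<integral>\<^sup>+x. \<phi> (-a) (\<lambda>i. - x i) \<partial>?P)"
      unfolding \<psi>_def by (rule nn_integral_PiM_lborel_uminus[symmetric]) simp
    also have "\<dots> = \<psi> a" unfolding \<psi>_def \<phi>01 * ** ..
    finally show ?thesis .
  qed
  \<comment> \<open>Upper semicontinuity makes \<open>S\<close> closed, log-concavity makes it
    midpoint closed, and evenness puts -1 into it besides 1; so it contains everything
    between.\<close>
  define S where "S = {s. \<psi> 1 \<le> \<psi> s}"
  have "closed S"
    unfolding closed_sequential_limits
  proof (intro allI impI, elim conjE)
    fix \<sigma> :: "nat \<Rightarrow> real" and l assume \<sigma>: "\<forall>n. \<sigma> n \<in> S" "\<sigma> \<longlonglongrightarrow> l"
    obtain B where B: "\<And>n. \<bar>\<sigma> n\<bar> \<le> B"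
      using convergent_imp_Bseq[OF convergentI[OF \<sigma>(2)]] by (auto simp: Bseq_def)
    \<comment> \<open>One bounded box that contains the shifted boxes for all terms of the
      convergent sequence: the integrable majorant for the reverse Fatou lemma.\<close>
    define w :: "('n \<Rightarrow> real) \<Rightarrow> ennreal"
      where "w x = (\<Prod>i\<in>UNIV. indicator {- (B * \<bar>c i\<bar> + h i)..B * \<bar>c i\<bar> + h i} (x i))" for x
    have w01: "w x = (if \<forall>i. \<bar>x i\<bar> \<le> B * \<bar>c i\<bar> + h i then 1 else 0)" for x
    proof -
      have "x i \<in> {- (B * \<bar>c i\<bar> + h i)..B * \<bar>c i\<bar> + h i} \<longleftrightarrow> \<bar>x i\<bar> \<le> B * \<bar>c i\<bar> + h i" for i by auto
      then show ?thesis by (simp add: w_def prod_indicator_UNIV)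
    qed
    have [measurable]: "w \<in> borel_measurable ?P" unfolding w_def by measurable
    have "\<phi> (\<sigma> n) x \<le> w x" for n x
    proof -
      have "\<bar>x i\<bar> \<le> B * \<bar>c i\<bar> + h i" if "\<bar>x i - \<sigma> n * c i\<bar> \<le> h i" for i
        using that mult_right_mono[OF B[of n], of "\<bar>c i\<bar>"] by (simp add: abs_mult[symmetric])
      then show ?thesis by (auto simp: \<phi>01 w01)
    qed
    moreover have "(\<integral>\<^sup>+x. w x \<partial>?P) < \<infinity>"
      unfolding w_def by (subst lborel_product.product_nn_integral_prod) (auto simp: ennreal_prod_eq_top less_top[symmetric] emeasure_lborel_Icc_eq)
    ultimately have "limsup (\<lambda>n. \<psi> (\<sigma> n)) \<le> (\<integral>\<^sup>+x. limsup (\<lambda>n. \<phi> (\<sigma> n) x) \<partial>?P)"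
      unfolding \<psi>_def by (intro nn_integral_limsup[of _ _ w]) auto
    also have "\<dots> \<le> \<psi> l"
      unfolding \<psi>_def
    proof (rule nn_integral_mono)
      fix x
      show "limsup (\<lambda>n. \<phi> (\<sigma> n) x) \<le> \<phi> l x"
      proof (cases "x \<in> K \<and> (\<forall>i. \<bar>x i - l * c i\<bar> \<le> h i)")
        case True
        then show ?thesis by (intro Limsup_bounded) (auto simp: \<phi>01)
      next
        case False
        show ?thesis
        proof (cases "x \<in> K")
          case True
          with False obtain i where i: "\<bar>x i - l * c i\<bar> > h i" by (auto simp: not_le)
          have "(\<lambda>n. \<bar>x i - \<sigma> n * c i\<bar>) \<longlonglongrightarrow> \<bar>x i - l * c i\<bar>"
            using \<sigma>(2) by (intro tendsto_intros)
          then have "\<forall>\<^sub>F n in sequentially. \<bar>x i - \<sigma> n * c i\<bar> > h i"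
            using i by (rule order_tendstoD)
          then have "\<forall>\<^sub>F n in sequentially. \<phi> (\<sigma> n) x \<le> \<phi> l x"
          proof eventually_elim
            case (elim n)
            then have "\<phi> (\<sigma> n) x = 0" unfolding \<phi>01 using not_le by metis
            then show ?case by simp
          qed
          then show ?thesis by (rule Limsup_bounded)
        qed (simp add: \<phi>01 Limsup_const)
      qed
    qed
    also have "\<psi> 1 \<le> limsup (\<lambda>n. \<psi> (\<sigma> n))"
      using \<sigma>(1) by (intro le_Limsup) (auto simp: S_def)
    finally (xtrans) show "l \<in> S" by (simp add: S_def)
  qed
  moreover have "(a + b) / 2 \<in> S" if "a \<in> S" "b \<in> S" for a b
  proof -
    have "(\<psi> 1)\<^sup>2 \<le> \<psi> a * \<psi> b" using that by (auto simp: S_def power2_eq_square intro!: mult_mono)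
    also note mid
    finally have *: "(\<psi> 1)\<^sup>2 \<le> (\<psi> ((a + b) / 2))\<^sup>2" .
    show ?thesis
    proof (rule ccontr)
      assume "(a + b) / 2 \<notin> S"
      then have "\<psi> ((a + b) / 2) < \<psi> 1" by (simp add: S_def not_le)
      moreover have "x < y \<Longrightarrow> x * x < y * y" for x y :: ennreal
        by (cases x; cases y) (auto simp: ennreal_mult[symmetric] ennreal_less_iff mult_strict_mono' ennreal_top_mult less_top[symmetric])
      ultimately show False using * by (simp add: power2_eq_square not_le[symmetric])
    qed
  qed
  moreover have "1 \<in> S" "-1 \<in> S" using even[of 1] by (auto simp: S_def)
  ultimately have "{-1..1} \<subseteq> S" by (intro closed_midpoint_closed_real) auto
  with s have "\<psi> 1 \<le> \<psi> s" by (auto simp: S_def subset_iff)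
  then show ?thesis by (simp add: \<psi>_def \<phi>_def)
qed

section \<open>Sliding intervals\<close>

text \<open>Half-open intervals make merging exact: the indicators of \<open>[a, b)\<close> and
  \<open>[b, c)\<close> add up to that of \<open>[a, c)\<close>. The sum form allows a multilinear
  expansion over tuples of intervals.\<close>

definition intervals_indicator :: "(real \<times> real) list \<Rightarrow> real \<Rightarrow> ennreal" where
  "intervals_indicator xs t = (\<Sum>I\<leftarrow>xs. indicator {fst I..<snd I} t)"

definition intervals_length :: "(real \<times> real) list \<Rightarrow> real" where
  "intervals_length xs = (\<Sum>I\<leftarrow>xs. snd I - fst I)"

text \<open>Nonemptiness of \<open>J\<close> is built into the order relation because this makes it
  transitive, so that only neighbouring intervals have to be checked after a slide.\<close>

definition spaced_intervals :: "(real \<times> real) list \<Rightarrow> bool" where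
  "spaced_intervals xs \<longleftrightarrow> (\<forall>I\<in>set xs. fst I < snd I) \<and> sorted_wrt (\<lambda>I J. fst J < snd J \<and> snd I \<le> fst J) xs"

text \<open>The centre is multiplied by \<open>s\<close> and the length is kept;
  \<open>s = 1\<close> is the identity and \<open>s = 0\<close> centres the interval at the
  origin.\<close>

definition slide_interval :: "real \<Rightarrow> real \<times> real \<Rightarrow> real \<times> real" where
  "slide_interval s I = (s * ((fst I + snd I) / 2) - (snd I - fst I) / 2, s * ((fst I + snd I) / 2) + (snd I - fst I) / 2)"

lemma intervals_indicator_measurable [measurable]: "intervals_indicator xs \<in> borel_measurable borel"
  unfolding intervals_indicator_def[abs_def] by (induction xs) auto

text \<open>Multilinearity, used to reduce statements about unions of intervals or cells to single
  boxes.\<close>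

lemma nn_integral_mult_prod_sum:
  fixes \<phi> :: "'n::finite \<Rightarrow> 'j \<Rightarrow> 'a::euclidean_space \<Rightarrow> ennreal"
  assumes [measurable]: "w \<in> borel_measurable (Pi\<^sub>M UNIV (\<lambda>_. lborel))" "\<And>i j. \<phi> i j \<in> borel_measurable borel"
    and "\<And>i. finite (B i)"
  shows "(\<integral>\<^sup>+x. w x * (\<Prod>i\<in>UNIV. \<Sum>j\<in>B i. \<phi> i j (x i)) \<partial>Pi\<^sub>M UNIV (\<lambda>_. lborel))
    = (\<Sum>J\<in>Pi\<^sub>E UNIV B. \<integral>\<^sup>+x. w x * (\<Prod>i\<in>UNIV. \<phi> i (J i) (x i)) \<partial>Pi\<^sub>M UNIV (\<lambda>_. lborel))"
  using assms(3)
  by (subst nn_integral_sum[symmetric]) (auto simp: prod_sum_PiE sum_distrib_left)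

lemma AE_PiM_lborel_component_neq:
  "AE x in Pi\<^sub>M UNIV (\<lambda>_::'n::finite. lborel :: real measure). x i \<noteq> b"
proof (rule AE_I[where N="Pi\<^sub>E UNIV (\<lambda>j. if j = i then {b} else UNIV)"])
  show "emeasure (Pi\<^sub>M UNIV (\<lambda>_::'n. lborel :: real measure)) (Pi\<^sub>E UNIV (\<lambda>j. if j = i then {b} else UNIV)) = 0"
    by (subst lborel_product.emeasure_PiM) (auto intro!: prod_zero bexI[of _ i])
qed (auto intro!: sets_PiM_I_finite simp: space_PiM PiE_iff)

text \<open>Midpoint closedness takes the place of convexity, matching the midpoint form of
  Prekopa--Leindler.\<close>

locale symmetric_midpoint_closed =
  fixes K :: "('n::finite \<Rightarrow> real) set"
  assumes meas[measurable]: "K \<in> sets (Pi\<^sub>M UNIV (\<lambda>_. lborel))"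
    and mid: "\<And>x y. x \<in> K \<Longrightarrow> y \<in> K \<Longrightarrow> (\<lambda>i. (x i + y i) / 2) \<in> K"
    and sym: "\<And>x. x \<in> K \<Longrightarrow> (\<lambda>i. - x i) \<in> K"
begin

text \<open>Expanding the product gives one term per choice of an interval in each coordinate, that
  is, a box. Scaling the centre of a box by \<open>s\<close> is Anderson's inequality; the passage
  between half-open and closed boxes costs only null faces.\<close>

lemma nn_integral_intervals_slide:
  assumes "0 \<le> s" "s \<le> 1"
  shows "(\<integral>\<^sup>+x. indicator K x * (\<Prod>i\<in>UNIV. intervals_indicator (xs i) (x i)) \<partial>Pi\<^sub>M UNIV (\<lambda>_. lborel))
    \<le> (\<integral>\<^sup>+x. indicator K x * (\<Prod>i\<in>UNIV. intervals_indicator (map (slide_interval s) (xs i)) (x i)) \<partial>Pi\<^sub>M UNIV (\<lambda>_. lborel))"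
proof -
  let ?P = "Pi\<^sub>M UNIV (\<lambda>_::'n. lborel :: real measure)"
  define T where "T f = (\<integral>\<^sup>+x. indicator K x * (\<Prod>i\<in>UNIV. f i (x i)) \<partial>?P)" for f :: "'n \<Rightarrow> real \<Rightarrow> ennreal"
  have expand: "T (\<lambda>i. intervals_indicator (xs i))
    = (\<Sum>J\<in>Pi\<^sub>E UNIV (\<lambda>i. {0..<length (xs i)}). T (\<lambda>i. indicator {fst (xs i ! J i)..<snd (xs i ! J i)}))"
    for xs :: "'n \<Rightarrow> (real \<times> real) list"
  proof -
    have "intervals_indicator (xs i) t = (\<Sum>j\<in>{0..<length (xs i)}. indicator {fst (xs i ! j)..<snd (xs i ! j)} t)" for i t
      unfolding intervals_indicator_def sum_list_sum_nth by simp
    then show ?thesis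
      unfolding T_def
      using nn_integral_mult_prod_sum[of "indicator K" "\<lambda>i j. indicator {fst (xs i ! j)..<snd (xs i ! j)}" "\<lambda>i. {0..<length (xs i)}"]
      by simp
  qed
  have "T (\<lambda>i. indicator {fst (I i)..<snd (I i)}) \<le> T (\<lambda>i. indicator {fst (slide_interval s (I i))..<snd (slide_interval s (I i))})"
    for I :: "'n \<Rightarrow> real \<times> real"
  proof -
    define c h where "c i = (fst (I i) + snd (I i)) / 2" and "h i = (snd (I i) - fst (I i)) / 2" for i
    have ch: "fst (I i) = c i - h i" "snd (I i) = c i + h i" for i by (simp_all add: c_def h_def field_simps)
    have sl: "fst (slide_interval s (I i)) = s * c i - h i" "snd (slide_interval s (I i)) = s * c i + h i" for i
      by (simp_all add: slide_interval_def c_def h_def)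
    have "T (\<lambda>i. indicator {c i - h i..<c i + h i}) \<le> T (\<lambda>i. indicator {c i - h i..c i + h i})"
      unfolding T_def by (intro nn_integral_mono mult_left_mono) (auto simp: prod_indicator_UNIV less_imp_le)
    also have "\<dots> \<le> T (\<lambda>i. indicator {s * c i - h i..s * c i + h i})"
      unfolding T_def by (rule symmetric_midpoint_closed_Int_box_mono[OF meas mid sym assms])
    also have "\<dots> \<le> T (\<lambda>i. indicator {s * c i - h i..<s * c i + h i})"
      unfolding T_def
    proof (rule nn_integral_mono_AE)
      have "AE x in ?P. \<forall>i. x i \<noteq> s * c i + h i"
        using AE_PiM_lborel_component_neq by (subst AE_all_countable) auto
      then show "AE x in ?P. indicator K x * (\<Prod>i\<in>UNIV. indicator {s * c i - h i..s * c i + h i} (x i))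
        \<le> (indicator K x * (\<Prod>i\<in>UNIV. indicator {s * c i - h i..<s * c i + h i} (x i)) :: ennreal)"
        by eventually_elim (auto intro!: mult_left_mono simp: prod_indicator_UNIV less_le)
    qed
    finally show ?thesis by (simp add: ch sl)
  qed
  then have "T (\<lambda>i. intervals_indicator (xs i)) \<le> T (\<lambda>i. intervals_indicator (map (slide_interval s) (xs i)))"
    unfolding expand by (subst PiE_cong[of _ "\<lambda>i. {0..<length (map (slide_interval s) (xs i))}" "\<lambda>i. {0..<length (xs i)}"])
      (auto intro!: sum_mono simp: PiE_iff)
  then show ?thesis by (simp add: T_def)
qed

text \<open>All centres are pulled towards the origin by a common factor until two neighbouring intervals
  touch; these are merged, so the number of intervals drops.\<close>

lemma nn_integral_spaced_intervals_le:
  assumes "\<And>i. spaced_intervals (xs i)"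
  shows "(\<integral>\<^sup>+x. indicator K x * (\<Prod>i\<in>UNIV. intervals_indicator (xs i) (x i)) \<partial>Pi\<^sub>M UNIV (\<lambda>_. lborel))
    \<le> (\<integral>\<^sup>+x. indicator K x * (\<Prod>i\<in>UNIV. indicator {- intervals_length (xs i) / 2..intervals_length (xs i) / 2} (x i)) \<partial>Pi\<^sub>M UNIV (\<lambda>_. lborel))"
  using assms
proof (induction "\<Sum>i\<in>UNIV. length (xs i)" arbitrary: xs rule: less_induct)
  case (less xs)
  \<comment> \<open>A coordinate without intervals makes the left side zero; one interval in each
    coordinate needs a single slide to the origin; otherwise two intervals can be merged.\<close>
  consider (empty) i where "xs i = []" | (single) "\<forall>i. length (xs i) = 1" | (many) i where "length (xs i) \<ge> 2"
    by (metis One_nat_def Suc_1 Suc_leI length_greater_0_conv less_Suc0 linorder_neqE_nat not_less_eq_eq nle_le)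
  then show ?case
  proof cases
    case empty
    then have eq: "(\<Prod>i\<in>UNIV. intervals_indicator (xs i) (x i)) = 0" for x :: "'n \<Rightarrow> real"
      by (intro prod_zero) (auto simp: intervals_indicator_def intro!: exI[of _ i])
    show ?thesis unfolding eq by simp
  next
    case single
    have xs: "\<exists>a b. xs i = [(a, b)]" for i using single[rule_format, of i] by (cases "xs i") auto
    show ?thesis
      using nn_integral_intervals_slide[of 0 xs]
    proof (rule order_trans, goal_cases)
      case 3
      show ?case
      proof (intro nn_integral_mono mult_left_mono prod_mono_ennreal)
        fix x :: "'n \<Rightarrow> real" and i
        obtain a b where "xs i = [(a, b)]" using xs by blast
        then show "intervals_indicator (map (slide_interval 0) (xs i)) (x i) \<le> indicator {- intervals_length (xs i) / 2..intervals_length (xs i) / 2} (x i)"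
          by (auto simp: intervals_indicator_def intervals_length_def slide_interval_def field_simps split: split_indicator)
      qed auto
    qed auto
  next
    case many
    define m h where "m i j = (fst (xs i ! j) + snd (xs i ! j)) / 2" and "h i j = (snd (xs i ! j) - fst (xs i ! j)) / 2" for i j
    define Q where "Q = (SIGMA i:UNIV. {j. Suc j < length (xs i)})"
    \<comment> \<open>\<open>r (i, j)\<close> is the factor at which the intervals \<open>j\<close>
      and \<open>j + 1\<close> of coordinate \<open>i\<close> come into contact. As the factor
      decreases from 1, the largest of these values is reached first, so at the maximum some pair
      touches and none overlaps.\<close>
    define r where "r = (\<lambda>(i, j). (h i j + h i (Suc j)) / (m i (Suc j) - m i j))"
    have finQ: "finite Q" 
  proof -
    have "finite {j. Suc j < length (xs i)}" for i
      by (rule finite_subset[of _ "{..<length (xs i)}"]) auto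
    then show ?thesis unfolding Q_def by (intro finite_SigmaI) auto
  qed
    have neQ: "Q \<noteq> {}"
  proof -
    have "(i, 0) \<in> Q" using many by (auto simp: Q_def)
    then show ?thesis by auto
  qed
    have h_pos: "h i j > 0" if "j < length (xs i)" for i j
      using less.prems[of i] that by (auto simp: spaced_intervals_def h_def)
    have gap: "h i j + h i (Suc j) \<le> m i (Suc j) - m i j" if "Suc j < length (xs i)" for i j
    proof -
      have "snd (xs i ! j) \<le> fst (xs i ! Suc j)"
        using less.prems[of i] that by (auto simp: spaced_intervals_def sorted_wrt_iff_nth_less)
      then show ?thesis by (simp add: h_def m_def field_simps)
    qed
    define s where "s = Max (r ` Q)"
    have "s \<in> r ` Q" unfolding s_def using finQ neQ by (intro Max_in) auto
    then obtain i0 j0 where ij: "Suc j0 < length (xs i0)" "s = (h i0 j0 + h i0 (Suc j0)) / (m i0 (Suc j0) - m i0 j0)"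
      by (auto simp: Q_def r_def)
    have s: "0 \<le> s" "s \<le> 1"
      using gap[OF ij(1)] h_pos[OF ij(1)] h_pos[OF Suc_lessD[OF ij(1)]] by (auto simp: ij(2))
    have r_le: "h i j + h i (Suc j) \<le> s * (m i (Suc j) - m i j)" if "Suc j < length (xs i)" for i j
    proof -
      have "r (i, j) \<le> s" unfolding s_def using finQ that by (intro Max_ge) (auto simp: Q_def)
      moreover have "m i (Suc j) - m i j > 0" using gap[OF that] h_pos[OF that] h_pos[OF Suc_lessD[OF that]] by simp
      ultimately show ?thesis by (simp add: r_def pos_divide_le_eq)
    qed
    have r_eq: "h i0 j0 + h i0 (Suc j0) = s * (m i0 (Suc j0) - m i0 j0)"
      using gap[OF ij(1)] h_pos[OF ij(1)] h_pos[OF Suc_lessD[OF ij(1)]] by (simp add: ij(2))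
    define ys where "ys i = map (slide_interval s) (xs i)" for i
    have nth_ys: "ys i ! j = (s * m i j - h i j, s * m i j + h i j)" if "j < length (xs i)" for i j
      using that by (simp add: ys_def slide_interval_def m_def h_def)
    have sp: "spaced_intervals (ys i)" for i
    proof -
      have tr: "transp (\<lambda>I J :: real \<times> real. fst J < snd J \<and> snd I \<le> fst J)" by (auto simp: transp_def)
      have "fst I < snd I" if "I \<in> set (ys i)" for I
        using that h_pos[of _ i] by (auto simp: in_set_conv_nth nth_ys ys_def[of i, THEN arg_cong[where f=length]])
      moreover have "sorted_wrt (\<lambda>I J. fst J < snd J \<and> snd I \<le> fst J) (ys i)"
        unfolding sorted_wrt_iff_nth_Suc_transp[OF tr]
      proof (intro allI impI)
        fix j assume "Suc j < length (ys i)"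
        then have j: "Suc j < length (xs i)" by (simp add: ys_def)
        show "fst (ys i ! Suc j) < snd (ys i ! Suc j) \<and> snd (ys i ! j) \<le> fst (ys i ! Suc j)"
          using r_le[OF j] h_pos[OF j] j by (simp add: nth_ys algebra_simps)
      qed
      ultimately show ?thesis by (auto simp: spaced_intervals_def)
    qed
    have len: "intervals_length (ys i) = intervals_length (xs i)" for i
      by (simp add: ys_def intervals_length_def slide_interval_def comp_def)
    define ps qs where "ps = take j0 (ys i0)" and "qs = drop (Suc (Suc j0)) (ys i0)"
    obtain a b c where ys_eq: "ys i0 = ps @ (a, b) # (b, c) # qs"
    proof -
      have "ys i0 = take j0 (ys i0) @ ys i0 ! j0 # ys i0 ! Suc j0 # drop (Suc (Suc j0)) (ys i0)"
        using ij(1) by (metis Cons_nth_drop_Suc Suc_lessD append_take_drop_id length_map ys_def)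
      moreover have "fst (ys i0 ! Suc j0) = snd (ys i0 ! j0)"
        using r_eq ij(1) by (simp add: nth_ys algebra_simps)
      ultimately show ?thesis
        using that[of "fst (ys i0 ! j0)" "snd (ys i0 ! j0)" "snd (ys i0 ! Suc j0)"] by (simp add: ps_def qs_def) (metis prod.collapse)
    qed
    \<comment> \<open>The touching pair is replaced by its union: indicator and total length stay
      the same, and the list gets shorter.\<close>
    define zs where "zs = ys(i0 := ps @ (a, c) # qs)"
    have ab: "a < b" "b < c" using sp[of i0] by (auto simp: ys_eq spaced_intervals_def)
    have "(\<Sum>i\<in>UNIV. length (zs i)) < (\<Sum>i\<in>UNIV. length (ys i))"
      by (rule sum_strict_mono_ex1) (auto simp: zs_def ys_eq intro!: exI[of _ i0])
    also have "\<dots> = (\<Sum>i\<in>UNIV. length (xs i))" by (simp add: ys_def)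
    finally have *: "(\<Sum>i\<in>UNIV. length (zs i)) < (\<Sum>i\<in>UNIV. length (xs i))" .
    have spz: "spaced_intervals (zs i)" for i
      using sp[of i] ab unfolding zs_def
      by (cases "i = i0") (auto simp: spaced_intervals_def ys_eq sorted_wrt_append)
    have lenz: "intervals_length (zs i) = intervals_length (xs i)" for i
      unfolding len[of i, symmetric] by (cases "i = i0") (auto simp: zs_def ys_eq intervals_length_def)
    have "intervals_indicator (zs i) t = intervals_indicator (ys i) t" for i t
      using ab by (cases "i = i0") (auto simp: zs_def ys_eq intervals_indicator_def split: split_indicator)
    then show ?thesis
      using order_trans[OF nn_integral_intervals_slide[OF s, of xs]] less.hyps[OF *, OF spz]
      by (simp add: lenz ys_def)
  qed
qed

end

section \<open>Rearrangement on the real line\<close>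

context
  fixes w :: "'n::finite \<Rightarrow> 'e::euclidean_space"
begin

text \<open>The trace of the norm condition on a family of parallel lines, one per argument, with
  parameters \<open>t\<close>; \<open>w j\<close> will be the \<open>j\<close>-th column of the
  matrix.\<close>

definition slab :: "real \<Rightarrow> ('n \<Rightarrow> real) set" where
  "slab \<rho> = {t. norm (\<Sum>j\<in>UNIV. t j *\<^sub>R w j) \<le> \<rho>}"

lemma slab_symmetric_midpoint_closed: "symmetric_midpoint_closed (slab \<rho>)"
proof
  have "{t \<in> space (Pi\<^sub>M UNIV (\<lambda>_. lborel)). norm (\<Sum>j\<in>UNIV. t j *\<^sub>R w j) \<le> \<rho>} \<in> sets (Pi\<^sub>M UNIV (\<lambda>_::'n. lborel))"
    by measurable
  then show "slab \<rho> \<in> sets (Pi\<^sub>M UNIV (\<lambda>_. lborel))" by (simp add: slab_def space_PiM)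
  fix x y assume "x \<in> slab \<rho>" "y \<in> slab \<rho>"
  then have xy: "norm (\<Sum>j\<in>UNIV. x j *\<^sub>R w j) \<le> \<rho>" "norm (\<Sum>j\<in>UNIV. y j *\<^sub>R w j) \<le> \<rho>" by (auto simp: slab_def)
  have "(\<Sum>j\<in>UNIV. ((x j + y j) / 2) *\<^sub>R w j) = (1/2) *\<^sub>R ((\<Sum>j\<in>UNIV. x j *\<^sub>R w j) + (\<Sum>j\<in>UNIV. y j *\<^sub>R w j))"
    by (simp add: scaleR_sum_right sum.distrib[symmetric] scaleR_add_left scaleR_add_right add_divide_distrib)
  then show "(\<lambda>i. (x i + y i) / 2) \<in> slab \<rho>"
    using xy norm_triangle_ineq[of "\<Sum>j\<in>UNIV. x j *\<^sub>R w j" "\<Sum>j\<in>UNIV. y j *\<^sub>R w j"] by (simp add: slab_def)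
qed (simp add: slab_def sum_negf)

lemma slab_enlarge:
  assumes "t \<in> slab \<rho>" "\<And>i. \<bar>t' i - t i\<bar> \<le> \<delta>"
  shows "t' \<in> slab (\<rho> + \<delta> * (\<Sum>j\<in>UNIV. norm (w j)))"
proof -
  have "norm ((\<Sum>j\<in>UNIV. t' j *\<^sub>R w j) - (\<Sum>j\<in>UNIV. t j *\<^sub>R w j)) = norm (\<Sum>j\<in>UNIV. (t' j - t j) *\<^sub>R w j)"
    by (simp add: sum_subtractf scaleR_diff_left)
  also have "\<dots> \<le> (\<Sum>j\<in>UNIV. \<delta> * norm (w j))"
    by (rule sum_norm_le) (auto intro!: mult_right_mono assms)
  finally show ?thesis
    using assms(1) norm_triangle_ineq2[of "\<Sum>j\<in>UNIV. t' j *\<^sub>R w j" "\<Sum>j\<in>UNIV. t j *\<^sub>R w j"]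
    by (simp add: slab_def sum_distrib_left)
qed

text \<open>In each cell of width \<open>\<delta>\<close> the mass of \<open>g i\<close> is replaced by an interval of the same mass, which moves
  points by at most \<open>\<delta>\<close> in every coordinate.\<close>

lemma nn_integral_slab_le_enlarged:
  fixes g :: "'n \<Rightarrow> real \<Rightarrow> ennreal" and L :: "'n \<Rightarrow> real"
  assumes [measurable]: "\<And>i. g i \<in> borel_measurable borel" and g_le: "\<And>i t. g i t \<le> 1"
    and supp: "\<And>i t. \<bar>t\<bar> > R \<Longrightarrow> g i t = 0"
    and L: "\<And>i. (\<integral>\<^sup>+t. g i t \<partial>lborel) = ennreal (L i)" "\<And>i. L i \<ge> 0"
    and "\<delta> > 0"
  shows "(\<integral>\<^sup>+t. indicator (slab \<rho>) t * (\<Prod>i\<in>UNIV. g i (t i)) \<partial>Pi\<^sub>M UNIV (\<lambda>_. lborel))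
    \<le> (\<integral>\<^sup>+t. indicator (slab (\<rho> + \<delta> * (\<Sum>j\<in>UNIV. norm (w j)))) t * (\<Prod>i\<in>UNIV. indicator {- L i / 2..L i / 2} (t i)) \<partial>Pi\<^sub>M UNIV (\<lambda>_. lborel))"
proof -
  let ?P = "Pi\<^sub>M UNIV (\<lambda>_::'n. lborel :: real measure)"
  define \<rho>' where "\<rho>' = \<rho> + \<delta> * (\<Sum>j\<in>UNIV. norm (w j))"
  interpret S: symmetric_midpoint_closed "slab \<rho>" by (rule slab_symmetric_midpoint_closed)
  interpret S': symmetric_midpoint_closed "slab \<rho>'" by (rule slab_symmetric_midpoint_closed)
  \<comment> \<open>\<open>p\<close> cells of width \<open>\<delta>\<close>, starting at
    \<open>- R\<close>, cover the common support.\<close>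
  obtain p :: nat where p: "2 * R / \<delta> < p" using reals_Archimedean2 by blast
  define a where "a j = - R + real j * \<delta>" for j :: nat
  define cell where "cell j = {a j..<a (Suc j)}" for j
  have [measurable]: "cell j \<in> sets borel" for j by (simp add: cell_def)
  have a_Suc: "a (Suc j) = a j + \<delta>" for j by (simp add: a_def algebra_simps)
  have cell_iff: "t \<in> cell j \<longleftrightarrow> nat \<lfloor>(t + R) / \<delta>\<rfloor> = j \<and> t \<ge> - R" for t j
  proof -
    have "t \<in> cell j \<longleftrightarrow> of_nat j \<le> (t + R) / \<delta> \<and> (t + R) / \<delta> < of_nat j + 1"
      using \<open>\<delta> > 0\<close> by (auto simp: cell_def a_def field_simps)
    also have "\<dots> \<longleftrightarrow> \<lfloor>(t + R) / \<delta>\<rfloor> = int j" by (simp add: floor_eq_iff)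
    also have "\<dots> \<longleftrightarrow> nat \<lfloor>(t + R) / \<delta>\<rfloor> = j \<and> t \<ge> - R"
    proof -
      have "t \<ge> - R \<longleftrightarrow> 0 \<le> \<lfloor>(t + R) / \<delta>\<rfloor>" using \<open>\<delta> > 0\<close> by (auto simp: zero_le_divide_iff)
      moreover have "F = int j \<longleftrightarrow> nat F = j \<and> 0 \<le> F" for F by auto
      ultimately show ?thesis by blast
    qed
    finally show ?thesis .
  qed
  have split: "g i t = (\<Sum>j<p. g i t * indicator (cell j) t)" for i t
  proof (cases "\<bar>t\<bar> > R")
    case False
    define k where "k = nat \<lfloor>(t + R) / \<delta>\<rfloor>"
    have "(t + R) / \<delta> \<le> 2 * R / \<delta>" using False \<open>\<delta> > 0\<close> by (intro divide_right_mono) auto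
    with p have "(t + R) / \<delta> < p" by simp
    then have "k < p" using False \<open>\<delta> > 0\<close> unfolding k_def by (subst nat_less_iff) (auto simp: floor_less_iff)
    moreover have "indicator (cell j) t = (if j = k then 1 else 0 :: ennreal)" for j
      using False by (auto simp: cell_iff k_def indicator_def)
    ultimately show ?thesis by (simp add: if_distrib[of "(*) _"] cong: if_cong)
  qed (simp add: supp)
  define m where "m i j = enn2real (\<integral>\<^sup>+t. g i t * indicator (cell j) t \<partial>lborel)" for i j
  have cell_le: "(\<integral>\<^sup>+t. g i t * indicator (cell j) t \<partial>lborel) \<le> ennreal \<delta>" for i j
  proof -
    have "(\<integral>\<^sup>+t. g i t * indicator (cell j) t \<partial>lborel) \<le> (\<integral>\<^sup>+t. indicator (cell j) t \<partial>lborel)"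
      using g_le by (intro nn_integral_mono) (auto split: split_indicator)
    also have "\<dots> = ennreal \<delta>" using \<open>\<delta> > 0\<close> by (simp add: cell_def a_Suc)
    finally show ?thesis .
  qed
  have m: "(\<integral>\<^sup>+t. g i t * indicator (cell j) t \<partial>lborel) = ennreal (m i j)" "0 \<le> m i j" "m i j \<le> \<delta>" for i j
    using cell_le[of i j] \<open>\<delta> > 0\<close> by (auto simp: m_def less_top[symmetric] top_unique ennreal_enn2real_if enn2real_leI)
  define I where "I i j = {a j..<a j + m i j}" for i j
  have I_sub: "I i j \<subseteq> cell j" for i j using m(3)[of i j] by (auto simp: I_def cell_def a_Suc)
  \<comment> \<open>Cells without mass are dropped because \<open>spaced_intervals\<close> allows
    only nonempty intervals.\<close>
  define xs where "xs i = map (\<lambda>j. (a j, a j + m i j)) (filter (\<lambda>j. m i j > 0) [0..<p])" for i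
  have spaced: "spaced_intervals (xs i)" for i
  proof -
    have "sorted_wrt (\<lambda>j k. a k < a k + m i k \<and> a j + m i j \<le> a k) (filter (\<lambda>j. m i j > 0) [0..<p])"
    proof (rule sorted_wrt_mono_rel[of _ "(<)"])
      fix j k assume "j \<in> set (filter (\<lambda>j. m i j > 0) [0..<p])" and k: "k \<in> set (filter (\<lambda>j. m i j > 0) [0..<p])" and "j < k"
      then have "real (Suc j) * \<delta> \<le> real k * \<delta>" using \<open>\<delta> > 0\<close> by (intro mult_right_mono) auto
      then show "a k < a k + m i k \<and> a j + m i j \<le> a k"
        using m(3)[of i j] k by (auto simp: a_def algebra_simps)
    qed (intro sorted_wrt_filter sorted_wrt_upt)
    then show ?thesis by (auto simp: spaced_intervals_def xs_def sorted_wrt_map)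
  qed
  have ind: "intervals_indicator (xs i) t = (\<Sum>j<p. indicator (I i j) t)" for i t
  proof -
    have "intervals_indicator (xs i) t = (\<Sum>j\<leftarrow>filter (\<lambda>j. m i j > 0) [0..<p]. indicator (I i j) t)"
      by (simp add: intervals_indicator_def xs_def I_def comp_def)
    also have "\<dots> = (\<Sum>j\<leftarrow>[0..<p]. indicator (I i j) t)"
      by (rule sum_list_map_filter) (use m(2) in \<open>auto simp: I_def less_le\<close>)
    also have "\<dots> = (\<Sum>j<p. indicator (I i j) t)"
      by (simp add: interv_sum_list_conv_sum_set_nat atLeast0LessThan)
    finally show ?thesis .
  qed
  have len: "intervals_length (xs i) = L i" for i
  proof -
    have "intervals_length (xs i) = (\<Sum>j\<leftarrow>filter (\<lambda>j. m i j > 0) [0..<p]. m i j)"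
      by (simp add: intervals_length_def xs_def comp_def)
    also have "\<dots> = (\<Sum>j\<leftarrow>[0..<p]. m i j)"
      by (rule sum_list_map_filter) (use m(2) in \<open>auto simp: less_le\<close>)
    also have "\<dots> = (\<Sum>j<p. m i j)" by (simp add: interv_sum_list_conv_sum_set_nat atLeast0LessThan)
    finally have *: "intervals_length (xs i) = (\<Sum>j<p. m i j)" .
    have "ennreal (L i) = (\<integral>\<^sup>+t. (\<Sum>j<p. g i t * indicator (cell j) t) \<partial>lborel)"
      by (simp add: L(1)[symmetric] split[symmetric])
    also have "\<dots> = (\<Sum>j<p. ennreal (m i j))" by (subst nn_integral_sum) (auto simp: m)
    also have "\<dots> = ennreal (\<Sum>j<p. m i j)" using m(2) by (simp add: sum_ennreal)
    finally show ?thesis using * L(2) m(2) by (simp add: sum_nonneg)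
  qed
  \<comment> \<open>A box of cells that misses the slab contributes nothing. If it meets the slab,
    the enlarged slab contains the whole box of intervals; then the left side is at most, and the
    right side equal to, the product of the cell masses.\<close>
  have box: "(\<integral>\<^sup>+t. indicator (slab \<rho>) t * (\<Prod>i\<in>UNIV. g i (t i) * indicator (cell (J i)) (t i)) \<partial>?P)
    \<le> (\<integral>\<^sup>+t. indicator (slab \<rho>') t * (\<Prod>i\<in>UNIV. indicator (I i (J i)) (t i)) \<partial>?P)" for J
  proof (cases "\<exists>t0\<in>slab \<rho>. \<forall>i. t0 i \<in> cell (J i)")
    case True
    then obtain t0 where t0: "t0 \<in> slab \<rho>" "\<And>i. t0 i \<in> cell (J i)" by auto
    have "t \<in> slab \<rho>'" if "\<And>i. t i \<in> I i (J i)" for t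
      unfolding \<rho>'_def
    proof (rule slab_enlarge[OF t0(1)])
      fix i
      have "t i \<in> cell (J i)" using that I_sub by blast
      with t0(2)[of i] show "\<bar>t i - t0 i\<bar> \<le> \<delta>" by (auto simp: cell_def a_Suc)
    qed
    then have eq: "indicator (slab \<rho>') t * (\<Prod>i\<in>UNIV. indicator (I i (J i)) (t i)) = ((\<Prod>i\<in>UNIV. indicator (I i (J i)) (t i)) :: ennreal)" for t
      by (auto simp: prod_indicator_UNIV indicator_def)
    have "(\<integral>\<^sup>+t. indicator (slab \<rho>) t * (\<Prod>i\<in>UNIV. g i (t i) * indicator (cell (J i)) (t i)) \<partial>?P)
      \<le> (\<integral>\<^sup>+t. (\<Prod>i\<in>UNIV. g i (t i) * indicator (cell (J i)) (t i)) \<partial>?P)"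
      by (intro nn_integral_mono) (auto split: split_indicator)
    also have "\<dots> = (\<Prod>i\<in>UNIV. ennreal (m i (J i)))"
      using lborel_product.product_nn_integral_prod[of UNIV "\<lambda>i t. g i t * indicator (cell (J i)) t"] by (simp add: m)
    also have "\<dots> = (\<integral>\<^sup>+t. (\<Prod>i\<in>UNIV. indicator (I i (J i)) (t i)) \<partial>?P)"
      using lborel_product.product_nn_integral_prod[of UNIV "\<lambda>i t. indicator (I i (J i)) t"] m(2) by (simp add: I_def)
    finally show ?thesis unfolding eq .
  next
    case False
    have eq: "indicator (slab \<rho>) t * (\<Prod>i\<in>UNIV. g i (t i) * indicator (cell (J i)) (t i)) = 0" for t
    proof (cases "t \<in> slab \<rho>")
      case True
      with False obtain i where "t i \<notin> cell (J i)" by auto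
      then have "(\<Prod>i\<in>UNIV. g i (t i) * indicator (cell (J i)) (t i)) = 0"
        by (intro prod_zero bexI[of _ i]) auto
      then show ?thesis by (metis mult_zero_right)
    qed simp
    show ?thesis unfolding eq by simp
  qed
  have I_meas [measurable]: "I i j \<in> sets borel" for i j by (simp add: I_def)
  have "(\<integral>\<^sup>+t. indicator (slab \<rho>) t * (\<Prod>i\<in>UNIV. g i (t i)) \<partial>?P)
    = (\<integral>\<^sup>+t. indicator (slab \<rho>) t * (\<Prod>i\<in>UNIV. \<Sum>j<p. g i (t i) * indicator (cell j) (t i)) \<partial>?P)"
    by (simp only: split[symmetric])
  also have "\<dots> = (\<Sum>J\<in>Pi\<^sub>E UNIV (\<lambda>_. {..<p}). \<integral>\<^sup>+t. indicator (slab \<rho>) t * (\<Prod>i\<in>UNIV. g i (t i) * indicator (cell (J i)) (t i)) \<partial>?P)"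
    by (rule nn_integral_mult_prod_sum) auto
  also have "\<dots> \<le> (\<Sum>J\<in>Pi\<^sub>E UNIV (\<lambda>_. {..<p}). \<integral>\<^sup>+t. indicator (slab \<rho>') t * (\<Prod>i\<in>UNIV. indicator (I i (J i)) (t i)) \<partial>?P)"
    by (intro sum_mono box)
  also have "\<dots> = (\<integral>\<^sup>+t. indicator (slab \<rho>') t * (\<Prod>i\<in>UNIV. \<Sum>j<p. indicator (I i j) (t i)) \<partial>?P)"
    by (rule nn_integral_mult_prod_sum[symmetric]) auto
  also have "\<dots> = (\<integral>\<^sup>+t. indicator (slab \<rho>') t * (\<Prod>i\<in>UNIV. intervals_indicator (xs i) (t i)) \<partial>?P)"
    by (simp only: ind)
  also have "\<dots> \<le> (\<integral>\<^sup>+t. indicator (slab \<rho>') t * (\<Prod>i\<in>UNIV. indicator {- L i / 2..L i / 2} (t i)) \<partial>?P)"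
    using S'.nn_integral_spaced_intervals_le[OF spaced] by (simp only: len)
  finally show ?thesis by (simp only: \<rho>'_def)
qed

text \<open>As the cell width tends to 0, the enlarged slabs decrease to \<open>slab \<rho>\<close>.
  The bounded box supplies the finite integral required for a decreasing limit.\<close>

lemma nn_integral_slab_le:
  fixes g :: "'n \<Rightarrow> real \<Rightarrow> ennreal" and L :: "'n \<Rightarrow> real"
  assumes "\<And>i. g i \<in> borel_measurable borel" "\<And>i t. g i t \<le> 1" "\<And>i t. \<bar>t\<bar> > R \<Longrightarrow> g i t = 0"
    and L: "\<And>i. (\<integral>\<^sup>+t. g i t \<partial>lborel) = ennreal (L i)" "\<And>i. L i \<ge> 0"
  shows "(\<integral>\<^sup>+t. indicator (slab \<rho>) t * (\<Prod>i\<in>UNIV. g i (t i)) \<partial>Pi\<^sub>M UNIV (\<lambda>_. lborel))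
    \<le> (\<integral>\<^sup>+t. indicator (slab \<rho>) t * (\<Prod>i\<in>UNIV. indicator {- L i / 2<..<L i / 2} (t i)) \<partial>Pi\<^sub>M UNIV (\<lambda>_. lborel))"
proof -
  let ?P = "Pi\<^sub>M UNIV (\<lambda>_::'n. lborel :: real measure)"
  define c where "c = (\<Sum>j\<in>UNIV. norm (w j))"
  have "c \<ge> 0" by (simp add: c_def sum_nonneg)
  define \<sigma> where "\<sigma> n = \<rho> + inverse (real (Suc n)) * c" for n
  define F where "F n t = (indicator (slab (\<sigma> n)) t * (\<Prod>i\<in>UNIV. indicator {- L i / 2..L i / 2} (t i)) :: ennreal)" for n t
  have [measurable]: "slab r \<in> sets ?P" for r
    by (rule symmetric_midpoint_closed.meas[OF slab_symmetric_midpoint_closed])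
  have [measurable]: "F n \<in> borel_measurable ?P" for n unfolding F_def by measurable
  have \<sigma>_dec: "\<sigma> n \<le> \<sigma> m" if "m \<le> n" for m n
    using that \<open>c \<ge> 0\<close> by (auto simp: \<sigma>_def intro!: mult_right_mono le_imp_inverse_le)
  have dec: "decseq F"
    unfolding decseq_def
  proof (intro allI impI le_funI)
    fix m n t assume "m \<le> (n :: nat)"
    then have "slab (\<sigma> n) \<subseteq> slab (\<sigma> m)" using \<sigma>_dec[of m n] by (auto simp: slab_def)
    then show "F n t \<le> F m t" unfolding F_def by (intro mult_right_mono indicator_leI) auto
  qed
  have fin: "(\<integral>\<^sup>+t. F 0 t \<partial>?P) < \<infinity>"
  proof -
    have "(\<integral>\<^sup>+t. F 0 t \<partial>?P) \<le> (\<integral>\<^sup>+t. (\<Prod>i\<in>UNIV. indicator {- L i / 2..L i / 2} (t i)) \<partial>?P)"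
      by (intro nn_integral_mono) (auto simp: F_def split: split_indicator)
    also have "\<dots> < \<infinity>"
      by (subst lborel_product.product_nn_integral_prod) (auto simp: ennreal_prod_eq_top less_top[symmetric] emeasure_lborel_Icc_eq)
    finally show ?thesis .
  qed
  have "(\<integral>\<^sup>+t. indicator (slab \<rho>) t * (\<Prod>i\<in>UNIV. g i (t i)) \<partial>?P) \<le> (INF n. \<integral>\<^sup>+t. F n t \<partial>?P)"
    unfolding F_def \<sigma>_def c_def
    by (intro INF_greatest nn_integral_slab_le_enlarged[of g R]) (use assms in auto)
  also have "\<dots> = (\<integral>\<^sup>+t. (INF n. F n t) \<partial>?P)"
    using dec fin by (intro nn_integral_monotone_convergence_INF_decseq[symmetric]) auto
  also have "\<dots> \<le> (\<integral>\<^sup>+t. indicator (slab \<rho>) t * (\<Prod>i\<in>UNIV. indicator {- L i / 2..L i / 2} (t i)) \<partial>?P)"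
  proof (rule nn_integral_mono)
    fix t
    show "(INF n. F n t) \<le> indicator (slab \<rho>) t * (\<Prod>i\<in>UNIV. indicator {- L i / 2..L i / 2} (t i))"
    proof (cases "t \<in> slab \<rho>")
      case True
      have "F 0 t \<le> (\<Prod>i\<in>UNIV. indicator {- L i / 2..L i / 2} (t i))" by (auto simp: F_def split: split_indicator)
      with True show ?thesis by (auto intro: INF_lower2[of 0])
    next
      case False
      have "\<sigma> \<longlonglongrightarrow> \<rho> + 0 * c"
        unfolding \<sigma>_def by (intro tendsto_intros LIMSEQ_inverse_real_of_nat)
      moreover have "\<rho> + 0 * c < norm (\<Sum>j\<in>UNIV. t j *\<^sub>R w j)" using False by (auto simp: slab_def)
      ultimately have "\<forall>\<^sub>F n in sequentially. \<sigma> n < norm (\<Sum>j\<in>UNIV. t j *\<^sub>R w j)" by (rule order_tendstoD)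
      then obtain n where "\<sigma> n < norm (\<Sum>j\<in>UNIV. t j *\<^sub>R w j)" by (auto simp: eventually_sequentially)
      then have "F n t = 0" by (auto simp: F_def slab_def)
      then show ?thesis by (intro INF_lower2[of n]) auto
    qed
  qed
  \<comment> \<open>Endpoints are null; open intervals are the shape produced by the strict
    inequality in \<open>steiner\<close>.\<close>
  also have "\<dots> = (\<integral>\<^sup>+t. indicator (slab \<rho>) t * (\<Prod>i\<in>UNIV. indicator {- L i / 2<..<L i / 2} (t i)) \<partial>?P)"
  proof (rule nn_integral_cong_AE)
    have "AE t in ?P. \<forall>i. t i \<noteq> - L i / 2" "AE t in ?P. \<forall>i. t i \<noteq> L i / 2"
      by (subst AE_all_countable, rule allI, rule AE_PiM_lborel_component_neq)+
    then show "AE t in ?P. indicator (slab \<rho>) t * (\<Prod>i\<in>UNIV. indicator {- L i / 2..L i / 2} (t i))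
      = (indicator (slab \<rho>) t * (\<Prod>i\<in>UNIV. indicator {- L i / 2<..<L i / 2} (t i)) :: ennreal)"
    proof eventually_elim
      case (elim t)
      then have "t i \<in> {- L i / 2..L i / 2} \<longleftrightarrow> t i \<in> {- L i / 2<..<L i / 2}" for i
        unfolding atLeastAtMost_iff greaterThanLessThan_iff less_le by metis
      then show ?case by (simp only: prod_indicator_UNIV)
    qed
  qed
  finally show ?thesis .
qed

end

section \<open>Steiner symmetrization\<close>

text \<open>The weight has integral 1 along every fibre, so the identity needs only translation invariance and
  Tonelli's theorem, and no orthogonal coordinates adapted to \<open>v\<close>.\<close>

lemma nn_integral_PiM_lborel_fibres:
  fixes v :: "'a::euclidean_space" and \<Phi> :: "('n::finite \<Rightarrow> 'a) \<Rightarrow> ennreal"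
  assumes [measurable]: "\<Phi> \<in> borel_measurable (Pi\<^sub>M UNIV (\<lambda>_. lborel))" and v: "norm v = 1"
  shows "(\<integral>\<^sup>+x. \<Phi> x \<partial>Pi\<^sub>M UNIV (\<lambda>_. lborel)) =
    (\<integral>\<^sup>+x. (\<Prod>i\<in>UNIV. indicator {0..1} (x i \<bullet> v)) * (\<integral>\<^sup>+t. \<Phi> (\<lambda>i. x i + t i *\<^sub>R v) \<partial>Pi\<^sub>M UNIV (\<lambda>_. lborel)) \<partial>Pi\<^sub>M UNIV (\<lambda>_. lborel))"
proof -
  let ?P = "Pi\<^sub>M UNIV (\<lambda>_::'n. lborel :: 'a measure)" and ?R = "Pi\<^sub>M UNIV (\<lambda>_::'n. lborel :: real measure)"
  interpret P: finite_product_sigma_finite "\<lambda>_::'n. lborel :: 'a measure" UNIV by standard simp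
  interpret R: finite_product_sigma_finite "\<lambda>_::'n. lborel :: real measure" UNIV by standard simp
  interpret PR: pair_sigma_finite ?P ?R by unfold_locales
  define W :: "('n \<Rightarrow> 'a) \<Rightarrow> ennreal" where "W x = (\<Prod>i\<in>UNIV. indicator {0..1} (x i \<bullet> v))" for x
  have [measurable]: "W \<in> borel_measurable ?P" unfolding W_def by measurable
  have sh1[measurable]: "(\<lambda>z i. fst z i + snd z i *\<^sub>R v) \<in> measurable (?P \<Otimes>\<^sub>M ?R) ?P"
    by (rule measurable_PiM_single') (auto simp: space_PiM)
  have sh2[measurable]: "(\<lambda>z i. fst z i + (- snd z i) *\<^sub>R v) \<in> measurable (?P \<Otimes>\<^sub>M ?R) ?P"
    by (rule measurable_PiM_single') (auto simp: space_PiM)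
  have sh3[measurable]: "(\<lambda>x i. x i + t i *\<^sub>R v) \<in> measurable ?P ?P" for t
    by (rule measurable_PiM_single') (auto simp: space_PiM)
  have sh4[measurable]: "(\<lambda>t i. x i + t i *\<^sub>R v) \<in> measurable ?R ?P" for x
    by (rule measurable_PiM_single') (auto simp: space_PiM)
  have sh5[measurable]: "(\<lambda>t i. x i + - t i *\<^sub>R v) \<in> measurable ?R ?P" for x
    by (rule measurable_PiM_single') (auto simp: space_PiM)
  have one: "(\<integral>\<^sup>+t. W (\<lambda>i. x i + (- t i) *\<^sub>R v) \<partial>?R) = 1" for x
  proof -
    have "W (\<lambda>i. x i + (- t i) *\<^sub>R v) = (\<Prod>i\<in>UNIV. indicator {x i \<bullet> v - 1..x i \<bullet> v} (t i))" for t
      unfolding W_def using v by (intro prod.cong) (auto simp: inner_diff_left dot_square_norm split: split_indicator)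
    then show ?thesis
      using lborel_product.product_nn_integral_prod[of UNIV "\<lambda>i. indicator {x i \<bullet> v - 1..x i \<bullet> v}"] by simp
  qed
  have "(\<integral>\<^sup>+x. W x * (\<integral>\<^sup>+t. \<Phi> (\<lambda>i. x i + t i *\<^sub>R v) \<partial>?R) \<partial>?P) = (\<integral>\<^sup>+x. (\<integral>\<^sup>+t. W x * \<Phi> (\<lambda>i. x i + t i *\<^sub>R v) \<partial>?R) \<partial>?P)"
    by (intro nn_integral_cong nn_integral_cmult[symmetric]) measurable
  also have "\<dots> = (\<integral>\<^sup>+t. (\<integral>\<^sup>+x. W x * \<Phi> (\<lambda>i. x i + t i *\<^sub>R v) \<partial>?P) \<partial>?R)"
    using measurable_compose[OF sh1, of \<Phi>] by (intro PR.Fubini'[symmetric]) (simp add: split_beta')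
  also have "\<dots> = (\<integral>\<^sup>+t. (\<integral>\<^sup>+x. W (\<lambda>i. x i + (- t i) *\<^sub>R v) * \<Phi> x \<partial>?P) \<partial>?R)"
  proof (rule nn_integral_cong)
    fix t :: "'n \<Rightarrow> real"
    show "(\<integral>\<^sup>+x. W x * \<Phi> (\<lambda>i. x i + t i *\<^sub>R v) \<partial>?P) = (\<integral>\<^sup>+x. W (\<lambda>i. x i + (- t i) *\<^sub>R v) * \<Phi> x \<partial>?P)"
      using nn_integral_PiM_lborel_translate[of "\<lambda>x. W x * \<Phi> (\<lambda>i. x i + t i *\<^sub>R v)" "\<lambda>i. (- t i) *\<^sub>R v"] by simp
  qed
  also have "\<dots> = (\<integral>\<^sup>+x. (\<integral>\<^sup>+t. W (\<lambda>i. x i + (- t i) *\<^sub>R v) * \<Phi> x \<partial>?R) \<partial>?P)"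
    using measurable_compose[OF sh2, of W] by (intro PR.Fubini') (simp add: split_beta')
  also have "\<dots> = (\<integral>\<^sup>+x. \<Phi> x \<partial>?P)"
  proof (rule nn_integral_cong)
    fix x
    have "(\<integral>\<^sup>+t. W (\<lambda>i. x i + (- t i) *\<^sub>R v) * \<Phi> x \<partial>?R) = (\<integral>\<^sup>+t. W (\<lambda>i. x i + (- t i) *\<^sub>R v) \<partial>?R) * \<Phi> x"
      by (rule nn_integral_multc) (use measurable_compose[OF sh5, of W] in simp)
    then show "(\<integral>\<^sup>+t. W (\<lambda>i. x i + (- t i) *\<^sub>R v) * \<Phi> x \<partial>?R) = \<Phi> x" by (simp only: one mult_1)
  qed
  finally show ?thesis by (simp add: W_def)
qed

lemma nn_integral_lborel_translate:
  fixes f :: "'a::euclidean_space \<Rightarrow> ennreal"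
  assumes [measurable]: "f \<in> borel_measurable borel"
  shows "(\<integral>\<^sup>+x. f (x + c) \<partial>lborel) = (\<integral>\<^sup>+x. f x \<partial>lborel)"
proof -
  have "(\<integral>\<^sup>+x. f x \<partial>lborel) = (\<integral>\<^sup>+x. f x \<partial>distr lborel borel ((+) c))" by (simp add: lborel_distr_plus)
  also have "\<dots> = (\<integral>\<^sup>+x. f (c + x) \<partial>lborel)" by (subst nn_integral_distr) auto
  finally show ?thesis by (simp add: add.commute)
qed

lemma nn_integral_lborel_fibres:
  fixes v :: "'a::euclidean_space" and \<Phi> :: "'a \<Rightarrow> ennreal"
  assumes [measurable]: "\<Phi> \<in> borel_measurable borel" and v: "norm v = 1"
  shows "(\<integral>\<^sup>+x. \<Phi> x \<partial>lborel) = (\<integral>\<^sup>+x. indicator {0..1} (x \<bullet> v) * (\<integral>\<^sup>+t. \<Phi> (x + t *\<^sub>R v) \<partial>lborel) \<partial>lborel)"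
proof -
  have one: "(\<integral>\<^sup>+t. indicator {0..1} ((x + (- t) *\<^sub>R v) \<bullet> v) \<partial>lborel) = (1::ennreal)" for x :: 'a
  proof -
    have "indicator {0..1} ((x + (- t) *\<^sub>R v) \<bullet> v) = (indicator {x \<bullet> v - 1..x \<bullet> v} t :: ennreal)" for t
      using v by (auto simp: inner_diff_left dot_square_norm split: split_indicator)
    then show ?thesis by simp
  qed
  have "(\<integral>\<^sup>+x. indicator {0..1} (x \<bullet> v) * (\<integral>\<^sup>+t. \<Phi> (x + t *\<^sub>R v) \<partial>lborel) \<partial>lborel)
    = (\<integral>\<^sup>+x. (\<integral>\<^sup>+t. indicator {0..1} (x \<bullet> v) * \<Phi> (x + t *\<^sub>R v) \<partial>lborel) \<partial>lborel)"
    by (intro nn_integral_cong nn_integral_cmult[symmetric]) measurable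
  also have "\<dots> = (\<integral>\<^sup>+t. (\<integral>\<^sup>+x. indicator {0..1} (x \<bullet> v) * \<Phi> (x + t *\<^sub>R v) \<partial>lborel) \<partial>lborel)"
    by (intro lborel_pair.Fubini'[symmetric]) measurable
  also have "\<dots> = (\<integral>\<^sup>+t. (\<integral>\<^sup>+x. indicator {0..1} ((x + (- t) *\<^sub>R v) \<bullet> v) * \<Phi> x \<partial>lborel) \<partial>lborel)"
  proof (rule nn_integral_cong)
    fix t :: real
    show "(\<integral>\<^sup>+x. indicator {0..1} (x \<bullet> v) * \<Phi> (x + t *\<^sub>R v) \<partial>lborel) = (\<integral>\<^sup>+x. indicator {0..1} ((x + (- t) *\<^sub>R v) \<bullet> v) * \<Phi> x \<partial>lborel)"
      using nn_integral_lborel_translate[of "\<lambda>x. indicator {0..1} (x \<bullet> v) * \<Phi> (x + t *\<^sub>R v)" "(- t) *\<^sub>R v"] by simp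
  qed
  also have "\<dots> = (\<integral>\<^sup>+x. (\<integral>\<^sup>+t. indicator {0..1} ((x + (- t) *\<^sub>R v) \<bullet> v) * \<Phi> x \<partial>lborel) \<partial>lborel)"
    by (intro lborel_pair.Fubini') measurable
  also have "\<dots> = (\<integral>\<^sup>+x. \<Phi> x \<partial>lborel)"
  proof (rule nn_integral_cong)
    fix x :: 'a
    have "(\<integral>\<^sup>+t. indicator {0..1} ((x + (- t) *\<^sub>R v) \<bullet> v) * \<Phi> x \<partial>lborel) = (\<integral>\<^sup>+t. indicator {0..1} ((x + (- t) *\<^sub>R v) \<bullet> v) \<partial>lborel) * \<Phi> x"
      by (rule nn_integral_multc) measurable
    then show "(\<integral>\<^sup>+t. indicator {0..1} ((x + (- t) *\<^sub>R v) \<bullet> v) * \<Phi> x \<partial>lborel) = \<Phi> x" by (simp only: one mult_1)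
  qed
  finally show ?thesis by simp
qed

definition line_mass :: "'a::euclidean_space \<Rightarrow> ('a \<Rightarrow> ennreal) \<Rightarrow> 'a \<Rightarrow> ennreal" where
  "line_mass v f x = (\<integral>\<^sup>+t. f (x + t *\<^sub>R v) \<partial>lborel)"

text \<open>The inequality is strict so that lines without mass stay empty.\<close>

definition steiner :: "'a::euclidean_space \<Rightarrow> ('a \<Rightarrow> ennreal) \<Rightarrow> 'a \<Rightarrow> ennreal" where
  "steiner v f x = (if ennreal (2 * \<bar>x \<bullet> v\<bar>) < line_mass v f x then 1 else 0)"

text \<open>The bounds make every line mass finite. The same \<open>R\<close> survives every
  symmetrization, so it limits the relevant translations \<open>h\<close> throughout.\<close>

definition subdensity :: "real \<Rightarrow> ('a::euclidean_space \<Rightarrow> ennreal) \<Rightarrow> bool" where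
  "subdensity R f \<longleftrightarrow> f \<in> borel_measurable borel \<and> (\<forall>x. f x \<le> 1) \<and> (\<forall>x. R < norm x \<longrightarrow> f x = 0)"

lemma subdensityD:
  assumes "subdensity R f"
  shows "f \<in> borel_measurable borel" "f x \<le> 1" "R < norm x \<Longrightarrow> f x = 0"
  using assms by (auto simp: subdensity_def)

lemma line_mass_measurable [measurable]:
  assumes [measurable]: "f \<in> borel_measurable borel"
  shows "line_mass v f \<in> borel_measurable borel"
  unfolding line_mass_def[abs_def] by measurable

lemma steiner_measurable [measurable]:
  "f \<in> borel_measurable borel \<Longrightarrow> steiner v f \<in> borel_measurable borel"
  unfolding steiner_def[abs_def] by measurable

lemma line_mass_shift:
  assumes [measurable]: "f \<in> borel_measurable borel"
  shows "line_mass v f (x + s *\<^sub>R v) = line_mass v f x"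
  using nn_integral_lborel_translate[of "\<lambda>t. f (x + t *\<^sub>R v)" s]
  by (simp add: line_mass_def algebra_simps)

lemma norm_add_scaleR_orthogonal:
  fixes v x :: "'a::euclidean_space"
  assumes "norm v = 1" "x \<bullet> v = 0"
  shows "(norm (x + t *\<^sub>R v))\<^sup>2 = (norm x)\<^sup>2 + t\<^sup>2"
  using assms norm_add_Pythagorean[of x "t *\<^sub>R v"] by (simp add: orthogonal_def)

text \<open>A density of at most 1 that lives on the chord cut from the ball of radius
  \<open>R\<close> has at most the chord length as its mass.\<close>

lemma line_mass_le:
  assumes f: "subdensity R f" and v: "norm v = 1" and x: "x \<bullet> v = 0" "norm x \<le> R"
  shows "line_mass v f x \<le> ennreal (2 * sqrt (R\<^sup>2 - (norm x)\<^sup>2))"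
proof -
  let ?r = "sqrt (R\<^sup>2 - (norm x)\<^sup>2)"
  have "line_mass v f x \<le> (\<integral>\<^sup>+t. indicator {- ?r..?r} t \<partial>lborel)"
    unfolding line_mass_def
  proof (rule nn_integral_mono)
    fix t
    have nrm: "(norm (x + t *\<^sub>R v))\<^sup>2 = (norm x)\<^sup>2 + t\<^sup>2"
      by (rule norm_add_scaleR_orthogonal[OF v x(1)])
    show "f (x + t *\<^sub>R v) \<le> indicator {- ?r..?r} t"
    proof (cases "norm (x + t *\<^sub>R v) \<le> R")
      case True
      then have "(norm x)\<^sup>2 + t\<^sup>2 \<le> R\<^sup>2" unfolding nrm[symmetric] by (intro power_mono) auto
      then have "\<bar>t\<bar> \<le> ?r" by (intro real_le_rsqrt) simp
      then show ?thesis using subdensityD(2)[OF f] by (auto simp: indicator_def abs_le_iff)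
    next
      case False
      then show ?thesis using subdensityD(3)[OF f] by simp
    qed
  qed
  also have "\<dots> = ennreal (2 * ?r)"
    using x(2) by (simp add: power_mono)
  finally show ?thesis .
qed

lemma steiner_line:
  assumes "f \<in> borel_measurable borel" "norm v = 1" "x \<bullet> v = 0"
    and "line_mass v f x = ennreal L" "L \<ge> 0"
  shows "steiner v f (x + t *\<^sub>R v) = indicator {- L / 2<..<L / 2} t"
  using assms by (auto simp: steiner_def line_mass_shift inner_add_left dot_square_norm ennreal_less_iff split: split_indicator)

lemma line_mass_eq_0:
  assumes f: "subdensity R f" and v: "norm v = 1" and x: "x \<bullet> v = 0" "norm x > R" and "R \<ge> 0"
  shows "line_mass v f x = 0"
proof -
  have "norm (x + t *\<^sub>R v) > R" for t
  proof -
    have "(norm (x + t *\<^sub>R v))\<^sup>2 = (norm x)\<^sup>2 + t\<^sup>2"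
      by (rule norm_add_scaleR_orthogonal[OF v x(1)])
    then have "(norm x)\<^sup>2 \<le> (norm (x + t *\<^sub>R v))\<^sup>2" by simp
    then have "norm x \<le> norm (x + t *\<^sub>R v)" by (rule power2_le_imp_le) simp
    with x(2) show ?thesis by simp
  qed
  then show ?thesis using subdensityD(3)[OF f] by (simp add: line_mass_def)
qed

lemma orthogonal_remainder:
  fixes v x :: "'a::euclidean_space"
  assumes "norm v = 1"
  obtains w where "w \<bullet> v = 0" "x = w + (x \<bullet> v) *\<^sub>R v"
  using assms that[of "x - (x \<bullet> v) *\<^sub>R v"] by (simp add: inner_diff_left dot_square_norm)

lemma line_mass_finite:
  assumes "subdensity R f" "norm v = 1" "R \<ge> 0"
  obtains L where "line_mass v f x = ennreal L" "L \<ge> 0"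
proof -
  obtain w where w: "w \<bullet> v = 0" "x = w + (x \<bullet> v) *\<^sub>R v" using orthogonal_remainder[OF assms(2)] by metis
  have eq: "line_mass v f x = line_mass v f w"
    by (subst w(2)) (rule line_mass_shift[OF subdensityD(1)[OF assms(1)]])
  have "line_mass v f w < \<infinity>"
  proof (cases "norm w \<le> R")
    case True
    then show ?thesis using line_mass_le[OF assms(1,2) w(1)] by (simp add: le_less_trans)
  next
    case False
    then show ?thesis using line_mass_eq_0[OF assms(1,2) w(1) _ assms(3)] by simp
  qed
  then show thesis using that eq by (cases "line_mass v f w") auto
qed

text \<open>A line carries at most the length of its chord in the ball of radius \<open>R\<close>,
  and a centred interval of at most that length stays inside the chord.\<close>

lemma subdensity_steiner:
  assumes f: "subdensity R f" and v: "norm v = 1" and "R \<ge> 0"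
  shows "subdensity R (steiner v f)"
  unfolding subdensity_def
proof (intro conjI allI impI)
  show "steiner v f \<in> borel_measurable borel" using subdensityD(1)[OF f] by measurable
  fix x
  show "steiner v f x \<le> 1" by (simp add: steiner_def)
  assume x: "R < norm x"
  obtain w where w: "w \<bullet> v = 0" "x = w + (x \<bullet> v) *\<^sub>R v" using orthogonal_remainder[OF v] by metis
  have eq: "line_mass v f x = line_mass v f w"
    by (subst w(2)) (rule line_mass_shift[OF subdensityD(1)[OF f]])
  have "line_mass v f w \<le> ennreal (2 * \<bar>x \<bullet> v\<bar>)"
  proof (cases "norm w \<le> R")
    case True
    have "(norm x)\<^sup>2 = (norm w)\<^sup>2 + (x \<bullet> v)\<^sup>2"
      by (subst w(2)) (rule norm_add_scaleR_orthogonal[OF v w(1)])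
    moreover have "R\<^sup>2 < (norm x)\<^sup>2" using x \<open>R \<ge> 0\<close> by (intro power_strict_mono) auto
    ultimately have "sqrt (R\<^sup>2 - (norm w)\<^sup>2) \<le> sqrt ((x \<bullet> v)\<^sup>2)" by (intro real_sqrt_le_mono) simp
    then have "ennreal (2 * sqrt (R\<^sup>2 - (norm w)\<^sup>2)) \<le> ennreal (2 * \<bar>x \<bullet> v\<bar>)" by (intro ennreal_leI) simp
    with line_mass_le[OF f v w(1) True] show ?thesis by (rule order_trans)
  next
    case False
    then show ?thesis using line_mass_eq_0[OF f v w(1) _ \<open>R \<ge> 0\<close>] by simp
  qed
  then show "steiner v f x = 0" by (simp add: steiner_def eq not_less[symmetric])
qed

lemma line_mass_steiner:
  assumes f: "subdensity R f" and v: "norm v = 1" and "R \<ge> 0"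
  shows "line_mass v (steiner v f) x = line_mass v f x"
proof -
  have [measurable]: "f \<in> borel_measurable borel" by (rule subdensityD(1)[OF f])
  obtain w where w: "w \<bullet> v = 0" "x = w + (x \<bullet> v) *\<^sub>R v" using orthogonal_remainder[OF v] by metis
  obtain L where L: "line_mass v f w = ennreal L" "L \<ge> 0" by (rule line_mass_finite[OF assms])
  have "line_mass v (steiner v f) x = line_mass v (steiner v f) w" by (subst w(2)) (rule line_mass_shift, measurable)
  also have "\<dots> = (\<integral>\<^sup>+t. indicator {- L / 2<..<L / 2} t \<partial>lborel)"
    unfolding line_mass_def by (simp add: steiner_line[OF _ v w(1) L])
  also have "\<dots> = line_mass v f w" using L by simp
  also have "\<dots> = line_mass v f (w + (x \<bullet> v) *\<^sub>R v)" by (rule line_mass_shift[symmetric]) measurable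
  finally show ?thesis by (simp only: w(2)[symmetric])
qed

lemma nn_integral_steiner:
  assumes f: "subdensity R f" and v: "norm v = 1" and "R \<ge> 0"
  shows "(\<integral>\<^sup>+x. steiner v f x \<partial>lborel) = (\<integral>\<^sup>+x. f x \<partial>lborel)"
proof -
  have [measurable]: "f \<in> borel_measurable borel" by (rule subdensityD(1)[OF f])
  have "(\<integral>\<^sup>+x. steiner v f x \<partial>lborel) = (\<integral>\<^sup>+x. indicator {0..1} (x \<bullet> v) * line_mass v (steiner v f) x \<partial>lborel)"
    unfolding line_mass_def by (rule nn_integral_lborel_fibres[OF _ v]) measurable
  also have "\<dots> = (\<integral>\<^sup>+x. f x \<partial>lborel)"
    unfolding line_mass_steiner[OF assms] unfolding line_mass_def
    by (rule nn_integral_lborel_fibres[OF _ v, symmetric]) measurable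
  finally show ?thesis .
qed

section \<open>The effect of one symmetrization\<close>

text \<open>Points are functions rather than vectors of vectors, because the product measures live
  on function spaces.\<close>

definition kron_slab :: "real^'n^'k \<Rightarrow> real \<Rightarrow> ('n::finite \<Rightarrow> 'a::euclidean_space) set" where
  "kron_slab A \<epsilon> = {x. norm (\<chi> l. \<Sum>j\<in>UNIV. (A $ l $ j) *\<^sub>R x j) \<le> \<epsilon>}"

lemma kron_slab_measurable [measurable]:
  "kron_slab (A :: real^'n^'k) \<epsilon> \<in> sets (Pi\<^sub>M UNIV (\<lambda>_::'n::finite. lborel :: 'a::euclidean_space measure))"
proof -
  have eq: "norm (\<chi> l. \<Sum>j\<in>UNIV. (A $ l $ j) *\<^sub>R x j) = sqrt (\<Sum>l\<in>UNIV. (norm (\<Sum>j\<in>UNIV. (A $ l $ j) *\<^sub>R x j))\<^sup>2)" for x :: "'n \<Rightarrow> 'a"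
    by (simp add: norm_vec_def L2_set_def)
  have "{x \<in> space (Pi\<^sub>M UNIV (\<lambda>_::'n. lborel :: 'a measure)). sqrt (\<Sum>l\<in>UNIV. (norm (\<Sum>j\<in>UNIV. (A $ l $ j) *\<^sub>R x j))\<^sup>2) \<le> \<epsilon>}
     \<in> sets (Pi\<^sub>M UNIV (\<lambda>_::'n. lborel :: 'a measure))"
    by measurable
  then show ?thesis by (simp add: kron_slab_def eq space_PiM)
qed

text \<open>In every block the component along \<open>v\<close> is orthogonal to the rest, so
  squared norms add up and \<open>\<epsilon>\<^sup>2 - y\<^sup>2\<close> remains for the parameters
  \<open>t\<close>. The conjunct \<open>y \<le> \<epsilon>\<close> also excludes negative
  \<open>\<epsilon>\<close>, whose sign is lost in the square.\<close>

lemma kron_slab_fibre: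
  fixes A :: "real^'n^'k" and v :: "'a::euclidean_space"
  assumes v: "norm v = 1" and x: "\<And>i. x i \<bullet> v = 0"
  defines "y \<equiv> norm (\<chi> l. \<Sum>j\<in>UNIV. (A $ l $ j) *\<^sub>R x j)"
  shows "(\<lambda>i. x i + t i *\<^sub>R v) \<in> kron_slab A \<epsilon> \<longleftrightarrow> y \<le> \<epsilon> \<and> t \<in> slab (\<lambda>j. column j A) (sqrt (\<epsilon>\<^sup>2 - y\<^sup>2))"
proof -
  let ?z = "norm (\<chi> l. \<Sum>j\<in>UNIV. (A $ l $ j) *\<^sub>R (x j + t j *\<^sub>R v))" and ?q = "norm (\<Sum>j\<in>UNIV. t j *\<^sub>R column j A)"
  have sq: "(norm u)\<^sup>2 = (\<Sum>l\<in>UNIV. (norm (u $ l))\<^sup>2)" for u :: "'b::real_normed_vector ^ 'k"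
    by (simp add: norm_vec_def L2_set_def sum_nonneg)
  have "(\<Sum>j\<in>UNIV. (A $ l $ j) *\<^sub>R (x j + t j *\<^sub>R v)) = (\<Sum>j\<in>UNIV. (A $ l $ j) *\<^sub>R x j) + (\<Sum>j\<in>UNIV. t j * A $ l $ j) *\<^sub>R v" for l
    by (simp add: scaleR_add_right sum.distrib scaleR_sum_left mult.commute)
  moreover have "(\<Sum>j\<in>UNIV. (A $ l $ j) *\<^sub>R x j) \<bullet> v = 0" for l
    using x by (simp add: inner_sum_left)
  ultimately have "?z\<^sup>2 = (\<Sum>l\<in>UNIV. (norm (\<Sum>j\<in>UNIV. (A $ l $ j) *\<^sub>R x j))\<^sup>2 + (\<Sum>j\<in>UNIV. t j * A $ l $ j)\<^sup>2)"
    by (simp add: sq norm_add_scaleR_orthogonal[OF v])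
  also have "\<dots> = y\<^sup>2 + ?q\<^sup>2" by (simp add: y_def sq sum.distrib column_def)
  finally have z: "?z\<^sup>2 = y\<^sup>2 + ?q\<^sup>2" .
  have "?z \<le> \<epsilon> \<longleftrightarrow> y \<le> \<epsilon> \<and> ?q \<le> sqrt (\<epsilon>\<^sup>2 - y\<^sup>2)"
  proof
    assume le: "?z \<le> \<epsilon>"
    then have le2: "y\<^sup>2 + ?q\<^sup>2 \<le> \<epsilon>\<^sup>2" unfolding z[symmetric] by (intro power_mono) auto
    then have "y\<^sup>2 \<le> \<epsilon>\<^sup>2" using zero_le_power2[of ?q] by linarith
    moreover have "0 \<le> \<epsilon>" using le norm_ge_zero order_trans by blast
    ultimately have "y \<le> \<epsilon>" by (rule power2_le_imp_le)
    moreover have "?q \<le> sqrt (\<epsilon>\<^sup>2 - y\<^sup>2)" using le2 by (intro real_le_rsqrt) simp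
    ultimately show "y \<le> \<epsilon> \<and> ?q \<le> sqrt (\<epsilon>\<^sup>2 - y\<^sup>2)" by simp
  next
    assume le: "y \<le> \<epsilon> \<and> ?q \<le> sqrt (\<epsilon>\<^sup>2 - y\<^sup>2)"
    have "0 \<le> y" by (simp add: y_def)
    with le have "y\<^sup>2 \<le> \<epsilon>\<^sup>2" by (intro power_mono) auto
    moreover have "?q\<^sup>2 \<le> (sqrt (\<epsilon>\<^sup>2 - y\<^sup>2))\<^sup>2" using le by (intro power_mono) auto
    ultimately have "?z\<^sup>2 \<le> \<epsilon>\<^sup>2" by (simp add: z)
    then show "?z \<le> \<epsilon>" by (rule power2_le_imp_le) (use le \<open>0 \<le> y\<close> in linarith)
  qed
  then show ?thesis by (simp add: kron_slab_def slab_def)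
qed

text \<open>All arguments are decomposed along lines of the same direction \<open>v\<close>. On such
  a family of lines the domain is empty or a slab in the parameters, so the real-line rearrangement
  applies fibre by fibre.\<close>

lemma nn_integral_kron_slab_steiner:
  fixes A :: "real^'n^'k" and f :: "'n \<Rightarrow> 'a::euclidean_space \<Rightarrow> ennreal"
  assumes f: "\<And>i. subdensity R (f i)" and v: "norm v = 1" and R: "R \<ge> 0"
  shows "(\<integral>\<^sup>+x. indicator (kron_slab A \<epsilon>) x * (\<Prod>i\<in>UNIV. f i (x i)) \<partial>Pi\<^sub>M UNIV (\<lambda>_. lborel))
    \<le> (\<integral>\<^sup>+x. indicator (kron_slab A \<epsilon>) x * (\<Prod>i\<in>UNIV. steiner v (f i) (x i)) \<partial>Pi\<^sub>M UNIV (\<lambda>_. lborel))"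
proof -
  let ?P = "Pi\<^sub>M UNIV (\<lambda>_::'n. lborel :: 'a measure)" and ?R = "Pi\<^sub>M UNIV (\<lambda>_::'n. lborel :: real measure)"
  define \<Phi> where "\<Phi> f x = (indicator (kron_slab A \<epsilon>) x * (\<Prod>i\<in>UNIV. f i (x i)) :: ennreal)"
    for f :: "'n \<Rightarrow> 'a \<Rightarrow> ennreal" and x
  have f_meas [measurable]: "f i \<in> borel_measurable borel" for i by (rule subdensityD(1)[OF f])
  have \<Phi>_meas: "\<Phi> g \<in> borel_measurable ?P" if [measurable]: "\<And>i. g i \<in> borel_measurable borel" for g
    unfolding \<Phi>_def by measurable
  have fibre: "(\<integral>\<^sup>+t. \<Phi> f (\<lambda>i. x i + t i *\<^sub>R v) \<partial>?R) \<le> (\<integral>\<^sup>+t. \<Phi> (\<lambda>i. steiner v (f i)) (\<lambda>i. x i + t i *\<^sub>R v) \<partial>?R)" for x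
  proof -
    \<comment> \<open>Base points are moved to the hyperplane orthogonal to \<open>v\<close>, where
      \<open>t\<close> is the coordinate along \<open>v\<close>; translating \<open>t\<close> leaves
      the fibre integral unchanged.\<close>
    define w where "w i = x i - (x i \<bullet> v) *\<^sub>R v" for i
    have w: "w i \<bullet> v = 0" for i using v by (simp add: w_def inner_diff_left dot_square_norm)
    have shift: "(\<integral>\<^sup>+t. \<Phi> g (\<lambda>i. x i + t i *\<^sub>R v) \<partial>?R) = (\<integral>\<^sup>+t. \<Phi> g (\<lambda>i. w i + t i *\<^sub>R v) \<partial>?R)"
      if g: "\<And>i. g i \<in> borel_measurable borel" for g
    proof -
      have "(\<lambda>t i. x i + t i *\<^sub>R v) \<in> measurable ?R ?P"
        by (rule measurable_PiM_single') (auto simp: space_PiM)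
      from measurable_compose[OF this \<Phi>_meas[OF g]]
      have "(\<integral>\<^sup>+t. \<Phi> g (\<lambda>i. x i + (t i + - (x i \<bullet> v)) *\<^sub>R v) \<partial>?R) = (\<integral>\<^sup>+t. \<Phi> g (\<lambda>i. x i + t i *\<^sub>R v) \<partial>?R)"
        by (rule nn_integral_PiM_lborel_translate[of "\<lambda>t. \<Phi> g (\<lambda>i. x i + t i *\<^sub>R v)"])
      then show ?thesis by (simp add: w_def algebra_simps)
    qed
    have "\<exists>L. line_mass v (f i) (w i) = ennreal L \<and> L \<ge> 0" for i
      using line_mass_finite[OF f v R] by metis
    then obtain L where L: "\<And>i. line_mass v (f i) (w i) = ennreal (L i)" "\<And>i. L i \<ge> 0" by metis
    define y where "y = norm (\<chi> l. \<Sum>j\<in>UNIV. (A $ l $ j) *\<^sub>R w j)"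
    define S where "S = slab (\<lambda>j. column j A) (sqrt (\<epsilon>\<^sup>2 - y\<^sup>2))"
    have ind: "indicator (kron_slab A \<epsilon>) (\<lambda>i. w i + t i *\<^sub>R v) = (if y \<le> \<epsilon> then indicator S t else (0::ennreal))" for t
      using kron_slab_fibre[OF v w, where t=t and A=A and \<epsilon>=\<epsilon>] by (auto simp: y_def S_def indicator_def)
    have "(\<integral>\<^sup>+t. indicator S t * (\<Prod>i\<in>UNIV. f i (w i + t i *\<^sub>R v)) \<partial>?R)
      \<le> (\<integral>\<^sup>+t. indicator S t * (\<Prod>i\<in>UNIV. indicator {- L i / 2<..<L i / 2} (t i)) \<partial>?R)"
      unfolding S_def
    proof (rule nn_integral_slab_le[of "\<lambda>i t. f i (w i + t *\<^sub>R v)" R])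
      show "f i (w i + t *\<^sub>R v) = 0" if "R < \<bar>t\<bar>" for i t
      proof (rule subdensityD(3)[OF f])
        have "\<bar>t\<bar>\<^sup>2 \<le> (norm (w i + t *\<^sub>R v))\<^sup>2" by (simp add: norm_add_scaleR_orthogonal[OF v w])
        then have "\<bar>t\<bar> \<le> norm (w i + t *\<^sub>R v)" by (rule power2_le_imp_le) simp
        with that show "R < norm (w i + t *\<^sub>R v)" by simp
      qed
    qed (use L subdensityD(2)[OF f] in \<open>auto simp: line_mass_def\<close>)
    also have "\<dots> = (\<integral>\<^sup>+t. indicator S t * (\<Prod>i\<in>UNIV. steiner v (f i) (w i + t i *\<^sub>R v)) \<partial>?R)"
      by (simp only: steiner_line[OF f_meas v w L])
    finally have "(\<integral>\<^sup>+t. \<Phi> f (\<lambda>i. w i + t i *\<^sub>R v) \<partial>?R) \<le> (\<integral>\<^sup>+t. \<Phi> (\<lambda>i. steiner v (f i)) (\<lambda>i. w i + t i *\<^sub>R v) \<partial>?R)"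
      by (cases "y \<le> \<epsilon>") (simp_all add: \<Phi>_def ind)
    then show ?thesis by (simp add: shift)
  qed
  have "(\<integral>\<^sup>+x. \<Phi> f x \<partial>?P) \<le> (\<integral>\<^sup>+x. \<Phi> (\<lambda>i. steiner v (f i)) x \<partial>?P)"
    by (subst (1 2) nn_integral_PiM_lborel_fibres[OF \<Phi>_meas v]) (auto intro!: nn_integral_mono mult_left_mono fibre)
  then show ?thesis by (simp add: \<Phi>_def)
qed

section \<open>Mass moved into a ball by one symmetrization\<close>

lemma cball_measurable [measurable]: "cball (a :: 'a::euclidean_space) r \<in> sets borel" "- cball a r \<in> sets borel"
  by auto

definition mass_outside :: "real \<Rightarrow> ('a::euclidean_space \<Rightarrow> ennreal) \<Rightarrow> ennreal" where
  "mass_outside r f = (\<integral>\<^sup>+x. f x * indicator (- cball 0 r) x \<partial>lborel)"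

text \<open>Weighs points outside the ball by their mass and, after the shift by \<open>- h\<close>,
  by the unfilled room \<open>1 - f\<close> inside the ball: a lower bound for what symmetrization
  in direction \<open>h\<close> gains.\<close>

definition displaced_overlap :: "real \<Rightarrow> ('a::euclidean_space \<Rightarrow> ennreal) \<Rightarrow> 'a \<Rightarrow> ennreal" where
  "displaced_overlap r f h = (\<integral>\<^sup>+x. f x * indicator (- cball 0 r) x * ((1 - f (x - h)) * indicator (cball 0 r) (x - h)) \<partial>lborel)"

text \<open>If the mass \<open>L\<close> of the line fits into its chord in the ball, of length
  \<open>2 * \<beta>\<close>, nothing remains outside after symmetrization. Otherwise the chord gets
  completely filled, so the outside mass drops by all the room that was left in the chord, and the
  overlap is at most that room.\<close>

lemma mass_outside_steiner_line:
  fixes v w :: "'a::euclidean_space"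
  assumes f: "subdensity R f" and v: "norm v = 1" and w: "w \<bullet> v = 0" and "R \<ge> 0" "r \<ge> 0"
  shows "line_mass v (\<lambda>x. steiner v f x * indicator (- cball 0 r) x) w
    + line_mass v (\<lambda>x. f x * indicator (- cball 0 r) x * ((1 - f (x - \<eta> *\<^sub>R v)) * indicator (cball 0 r) (x - \<eta> *\<^sub>R v))) w
    \<le> line_mass v (\<lambda>x. f x * indicator (- cball 0 r) x) w"
proof -
  have [measurable]: "f \<in> borel_measurable borel" by (rule subdensityD(1)[OF f])
  obtain L where L: "line_mass v f w = ennreal L" "L \<ge> 0" by (rule line_mass_finite[OF f v \<open>R \<ge> 0\<close>])
  define g where "g t = f (w + t *\<^sub>R v)" for t
  define b :: "real \<Rightarrow> ennreal" where "b t = indicator (cball 0 r) (w + t *\<^sub>R v)" for t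
  have [measurable]: "g \<in> borel_measurable borel" "b \<in> borel_measurable borel"
    unfolding g_def[abs_def] b_def[abs_def] by measurable
  have g1: "g t \<le> 1" for t using subdensityD(2)[OF f] by (simp add: g_def)
  have b01: "b t = 0 \<or> b t = 1" for t by (simp add: b_def indicator_def)
  have gL: "(\<integral>\<^sup>+t. g t \<partial>lborel) = ennreal L" using L(1) by (simp add: line_mass_def g_def)
  \<comment> \<open>Half the length of the chord, or 0 when the line misses the ball.\<close>
  obtain \<beta> where \<beta>: "\<beta> \<ge> 0" "\<And>t. \<bar>t\<bar> < \<beta> \<Longrightarrow> b t = 1" "(\<integral>\<^sup>+t. b t \<partial>lborel) = ennreal (2 * \<beta>)"
  proof (cases "norm w \<le> r")
    case True
    let ?\<beta> = "sqrt (r\<^sup>2 - (norm w)\<^sup>2)"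
    have b_eq: "b t = indicator {-?\<beta>..?\<beta>} t" for t
    proof -
      have "norm (w + t *\<^sub>R v) \<le> r \<longleftrightarrow> (norm (w + t *\<^sub>R v))\<^sup>2 \<le> r\<^sup>2"
        using \<open>r \<ge> 0\<close> by (meson norm_ge_zero power2_le_imp_le power_mono)
      also have "\<dots> \<longleftrightarrow> \<bar>t\<bar>\<^sup>2 \<le> r\<^sup>2 - (norm w)\<^sup>2"
        unfolding norm_add_scaleR_orthogonal[OF v w] power2_abs by linarith
      also have "\<dots> \<longleftrightarrow> \<bar>t\<bar> \<le> ?\<beta>"
        by (metis abs_ge_zero real_le_lsqrt real_le_rsqrt real_sqrt_abs real_sqrt_le_iff power2_abs)
      finally show ?thesis by (auto simp: b_def indicator_def abs_le_iff)
    qed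
    have "?\<beta> \<ge> 0" using True by (simp add: power_mono)
    moreover from this have "(\<integral>\<^sup>+t. b t \<partial>lborel) = ennreal (2 * ?\<beta>)" unfolding b_eq by simp
    ultimately show ?thesis by (intro that[of ?\<beta>]) (auto simp: b_eq indicator_def split: if_splits)
  next
    case False
    have "b t = 0" for t
    proof -
      have "(norm w)\<^sup>2 \<le> (norm (w + t *\<^sub>R v))\<^sup>2" by (simp add: norm_add_scaleR_orthogonal[OF v w])
      then have "norm w \<le> norm (w + t *\<^sub>R v)" by (rule power2_le_imp_le) simp
      with False show ?thesis by (simp add: b_def)
    qed
    then show ?thesis by (intro that[of 0]) auto
  qed
  have not_b: "indicator (- cball 0 r) (w + t *\<^sub>R v) = 1 - b t" for t by (simp add: b_def indicator_def)
  let ?F1 = "\<integral>\<^sup>+t. indicator {- L / 2<..<L / 2} t * (1 - b t) \<partial>lborel"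
  let ?F2 = "\<integral>\<^sup>+t. g t * (1 - b t) * ((1 - g (t - \<eta>)) * b (t - \<eta>)) \<partial>lborel"
  let ?F3 = "\<integral>\<^sup>+t. g t * (1 - b t) \<partial>lborel"
  have shift: "w + t *\<^sub>R v - \<eta> *\<^sub>R v = w + (t - \<eta>) *\<^sub>R v" for t by (simp add: algebra_simps)
  have "?F1 + ?F2 \<le> ?F3"
  proof (cases "L \<le> 2 * \<beta>")
    case True
    have "?F1 = 0"
    proof -
      have eq: "indicator {- L / 2<..<L / 2} t * (1 - b t) = 0" for t
        using \<beta>(2)[of t] True by (auto simp: indicator_def abs_if)
      show ?thesis unfolding eq by simp
    qed
    moreover have "?F2 \<le> ?F3"
    proof (rule nn_integral_mono)
      fix t
      have "(1 - g (t - \<eta>)) * b (t - \<eta>) \<le> 1 * 1"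
        using b01[of "t - \<eta>"] by (intro mult_mono) (auto simp: diff_le_self_ennreal)
      then have "g t * (1 - b t) * ((1 - g (t - \<eta>)) * b (t - \<eta>)) \<le> g t * (1 - b t) * 1" by (intro mult_left_mono) auto
      then show "g t * (1 - b t) * ((1 - g (t - \<eta>)) * b (t - \<eta>)) \<le> g t * (1 - b t)" by simp
    qed
    ultimately show ?thesis by simp
  next
    case False
    have F3: "?F3 + (\<integral>\<^sup>+t. g t * b t \<partial>lborel) = ennreal L"
    proof -
      have "g t * (1 - b t) + g t * b t = g t" for t using b01[of t] by auto
      then show ?thesis by (subst nn_integral_add[symmetric]) (auto simp: gL)
    qed
    have F2: "?F2 + (\<integral>\<^sup>+t. g t * b t \<partial>lborel) \<le> ennreal (2 * \<beta>)"
    proof -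
      have "?F2 \<le> (\<integral>\<^sup>+t. (1 - g (t - \<eta>)) * b (t - \<eta>) \<partial>lborel)"
      proof (rule nn_integral_mono)
        fix t
        have "g t * (1 - b t) \<le> 1 * 1"
          using b01[of t] g1 by (intro mult_mono) (auto simp: diff_le_self_ennreal)
        then have "g t * (1 - b t) * ((1 - g (t - \<eta>)) * b (t - \<eta>)) \<le> 1 * ((1 - g (t - \<eta>)) * b (t - \<eta>))" by (intro mult_right_mono) auto
        then show "g t * (1 - b t) * ((1 - g (t - \<eta>)) * b (t - \<eta>)) \<le> (1 - g (t - \<eta>)) * b (t - \<eta>)" by simp
      qed
      also have "\<dots> = (\<integral>\<^sup>+t. (1 - g t) * b t \<partial>lborel)"
        using nn_integral_lborel_translate[of "\<lambda>t. (1 - g t) * b t" "- \<eta>"] by simp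
      finally have "?F2 + (\<integral>\<^sup>+t. g t * b t \<partial>lborel) \<le> (\<integral>\<^sup>+t. (1 - g t) * b t \<partial>lborel) + (\<integral>\<^sup>+t. g t * b t \<partial>lborel)"
        by (rule add_right_mono)
      also have "\<dots> = (\<integral>\<^sup>+t. (1 - g t) * b t + g t * b t \<partial>lborel)" by (rule nn_integral_add[symmetric]) measurable
      also have "\<dots> = (\<integral>\<^sup>+t. b t \<partial>lborel)"
        using g1 by (intro nn_integral_cong) (simp add: distrib_right[symmetric] diff_add_cancel_ennreal)
      finally show ?thesis by (simp add: \<beta>(3))
    qed
    have F1: "?F1 + ennreal (2 * \<beta>) \<le> ennreal L"
    proof -
      have "ennreal (2 * \<beta>) = (\<integral>\<^sup>+t. indicator {-\<beta><..<\<beta>} t \<partial>lborel)" using \<beta>(1) by simp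
      then have "?F1 + ennreal (2 * \<beta>) = (\<integral>\<^sup>+t. indicator {- L / 2<..<L / 2} t * (1 - b t) + indicator {-\<beta><..<\<beta>} t \<partial>lborel)"
        by (simp only:) (rule nn_integral_add[symmetric], measurable)
      also have "\<dots> \<le> (\<integral>\<^sup>+t. indicator {- L / 2<..<L / 2} t \<partial>lborel)"
      proof (rule nn_integral_mono)
        fix t
        show "indicator {- L / 2<..<L / 2} t * (1 - b t) + indicator {-\<beta><..<\<beta>} t \<le> (indicator {- L / 2<..<L / 2} t :: ennreal)"
          using \<beta>(2)[of t] False diff_le_self_ennreal[of 1 "b t"] by (cases "\<bar>t\<bar> < \<beta>") (auto simp: indicator_def)
      qed
      also have "\<dots> = ennreal L" using L(2) by simp
      finally show ?thesis .
    qed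
    have "?F1 + ?F2 + (\<integral>\<^sup>+t. g t * b t \<partial>lborel) \<le> ?F1 + ennreal (2 * \<beta>)"
      unfolding add.assoc by (intro add_left_mono F2)
    also note F1
    also note F3[symmetric]
    finally have *: "(\<integral>\<^sup>+t. g t * b t \<partial>lborel) + (?F1 + ?F2) \<le> (\<integral>\<^sup>+t. g t * b t \<partial>lborel) + ?F3"
      by (simp add: add_ac)
    have "(\<integral>\<^sup>+t. g t * b t \<partial>lborel) \<le> ennreal (2 * \<beta>)"
      unfolding \<beta>(3)[symmetric] by (intro nn_integral_mono order_trans[OF mult_right_mono[OF g1]]) auto
    then have "(\<integral>\<^sup>+t. g t * b t \<partial>lborel) \<noteq> top" by (auto simp: top_unique)
    with * show ?thesis by (simp add: ennreal_add_left_cancel_le)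
  qed
  then show ?thesis
    by (simp only: line_mass_def steiner_line[OF _ v w L] shift not_b g_def[symmetric] b_def[symmetric] subdensityD(1)[OF f])
qed

text \<open>A shift by \<open>h\<close> stays on the lines of direction \<open>h\<close>, so the
  estimate on single lines integrates over all of them.\<close>

lemma mass_outside_steiner:
  fixes h :: "'a::euclidean_space"
  assumes f: "subdensity R f" and "h \<noteq> 0" and "R \<ge> 0" "r \<ge> 0"
  shows "mass_outside r (steiner (h /\<^sub>R norm h) f) + displaced_overlap r f h \<le> mass_outside r f"
proof -
  have [measurable]: "f \<in> borel_measurable borel" by (rule subdensityD(1)[OF f])
  define v where "v = h /\<^sub>R norm h"
  have v: "norm v = 1" and h: "h = norm h *\<^sub>R v" using \<open>h \<noteq> 0\<close> by (auto simp: v_def)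
  let ?F1 = "\<lambda>x. steiner v f x * indicator (- cball 0 r) x"
  let ?F2 = "\<lambda>x. f x * indicator (- cball 0 r) x * ((1 - f (x - norm h *\<^sub>R v)) * indicator (cball 0 r) (x - norm h *\<^sub>R v))"
  let ?F3 = "\<lambda>x. f x * indicator (- cball 0 r) x"
  have [measurable]: "?F1 \<in> borel_measurable borel" "?F2 \<in> borel_measurable borel" "?F3 \<in> borel_measurable borel"
    by measurable
  have fib: "(\<integral>\<^sup>+x. F x \<partial>lborel) = (\<integral>\<^sup>+x. indicator {0..1} (x \<bullet> v) * line_mass v F x \<partial>lborel)"
    if "F \<in> borel_measurable borel" for F :: "'a \<Rightarrow> ennreal"
    unfolding line_mass_def by (rule nn_integral_lborel_fibres[OF that v])
  have line: "line_mass v ?F1 x + line_mass v ?F2 x \<le> line_mass v ?F3 x" for x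
  proof -
    obtain w where w: "w \<bullet> v = 0" "x = w + (x \<bullet> v) *\<^sub>R v" using orthogonal_remainder[OF v] by metis
    have "line_mass v F x = line_mass v F w" if "F \<in> borel_measurable borel" for F
      by (subst w(2)) (rule line_mass_shift[OF that])
    then show ?thesis using mass_outside_steiner_line[OF f v w(1) \<open>R \<ge> 0\<close> \<open>r \<ge> 0\<close>, of "norm h"] by simp
  qed
  have "(\<integral>\<^sup>+x. ?F1 x \<partial>lborel) + (\<integral>\<^sup>+x. ?F2 x \<partial>lborel)
    = (\<integral>\<^sup>+x. indicator {0..1} (x \<bullet> v) * line_mass v ?F1 x + indicator {0..1} (x \<bullet> v) * line_mass v ?F2 x \<partial>lborel)"
    by (subst (1 2) fib, measurable, rule nn_integral_add[symmetric]) measurable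
  also have "\<dots> \<le> (\<integral>\<^sup>+x. indicator {0..1} (x \<bullet> v) * line_mass v ?F3 x \<partial>lborel)"
    unfolding distrib_left[symmetric] by (intro nn_integral_mono mult_left_mono line) auto
  also have "\<dots> = (\<integral>\<^sup>+x. ?F3 x \<partial>lborel)" by (rule fib[symmetric]) measurable
  finally show ?thesis
    unfolding mass_outside_def displaced_overlap_def v_def[symmetric] h[symmetric] .
qed

section \<open>Convergence to balls\<close>

text \<open>Averaged over all \<open>h\<close>, the overlap is the product of the mass outside the ball and the deficit inside.\<close>

lemma square_mass_outside_le_nn_integral_displaced_overlap:
  fixes f :: "'a::euclidean_space \<Rightarrow> ennreal"
  assumes f: "subdensity R f" and mass: "(\<integral>\<^sup>+x. f x \<partial>lborel) \<le> emeasure lborel (cball (0::'a) r)"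
  shows "(mass_outside r f)\<^sup>2 \<le> (\<integral>\<^sup>+h. displaced_overlap r f h \<partial>lborel)"
proof -
  have [measurable]: "f \<in> borel_measurable borel" by (rule subdensityD(1)[OF f])
  have f1: "f x \<le> 1" for x by (rule subdensityD(2)[OF f])
  let ?D = "\<integral>\<^sup>+x. (1 - f x) * indicator (cball 0 r) x \<partial>lborel" and ?I = "\<integral>\<^sup>+x. f x * indicator (cball 0 r) x \<partial>lborel"
  have "?I \<le> (\<integral>\<^sup>+x. indicator (cball (0::'a) r) x \<partial>lborel)"
    using f1 by (intro nn_integral_mono) (auto split: split_indicator)
  also have "\<dots> < \<infinity>" using emeasure_lborel_cball_finite by simp
  finally have fin: "?I \<noteq> top" by simp
  have "?I + mass_outside r f = (\<integral>\<^sup>+x. f x \<partial>lborel)"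
    unfolding mass_outside_def by (subst nn_integral_add[symmetric]) (auto intro!: nn_integral_cong split: split_indicator)
  also note mass
  also have "emeasure lborel (cball (0::'a) r) = (\<integral>\<^sup>+x. indicator (cball (0::'a) r) x \<partial>lborel)" by simp
  also have "\<dots> = ?I + ?D"
    using f1 by (subst nn_integral_add[symmetric])
      (auto intro!: nn_integral_cong simp: distrib_right[symmetric] add_diff_inverse_ennreal split: split_indicator)
  \<comment> \<open>The room inside is at least the mass outside, because the total mass does not
    exceed the volume of the ball; this produces the square.\<close>
  finally have D: "mass_outside r f \<le> ?D" using fin by (simp add: ennreal_add_left_cancel_le)
  have "(mass_outside r f)\<^sup>2 \<le> mass_outside r f * ?D"
    unfolding power2_eq_square by (rule mult_left_mono[OF D]) simp
  also have "\<dots> = (\<integral>\<^sup>+x. f x * indicator (- cball 0 r) x * ?D \<partial>lborel)"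
    unfolding mass_outside_def by (rule nn_integral_multc[symmetric]) measurable
  also have "\<dots> = (\<integral>\<^sup>+x. (\<integral>\<^sup>+h. f x * indicator (- cball 0 r) x * ((1 - f (x - h)) * indicator (cball 0 r) (x - h)) \<partial>lborel) \<partial>lborel)"
  proof (rule nn_integral_cong)
    fix x :: 'a
    have "(\<integral>\<^sup>+h. f x * indicator (- cball 0 r) x * ((1 - f (x - h)) * indicator (cball 0 r) (x - h)) \<partial>lborel)
      = f x * indicator (- cball 0 r) x * (\<integral>\<^sup>+h. (1 - f (x - h)) * indicator (cball 0 r) (x - h) \<partial>lborel)"
      by (rule nn_integral_cmult) measurable
    also have "(\<integral>\<^sup>+h. (1 - f (x - h)) * indicator (cball 0 r) (x - h) \<partial>lborel) = ?D"
    proof -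
      have "?D = (\<integral>\<^sup>+y. (1 - f y) * indicator (cball 0 r) y \<partial>density (distr lborel borel (\<lambda>h. x + (-1) *\<^sub>R h)) (\<lambda>_. 1))"
        using lborel_affine[of "-1" x] by simp
      also have "\<dots> = (\<integral>\<^sup>+h. (1 - f (x - h)) * indicator (cball 0 r) (x - h) \<partial>lborel)"
        by (simp add: nn_integral_density nn_integral_distr)
      finally show ?thesis by simp
    qed
    finally show "f x * indicator (- cball 0 r) x * ?D
      = (\<integral>\<^sup>+h. f x * indicator (- cball 0 r) x * ((1 - f (x - h)) * indicator (cball 0 r) (x - h)) \<partial>lborel)" by simp
  qed
  also have "\<dots> = (\<integral>\<^sup>+h. displaced_overlap r f h \<partial>lborel)"
    unfolding displaced_overlap_def by (rule lborel_pair.Fubini') measurable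
  finally show ?thesis .
qed

lemma displaced_overlap_eq_0:
  assumes f: "subdensity R f" and "r \<le> R" and h: "2 * R < norm h"
  shows "displaced_overlap r f h = 0"
proof -
  have eq: "f x * indicator (- cball 0 r) x * ((1 - f (x - h)) * indicator (cball 0 r) (x - h)) = 0" for x
  proof (cases "norm x \<le> R")
    case True
    then have "norm (x - h) > R" using h norm_triangle_sub[of h x] by (simp add: norm_minus_commute)
    then show ?thesis using \<open>r \<le> R\<close> by simp
  qed (use subdensityD(3)[OF f] in simp)
  show ?thesis unfolding displaced_overlap_def eq by simp
qed

text \<open>Overlaps vanish for \<open>norm h > 2 * R\<close>, so if all were below
  \<open>c * m\<^sup>2\<close>, their integral would be at most \<open>m\<^sup>2 / 2\<close>, half
  of its lower bound \<open>m\<^sup>2\<close>. The factor 2 in \<open>c\<close> provides this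
  strictness; \<open>h \<noteq> 0\<close> is recorded because \<open>h\<close> has to define a
  direction.\<close>

lemma exists_displaced_overlap_ge:
  fixes f :: "'a::euclidean_space \<Rightarrow> ennreal"
  assumes f: "subdensity R f" and mass: "(\<integral>\<^sup>+x. f x \<partial>lborel) \<le> emeasure lborel (cball (0::'a) r)"
    and R: "r \<le> R" "0 < R" and m: "0 < m" "ennreal m \<le> mass_outside r f"
  defines "c \<equiv> 1 / (2 * measure lborel (cball (0::'a) (2 * R)))"
  obtains h where "h \<noteq> 0" "ennreal (c * m\<^sup>2) \<le> displaced_overlap r f h"
proof -
  let ?V = "measure lborel (cball (0::'a) (2 * R))"
  have V: "?V > 0" "emeasure lborel (cball (0::'a) (2 * R)) = ennreal ?V"
    using R emeasure_lborel_cball_finite[of "0::'a" "2 * R"]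
    by (auto simp: content_cball_pos emeasure_eq_ennreal_measure)
  have "\<exists>h. ennreal (c * m\<^sup>2) \<le> displaced_overlap r f h"
  proof (rule ccontr)
    assume "\<not> ?thesis"
    then have less: "displaced_overlap r f h \<le> ennreal (c * m\<^sup>2)" for h by (meson nle_le)
    have "(ennreal m)\<^sup>2 \<le> (mass_outside r f)\<^sup>2" using m by (intro power_mono) auto
    also have "\<dots> \<le> (\<integral>\<^sup>+h. displaced_overlap r f h \<partial>lborel)"
      by (rule square_mass_outside_le_nn_integral_displaced_overlap[OF f mass])
    also have "\<dots> \<le> (\<integral>\<^sup>+h. ennreal (c * m\<^sup>2) * indicator (cball 0 (2 * R)) (h::'a) \<partial>lborel)"
      using less displaced_overlap_eq_0[OF f R(1)] by (intro nn_integral_mono) (auto split: split_indicator)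
    also have "\<dots> = ennreal (c * m\<^sup>2) * ennreal ?V" by (subst nn_integral_cmult_indicator) (auto simp: V(2))
    also have "\<dots> = ennreal (m\<^sup>2 / 2)" using V(1) by (subst ennreal_mult[symmetric]) (auto simp: c_def)
    finally show False using m(1) by (simp add: ennreal_power)
  qed
  then obtain h where h: "ennreal (c * m\<^sup>2) \<le> displaced_overlap r f h" by blast
  have "h \<noteq> 0"
  proof
    assume "h = 0"
    have "displaced_overlap r f 0 = 0"
    proof -
      have eq: "f x * indicator (- cball 0 r) x * ((1 - f (x - 0)) * indicator (cball 0 r) (x - 0)) = 0" for x
        by (cases "x \<in> cball 0 r") simp_all
      show ?thesis unfolding displaced_overlap_def eq by simp
    qed
    with h \<open>h = 0\<close> m(1) V(1) show False by (simp add: c_def)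
  qed
  with h show thesis by (rule that[rotated])
qed

text \<open>If every argument lies in its ball, the integrand is at most that of the balls;
  otherwise some argument lies outside, and a union bound charges the integrand to that
  component.\<close>

lemma nn_integral_kron_slab_le_mass_outside:
  fixes A :: "real^'n^'k" and g :: "'n \<Rightarrow> 'a::euclidean_space \<Rightarrow> ennreal"
  assumes g: "\<And>i. subdensity R (g i)"
    and mass: "\<And>i. (\<integral>\<^sup>+x. g i x \<partial>lborel) \<le> emeasure lborel (cball (0::'a) (r i))"
  shows "(\<integral>\<^sup>+x. indicator (kron_slab A \<epsilon>) x * (\<Prod>i\<in>UNIV. g i (x i)) \<partial>Pi\<^sub>M UNIV (\<lambda>_. lborel))
    \<le> (\<integral>\<^sup>+x. indicator (kron_slab A \<epsilon>) x * (\<Prod>i\<in>UNIV. indicator (cball (0::'a) (r i)) (x i)) \<partial>Pi\<^sub>M UNIV (\<lambda>_. lborel))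
      + (\<Sum>i\<in>UNIV. mass_outside (r i) (g i)) * (\<Prod>i\<in>UNIV. 1 + emeasure lborel (cball (0::'a) (r i)))"
proof -
  let ?P = "Pi\<^sub>M UNIV (\<lambda>_::'n. lborel :: 'a measure)"
  let ?C = "\<Prod>i\<in>UNIV. 1 + emeasure lborel (cball (0::'a) (r i))"
  have [measurable]: "g i \<in> borel_measurable borel" for i by (rule subdensityD(1)[OF g])
  have g1: "g i x \<le> 1" for i x by (rule subdensityD(2)[OF g])
  define \<phi> where "\<phi> i j x = (if j = i then g i x * indicator (- cball 0 (r i)) x else g j x)" for i j x
  have [measurable]: "\<phi> i j \<in> borel_measurable borel" for i j by (cases "j = i") (simp_all add: \<phi>_def[abs_def])
  have pw: "indicator (kron_slab A \<epsilon>) x * (\<Prod>i\<in>UNIV. g i (x i))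
    \<le> indicator (kron_slab A \<epsilon>) x * (\<Prod>i\<in>UNIV. indicator (cball (0::'a) (r i)) (x i)) + (\<Sum>i\<in>UNIV. \<Prod>j\<in>UNIV. \<phi> i j (x j))" for x
  proof (cases "\<forall>i. x i \<in> cball 0 (r i)")
    case True
    then have "(\<Prod>i\<in>UNIV. indicator (cball (0::'a) (r i)) (x i)) = (1 :: ennreal)" by simp
    moreover have "(\<Prod>i\<in>UNIV. g i (x i)) \<le> (\<Prod>i\<in>(UNIV::'n set). 1)" by (intro prod_mono_ennreal g1)
    ultimately have "indicator (kron_slab A \<epsilon>) x * (\<Prod>i\<in>UNIV. g i (x i))
      \<le> indicator (kron_slab A \<epsilon>) x * (\<Prod>i\<in>UNIV. indicator (cball (0::'a) (r i)) (x i))" by (intro mult_left_mono) auto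
    then show ?thesis by (rule add_increasing2[rotated]) simp
  next
    case False
    then obtain i where i: "x i \<notin> cball 0 (r i)" by blast
    have "indicator (kron_slab A \<epsilon>) x * (\<Prod>j\<in>UNIV. g j (x j)) \<le> (\<Prod>j\<in>UNIV. g j (x j))" by (simp add: indicator_def)
    also have "\<dots> = (\<Prod>j\<in>UNIV. \<phi> i j (x j))" using i by (intro prod.cong) (auto simp: \<phi>_def)
    also have "\<dots> \<le> (\<Sum>i\<in>UNIV. \<Prod>j\<in>UNIV. \<phi> i j (x j))" by (rule member_le_sum) auto
    finally show ?thesis by (rule add_increasing[rotated]) simp
  qed
  have factor: "(\<integral>\<^sup>+x. (\<Prod>j\<in>UNIV. \<phi> i j (x j)) \<partial>?P) \<le> mass_outside (r i) (g i) * ?C" for i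
  proof -
    have "(\<integral>\<^sup>+x. (\<Prod>j\<in>UNIV. \<phi> i j (x j)) \<partial>?P) = (\<Prod>j\<in>UNIV. \<integral>\<^sup>+x. \<phi> i j x \<partial>lborel)"
      by (rule lborel_product.product_nn_integral_prod) auto
    also have "\<dots> = (\<integral>\<^sup>+x. \<phi> i i x \<partial>lborel) * (\<Prod>j\<in>UNIV - {i}. \<integral>\<^sup>+x. \<phi> i j x \<partial>lborel)"
      by (rule prod.remove) auto
    also have "(\<integral>\<^sup>+x. \<phi> i i x \<partial>lborel) = mass_outside (r i) (g i)" by (simp add: \<phi>_def mass_outside_def)
    also have "(\<Prod>j\<in>UNIV - {i}. \<integral>\<^sup>+x. \<phi> i j x \<partial>lborel) \<le> (\<Prod>j\<in>UNIV - {i}. 1 + emeasure lborel (cball (0::'a) (r j)))"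
      using mass by (intro prod_mono_ennreal) (auto simp: \<phi>_def intro: add_increasing)
    \<comment> \<open>The summand 1 makes the missing factor for \<open>i\<close> at least 1, so it
      can be inserted to reach a constant independent of \<open>i\<close>.\<close>
    also have "\<dots> \<le> (1 + emeasure lborel (cball (0::'a) (r i))) * (\<Prod>j\<in>UNIV - {i}. 1 + emeasure lborel (cball (0::'a) (r j)))"
      by (metis add_increasing2 mult_1 mult_right_mono order_refl zero_le)
    also have "\<dots> = ?C" by (rule prod.remove[symmetric]) auto
    finally show ?thesis by (simp add: mult_left_mono)
  qed
  have "(\<integral>\<^sup>+x. indicator (kron_slab A \<epsilon>) x * (\<Prod>i\<in>UNIV. g i (x i)) \<partial>?P)
    \<le> (\<integral>\<^sup>+x. indicator (kron_slab A \<epsilon>) x * (\<Prod>i\<in>UNIV. indicator (cball (0::'a) (r i)) (x i)) + (\<Sum>i\<in>UNIV. \<Prod>j\<in>UNIV. \<phi> i j (x j)) \<partial>?P)"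
    by (intro nn_integral_mono pw)
  also have "\<dots> = (\<integral>\<^sup>+x. indicator (kron_slab A \<epsilon>) x * (\<Prod>i\<in>UNIV. indicator (cball (0::'a) (r i)) (x i)) \<partial>?P)
     + (\<Sum>i\<in>UNIV. \<integral>\<^sup>+x. (\<Prod>j\<in>UNIV. \<phi> i j (x j)) \<partial>?P)"
    by (subst nn_integral_add) (auto simp: nn_integral_sum)
  also have "\<dots> \<le> (\<integral>\<^sup>+x. indicator (kron_slab A \<epsilon>) x * (\<Prod>i\<in>UNIV. indicator (cball (0::'a) (r i)) (x i)) \<partial>?P)
     + (\<Sum>i\<in>UNIV. mass_outside (r i) (g i) * ?C)"
    by (intro add_left_mono sum_mono factor)
  finally show ?thesis by (simp only: sum_distrib_right)
qed

text \<open>Among all tuples for which the functional is at least its initial value, the total mass outside the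
  balls has infimum 0: otherwise one more symmetrization of a near-minimizer would go below the infimum.\<close>

lemma nn_integral_kron_slab_subdensity_le:
  fixes A :: "real^'n^'k" and f :: "'n \<Rightarrow> 'a::euclidean_space \<Rightarrow> ennreal"
  assumes f: "\<And>i. subdensity R (f i)"
    and mass: "\<And>i. (\<integral>\<^sup>+x. f i x \<partial>lborel) \<le> emeasure lborel (cball (0::'a) (r i))"
    and r: "\<And>i. 0 \<le> r i" "\<And>i. r i \<le> R" and R: "0 < R"
  shows "(\<integral>\<^sup>+x. indicator (kron_slab A \<epsilon>) x * (\<Prod>i\<in>UNIV. f i (x i)) \<partial>Pi\<^sub>M UNIV (\<lambda>_. lborel))
    \<le> (\<integral>\<^sup>+x. indicator (kron_slab A \<epsilon>) x * (\<Prod>i\<in>UNIV. indicator (cball (0::'a) (r i)) (x i)) \<partial>Pi\<^sub>M UNIV (\<lambda>_. lborel))"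
proof -
  define J where "J g = (\<integral>\<^sup>+x. indicator (kron_slab A \<epsilon>) x * (\<Prod>i\<in>UNIV. g i (x i)) \<partial>Pi\<^sub>M UNIV (\<lambda>_. lborel))"
    for g :: "'n \<Rightarrow> 'a \<Rightarrow> ennreal"
  define G where "G = {g. (\<forall>i. subdensity R (g i)) \<and> (\<forall>i. (\<integral>\<^sup>+x. g i x \<partial>lborel) \<le> emeasure lborel (cball (0::'a) (r i))) \<and> J f \<le> J g}"
  define Out where "Out g = (\<Sum>i\<in>UNIV. mass_outside (r i) (g i))" for g :: "'n \<Rightarrow> 'a \<Rightarrow> ennreal"
  have "f \<in> G" using f mass by (simp add: G_def)
  have Out_fin: "Out g < \<infinity>" if "g \<in> G" for g
  proof -
    have "mass_outside (r i) (g i) < \<infinity>" for i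
    proof -
      have "mass_outside (r i) (g i) \<le> (\<integral>\<^sup>+x. g i x \<partial>lborel)"
        unfolding mass_outside_def by (intro nn_integral_mono) (simp add: indicator_def)
      also have "\<dots> \<le> emeasure lborel (cball (0::'a) (r i))" using that by (simp add: G_def)
      also have "\<dots> < \<infinity>" using emeasure_lborel_cball_finite by simp
      finally show ?thesis .
    qed
    then show ?thesis by (simp add: Out_def)
  qed
  define c where "c = 1 / (2 * measure lborel (cball (0::'a) (2 * R)))"
  have c: "c > 0" using R by (simp add: c_def content_cball_pos)
  have inf: "(INF g\<in>G. Out g) = 0"
  proof (rule ccontr)
    assume neq: "(INF g\<in>G. Out g) \<noteq> 0"
    have "(INF g\<in>G. Out g) < \<infinity>" using Out_fin[OF \<open>f \<in> G\<close>] by (rule le_less_trans[OF INF_lower[OF \<open>f \<in> G\<close>]])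
    with neq obtain m where m: "(INF g\<in>G. Out g) = ennreal m" "m > 0"
      by (cases "INF g\<in>G. Out g") (auto simp: less_le)
    define n where "n = real CARD('n)"
    have n: "n > 0" by (simp add: n_def)
    \<comment> \<open>By pigeonhole some component has outside mass at least
      \<open>m / (2 * n)\<close>; \<open>\<eta>\<close> is the gain guaranteed by a symmetrization
      chosen for that component.\<close>
    define \<eta> where "\<eta> = c * (m / (2 * n))\<^sup>2"
    have \<eta>: "\<eta> > 0" using c m(2) n by (simp add: \<eta>_def)
    have "(INF g\<in>G. Out g) < ennreal (m + \<eta>)" using m \<eta> by (simp add: ennreal_less_iff)
    then obtain g where g: "g \<in> G" "Out g < ennreal (m + \<eta>)" by (auto simp: INF_less_iff)
    have gs: "\<And>i. subdensity R (g i)" "\<And>i. (\<integral>\<^sup>+x. g i x \<partial>lborel) \<le> emeasure lborel (cball (0::'a) (r i))" "J f \<le> J g"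
      using g(1) by (auto simp: G_def)
    obtain i where i: "ennreal (m / (2 * n)) \<le> mass_outside (r i) (g i)"
    proof (rule ccontr)
      assume "\<not> thesis"
      then have "mass_outside (r i) (g i) \<le> ennreal (m / (2 * n))" for i using that by (meson nle_le)
      then have "Out g \<le> (\<Sum>i\<in>(UNIV::'n set). ennreal (m / (2 * n)))"
        unfolding Out_def by (intro sum_mono) auto
      also have "\<dots> = ennreal (m / 2)" using n m(2) by (simp add: n_def ennreal_of_nat_eq_real_of_nat ennreal_mult[symmetric])
      also have "\<dots> < ennreal m" using m(2) by (simp add: ennreal_less_iff)
      also have "\<dots> \<le> Out g" unfolding m(1)[symmetric] by (rule INF_lower[OF g(1)])
      finally show False by simp
    qed
    obtain h where h: "h \<noteq> 0" "ennreal \<eta> \<le> displaced_overlap (r i) (g i) h"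
      using exists_displaced_overlap_ge[OF gs(1,2) r(2) R _ i] m(2) n unfolding \<eta>_def c_def by auto
    \<comment> \<open>The direction found for component \<open>i\<close> is applied to all
      components; for the others the outside mass does not grow, since their overlaps are
      nonnegative.\<close>
    define v where "v = h /\<^sub>R norm h"
    have v: "norm v = 1" using h(1) by (simp add: v_def)
    let ?g = "\<lambda>i. steiner v (g i)"
    have "?g \<in> G"
      unfolding G_def using subdensity_steiner[OF gs(1) v] nn_integral_steiner[OF gs(1) v] gs(2,3) R
        nn_integral_kron_slab_steiner[OF gs(1) v, of A \<epsilon>] by (auto simp: J_def intro: order_trans)
    then have "ennreal m \<le> Out ?g" unfolding m(1)[symmetric] by (rule INF_lower)
    then have "ennreal (m + \<eta>) \<le> Out ?g + ennreal \<eta>"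
      using m(2) \<eta> by (subst ennreal_plus) (auto intro: add_right_mono)
    also have "\<dots> \<le> Out g"
    proof -
      have "Out ?g + ennreal \<eta> \<le> Out ?g + displaced_overlap (r i) (g i) h" using h(2) by (rule add_left_mono)
      also have "\<dots> \<le> Out ?g + (\<Sum>i\<in>UNIV. displaced_overlap (r i) (g i) h)"
        by (intro add_left_mono member_le_sum) auto
      also have "\<dots> = (\<Sum>i\<in>UNIV. mass_outside (r i) (?g i) + displaced_overlap (r i) (g i) h)"
        by (simp add: Out_def sum.distrib)
      also have "\<dots> \<le> Out g"
        unfolding Out_def v_def using R by (intro sum_mono mass_outside_steiner[OF gs(1) h(1) _ r(1)]) auto
      finally show ?thesis .
    qed
    finally show False using g(2) by simp
  qed
  let ?B = "\<lambda>i. indicator (cball (0::'a) (r i))" and ?C = "\<Prod>i\<in>UNIV. 1 + emeasure lborel (cball (0::'a) (r i))"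
  have C: "?C < \<infinity>" using emeasure_lborel_cball_finite by (auto simp: less_top[symmetric] ennreal_prod_eq_top)
  have "J f \<le> J ?B"
  proof (rule ennreal_le_epsilon)
    fix e :: real assume "0 < e"
    obtain C where C: "?C = ennreal C" "C \<ge> 0" using C by (cases ?C) auto
    then have "(INF g\<in>G. Out g) < ennreal (e / (C + 1))" using \<open>0 < e\<close> by (simp add: inf)
    then obtain g where g: "g \<in> G" "Out g < ennreal (e / (C + 1))" by (auto simp: INF_less_iff)
    have "J f \<le> J g" using g(1) by (simp add: G_def)
    also have "\<dots> \<le> J ?B + Out g * ?C"
      using g(1) unfolding J_def Out_def by (intro nn_integral_kron_slab_le_mass_outside[of R]) (auto simp: G_def)
    also have "Out g * ?C \<le> ennreal (e / (C + 1)) * ennreal C"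
      using g(2) C(1) by (intro mult_mono) auto
    also have "\<dots> = ennreal (e * (C / (C + 1)))" using \<open>0 < e\<close> C(2) by (simp add: ennreal_mult[symmetric])
    also have "\<dots> \<le> ennreal e"
      using \<open>0 < e\<close> C(2) mult_left_mono[of "C / (C + 1)" 1 e] by (intro ennreal_leI) auto
    finally show "J f \<le> J ?B + ennreal e" by (simp add: add_left_mono)
  qed
  then show ?thesis by (simp add: J_def)
qed

section \<open>Densities and balls\<close>

text \<open>Cutting the densities off outside large balls reduces to bounded support; monotone
  convergence restores them.\<close>

lemma nn_integral_kron_slab_le:
  fixes A :: "real^'n^'k" and f :: "'n \<Rightarrow> 'a::euclidean_space \<Rightarrow> ennreal"
  assumes [measurable]: "\<And>i. f i \<in> borel_measurable borel" and f1: "\<And>i x. f i x \<le> 1"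
    and mass: "\<And>i. (\<integral>\<^sup>+x. f i x \<partial>lborel) \<le> emeasure lborel (cball (0::'a) (r i))"
    and r: "\<And>i. 0 \<le> r i"
  shows "(\<integral>\<^sup>+x. indicator (kron_slab A \<epsilon>) x * (\<Prod>i\<in>UNIV. f i (x i)) \<partial>Pi\<^sub>M UNIV (\<lambda>_. lborel))
    \<le> (\<integral>\<^sup>+x. indicator (kron_slab A \<epsilon>) x * (\<Prod>i\<in>UNIV. indicator (cball (0::'a) (r i)) (x i)) \<partial>Pi\<^sub>M UNIV (\<lambda>_. lborel))"
proof -
  let ?P = "Pi\<^sub>M UNIV (\<lambda>_::'n. lborel :: 'a measure)"
  define F where "F m x = (indicator (kron_slab A \<epsilon>) x * (\<Prod>i\<in>UNIV. f i (x i) * indicator (cball 0 (real m)) (x i)) :: ennreal)"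
    for m :: nat and x :: "'n \<Rightarrow> 'a"
  have [measurable]: "F m \<in> borel_measurable ?P" for m unfolding F_def by measurable
  have sup: "(SUP m. F m x) = indicator (kron_slab A \<epsilon>) x * (\<Prod>i\<in>UNIV. f i (x i))" for x
  proof (rule antisym)
    show "(SUP m. F m x) \<le> indicator (kron_slab A \<epsilon>) x * (\<Prod>i\<in>UNIV. f i (x i))"
      unfolding F_def by (intro SUP_least mult_left_mono prod_mono_ennreal) (auto simp: indicator_def)
    obtain m :: nat where m: "(\<Sum>i\<in>UNIV. norm (x i)) \<le> real m" using real_arch_simple by blast
    have "norm (x i) \<le> real m" for i
      using m member_le_sum[of i UNIV "\<lambda>i. norm (x i)"] by simp
    then have "indicator (kron_slab A \<epsilon>) x * (\<Prod>i\<in>UNIV. f i (x i)) = F m x" by (simp add: F_def)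
    then show "indicator (kron_slab A \<epsilon>) x * (\<Prod>i\<in>UNIV. f i (x i)) \<le> (SUP m. F m x)"
      by (metis SUP_upper UNIV_I)
  qed
  have "incseq F"
    unfolding incseq_def
  proof (intro allI impI le_funI)
    fix m n :: nat and x :: "'n \<Rightarrow> 'a" assume "m \<le> n"
    then have "cball (0::'a) (real m) \<subseteq> cball 0 (real n)" by auto
    then show "F m x \<le> F n x" unfolding F_def by (intro mult_left_mono prod_mono_ennreal indicator_leI) auto
  qed
  then have "(\<integral>\<^sup>+x. indicator (kron_slab A \<epsilon>) x * (\<Prod>i\<in>UNIV. f i (x i)) \<partial>?P) = (SUP m. \<integral>\<^sup>+x. F m x \<partial>?P)"
    unfolding sup[symmetric] by (intro nn_integral_monotone_convergence_SUP) auto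
  also have "\<dots> \<le> (\<integral>\<^sup>+x. indicator (kron_slab A \<epsilon>) x * (\<Prod>i\<in>UNIV. indicator (cball (0::'a) (r i)) (x i)) \<partial>?P)"
  proof (rule SUP_least)
    fix m :: nat
    \<comment> \<open>A common radius that exceeds the cutoff and every \<open>r i\<close>, and is
      positive even if these vanish.\<close>
    define R where "R = real m + (\<Sum>i\<in>UNIV. r i) + 1"
    have rs: "0 \<le> (\<Sum>i\<in>UNIV. r i)" "r i \<le> (\<Sum>i\<in>UNIV. r i)" for i
      using r by (auto intro: sum_nonneg member_le_sum)
    have "subdensity R (\<lambda>x. f i x * indicator (cball 0 (real m)) x)" for i
      using f1 rs by (auto simp: subdensity_def R_def indicator_def)
    moreover have "(\<integral>\<^sup>+x. f i x * indicator (cball 0 (real m)) x \<partial>lborel) \<le> emeasure lborel (cball (0::'a) (r i))" for i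
      by (rule order_trans[OF nn_integral_mono mass]) (simp add: indicator_def)
    ultimately show "(\<integral>\<^sup>+x. F m x \<partial>?P) \<le> (\<integral>\<^sup>+x. indicator (kron_slab A \<epsilon>) x * (\<Prod>i\<in>UNIV. indicator (cball (0::'a) (r i)) (x i)) \<partial>?P)"
      unfolding F_def using rs r
      by (intro nn_integral_kron_slab_subdensity_le[of R]) (auto simp: R_def add_increasing intro: order_trans[OF rs(2)])
  qed
  finally show ?thesis .
qed

section \<open>From \<open>max_density\<close> to bounded densities, and from balls to Borel
  sets\<close>

lemma emeasure_lborel_cball_pos:
  fixes x :: "'b::euclidean_space"
  assumes "0 < d"
  shows "0 < emeasure lborel (cball x d)"
proof -
  have "0 < unit_ball_vol (real DIM('b)) * d ^ DIM('b)" using assms by (intro mult_pos_pos) auto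
  then show ?thesis using assms by (simp add: emeasure_cball)
qed

lemma emeasure_vimage_le_max_density:
  assumes "B \<in> sets borel" "0 < emeasure lborel B" "emeasure lborel B \<noteq> \<infinity>"
  shows "emeasure P (Y -` B \<inter> space P) \<le> max_density P Y * emeasure lborel B"
proof -
  have "emeasure P (Y -` B \<inter> space P) / emeasure lborel B \<le> max_density P Y"
    unfolding max_density_def using assms by (intro SUP_upper) auto
  then have "emeasure P (Y -` B \<inter> space P) / emeasure lborel B * emeasure lborel B \<le> max_density P Y * emeasure lborel B"
    by (rule mult_right_mono) simp
  then show ?thesis using assms by (simp add: ennreal_divide_times ennreal_divide_self less_top)
qed

text \<open>Null sets are invisible in the definition of \<open>max_density\<close>. They are
  covered by open sets of small measure; a nonempty open set has positive measure, so the ratio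
  bound applies to it.\<close>

lemma emeasure_vimage_le_mult_emeasure_lborel:
  fixes Y :: "'w \<Rightarrow> 'b::euclidean_space"
  assumes [measurable]: "Y \<in> borel_measurable P" and C: "max_density P Y \<le> ennreal C" "0 < C"
    and A[measurable]: "A \<in> sets borel"
  shows "emeasure P (Y -` A \<inter> space P) \<le> ennreal C * emeasure lborel A"
proof -
  have pos: "emeasure P (Y -` B \<inter> space P) \<le> ennreal C * emeasure lborel B"
    if B: "B \<in> sets borel" "emeasure lborel B > 0" for B
  proof (cases "emeasure lborel B = \<infinity>")
    case False
    then have "emeasure P (Y -` B \<inter> space P) \<le> max_density P Y * emeasure lborel B"
      using B by (intro emeasure_vimage_le_max_density) auto
    also have "\<dots> \<le> ennreal C * emeasure lborel B" by (intro mult_right_mono C(1)) simp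
    finally show ?thesis .
  qed (use C in \<open>simp add: ennreal_mult_top\<close>)
  show ?thesis
  proof (cases "emeasure lborel A = 0")
    case True
    have "emeasure P (Y -` A \<inter> space P) \<le> 0"
    proof (rule ennreal_le_epsilon)
      fix e :: real assume "0 < e"
      obtain U where U: "open U" "A \<subseteq> U" "emeasure lborel (U - A) < ennreal (e / C)"
        using outer_regular_lborel[OF A, of "e / C"] \<open>0 < e\<close> C(2) by auto
      have [measurable]: "U \<in> sets borel" using U(1) by auto
      have "emeasure lborel U \<le> emeasure lborel (U - A) + emeasure lborel A"
        by (rule order_trans[OF emeasure_mono emeasure_subadditive]) auto
      then have small: "emeasure lborel U \<le> ennreal (e / C)" using U(3) True by simp
      have "emeasure P (Y -` A \<inter> space P) \<le> emeasure P (Y -` U \<inter> space P)"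
        using U(2) by (intro emeasure_mono) auto
      also have "\<dots> \<le> ennreal C * emeasure lborel U"
      proof (cases "emeasure lborel U = 0")
        case True
        have "U = {}"
        proof (rule ccontr)
          assume "U \<noteq> {}"
          then obtain x d where d: "d > 0" "cball x d \<subseteq> U" using U(1) open_contains_cball by blast
          then have "emeasure lborel (cball x d) \<le> emeasure lborel U" by (intro emeasure_mono) auto
          with True emeasure_lborel_cball_pos[OF d(1), of x] show False by simp
        qed
        then show ?thesis by simp
      qed (use pos[of U] in \<open>auto simp: zero_less_iff_neq_zero\<close>)
      also have "\<dots> \<le> ennreal C * ennreal (e / C)" by (intro mult_left_mono small) simp
      also have "\<dots> = ennreal e" using C(2) \<open>0 < e\<close> by (simp add: ennreal_mult[symmetric])
      finally show "emeasure P (Y -` A \<inter> space P) \<le> 0 + ennreal e" by simp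
    qed
    then show ?thesis by simp
  qed (use pos[OF A] in \<open>simp add: zero_less_iff_neq_zero\<close>)
qed

text \<open>The bound on all Borel sets gives absolute continuity, hence a Radon--Nikodym density.
  It is at most \<open>C\<close> almost everywhere, and capping it makes the bound hold
  everywhere.\<close>

lemma bounded_density_exists:
  fixes Y :: "'w \<Rightarrow> 'b::euclidean_space"
  assumes [measurable]: "Y \<in> borel_measurable P" and C: "max_density P Y \<le> ennreal C" "0 < C"
  obtains g where "g \<in> borel_measurable borel" "\<And>x. g x \<le> ennreal C" "distr P borel Y = density lborel g"
proof -
  let ?\<mu> = "distr P borel Y"
  have le: "emeasure ?\<mu> A \<le> ennreal C * emeasure lborel A" if "A \<in> sets borel" for A
    using emeasure_vimage_le_mult_emeasure_lborel[OF assms that] that by (simp add: emeasure_distr)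
  have "absolutely_continuous lborel ?\<mu>"
    unfolding absolutely_continuous_def
  proof
    fix A assume "A \<in> null_sets (lborel :: 'b measure)"
    then have "A \<in> sets borel" "emeasure lborel A = 0" by auto
    with le[of A] show "A \<in> null_sets ?\<mu>" by auto
  qed
  then obtain f where f: "f \<in> borel_measurable lborel" "density lborel f = ?\<mu>"
    using sigma_finite_measure.Radon_Nikodym[OF sigma_finite_lborel, of ?\<mu>] by auto
  from f(1) have [measurable]: "f \<in> borel_measurable borel" by simp
  \<comment> \<open>Intersecting with balls keeps the measures finite, as required to cancel
    \<open>C * emeasure lborel B\<close>.\<close>
  have ae: "AE x in lborel. f x \<le> ennreal C \<or> norm x > real k" for k :: nat
  proof -
    define B where "B = {x. ennreal C < f x} \<inter> cball 0 (real k)"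
    have [measurable]: "B \<in> sets borel" unfolding B_def by measurable
    have "emeasure lborel B \<le> emeasure lborel (cball (0::'b) (real k))"
      unfolding B_def by (intro emeasure_mono) auto
    also have "\<dots> < \<infinity>" using emeasure_lborel_cball_finite by simp
    finally have fin: "ennreal C * emeasure lborel B \<noteq> top" by (simp add: ennreal_mult_eq_top_iff)
    have "(\<integral>\<^sup>+x. (f x - ennreal C) * indicator B x \<partial>lborel) + ennreal C * emeasure lborel B
      = (\<integral>\<^sup>+x. (f x - ennreal C) * indicator B x + ennreal C * indicator B x \<partial>lborel)"
      by (subst nn_integral_add) (auto simp: nn_integral_cmult_indicator)
    also have "\<dots> = (\<integral>\<^sup>+x. f x * indicator B x \<partial>lborel)"
      by (intro nn_integral_cong) (auto simp: B_def diff_add_cancel_ennreal less_imp_le split: split_indicator)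
    also have "\<dots> = emeasure ?\<mu> B" by (simp add: f(2)[symmetric] emeasure_density)
    also have "\<dots> \<le> 0 + ennreal C * emeasure lborel B" using le[of B] by simp
    finally have "(\<integral>\<^sup>+x. (f x - ennreal C) * indicator B x \<partial>lborel) = 0"
      using fin by (simp only: add.commute[of _ "ennreal C * emeasure lborel B"] ennreal_add_left_cancel_le) simp
    then have "AE x in lborel. (f x - ennreal C) * indicator B x = 0"
      by (subst (asm) nn_integral_0_iff_AE) auto
    then show ?thesis
      by eventually_elim (auto simp: B_def diff_eq_0_iff_ennreal not_le split: split_indicator_asm)
  qed
  have "AE x in lborel. \<forall>k::nat. f x \<le> ennreal C \<or> norm x > real k" using ae by (subst AE_all_countable) auto
  then have "AE x in lborel. f x = min (f x) (ennreal C)"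
  proof eventually_elim
    case (elim x)
    obtain k :: nat where "norm x \<le> real k" using real_arch_simple by blast
    with elim have "f x \<le> ennreal C" by (meson not_le)
    then show ?case by (simp add: min_def)
  qed
  then have "density lborel f = density lborel (\<lambda>x. min (f x) (ennreal C))"
    by (intro density_cong) auto
  then show thesis using f(2) by (intro that[of "\<lambda>x. min (f x) (ennreal C)"]) auto
qed

text \<open>For open \<open>U\<close>, the averages of \<open>indicator U\<close> over balls of
  radius \<open>e n\<close> tend to 1 on \<open>U\<close>. Fatou's lemma bounds the measure of
  \<open>U\<close> by their integrals, and Tonelli turns these into integrals of ball ratios over
  centres in \<open>U\<close>. Outer regularity extends the bound to Borel sets.\<close>

lemma emeasure_le_if_cball_le:
  fixes \<mu> :: "'b::euclidean_space measure"
  assumes "finite_measure \<mu>" and sets: "sets \<mu> = sets borel"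
    and le: "\<And>a e. e > 0 \<Longrightarrow> emeasure \<mu> (cball a e) \<le> ennreal C * emeasure lborel (cball a e)"
    and "0 \<le> C" and A[measurable]: "A \<in> sets borel"
  shows "emeasure \<mu> A \<le> ennreal C * emeasure lborel A"
proof -
  interpret finite_measure \<mu> by fact
  interpret pair_sigma_finite \<mu> "lborel :: 'b measure" by unfold_locales
  note sets[measurable_cong]
  have open_le: "emeasure \<mu> U \<le> ennreal C * emeasure lborel U" if "open U" for U
  proof -
    have [measurable]: "U \<in> sets borel" using \<open>open U\<close> by auto
    define e where "e n = inverse (real (Suc n))" for n
    define V where "V n = emeasure lborel (cball (0::'b) (e n))" for n
    have e: "e n > 0" "e \<longlonglongrightarrow> 0" for n
      unfolding e_def using LIMSEQ_inverse_real_of_nat by auto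
    have V_eq: "emeasure lborel (cball y (e n)) = V n" for y :: 'b and n
      using e(1)[of n] by (simp add: V_def emeasure_cball)
    have V: "V n \<noteq> 0" "V n \<noteq> top" for n
      using emeasure_lborel_cball_pos[OF e(1), of "0::'b" n] emeasure_lborel_cball_finite[of "0::'b" "e n"]
      by (auto simp: V_def)
    \<comment> \<open>The kernel is symmetric: for fixed \<open>y\<close> it is the uniform density
      on a ball, and for fixed \<open>z\<close> its integral against \<open>\<mu>\<close> is a ball
      ratio.\<close>
    define \<kappa> where "\<kappa> n y z = (if dist y z \<le> e n then 1 / V n else (0::ennreal))" for n and y z :: 'b
    have [measurable]: "(\<lambda>p. \<kappa> n (fst p) (snd p)) \<in> borel_measurable (borel \<Otimes>\<^sub>M borel)" for n
      unfolding \<kappa>_def by measurable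
    define \<phi> where "\<phi> n y = (\<integral>\<^sup>+z. indicator U z * \<kappa> n y z \<partial>lborel)" for n y
    have [measurable]: "\<phi> n \<in> borel_measurable borel" for n
      unfolding \<phi>_def \<kappa>_def by measurable
    have lim: "indicator U y \<le> liminf (\<lambda>n. \<phi> n y)" for y
    proof (cases "y \<in> U")
      case True
      then obtain d where d: "d > 0" "cball y d \<subseteq> U" using \<open>open U\<close> open_contains_cball by blast
      have "\<forall>\<^sub>F n in sequentially. e n < d" using e(2) d(1) by (rule order_tendstoD)
      then have "\<forall>\<^sub>F n in sequentially. 1 \<le> \<phi> n y"
      proof eventually_elim
        case (elim n)
        have "\<phi> n y = (\<integral>\<^sup>+z. (1 / V n) * indicator (cball y (e n)) z \<partial>lborel)"
          unfolding \<phi>_def using elim d(2) by (intro nn_integral_cong) (auto simp: \<kappa>_def subset_iff split: split_indicator)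
        also have "\<dots> = 1 / V n * V n" by (subst nn_integral_cmult_indicator) (auto simp: V_eq)
        also have "\<dots> = 1" using V[of n] by (simp add: ennreal_divide_times ennreal_divide_self less_top)
        finally show ?case by simp
      qed
      then have "1 \<le> liminf (\<lambda>n. \<phi> n y)" by (rule Liminf_bounded)
      then show ?thesis by (simp add: indicator_def)
    qed simp
    have int: "(\<integral>\<^sup>+y. \<phi> n y \<partial>\<mu>) \<le> ennreal C * emeasure lborel U" for n
    proof -
      have "(\<integral>\<^sup>+y. \<phi> n y \<partial>\<mu>) = (\<integral>\<^sup>+z. (\<integral>\<^sup>+y. indicator U z * \<kappa> n y z \<partial>\<mu>) \<partial>lborel)"
        unfolding \<phi>_def by (rule Fubini'[symmetric]) (unfold \<kappa>_def, measurable)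
      also have "\<dots> \<le> (\<integral>\<^sup>+z. ennreal C * indicator U z \<partial>lborel)"
      proof (rule nn_integral_mono)
        fix z :: 'b
        have "(\<integral>\<^sup>+y. \<kappa> n y z \<partial>\<mu>) = (\<integral>\<^sup>+y. (1 / V n) * indicator (cball z (e n)) y \<partial>\<mu>)"
          by (intro nn_integral_cong) (auto simp: \<kappa>_def dist_commute split: split_indicator)
        also have "\<dots> = (1 / V n) * emeasure \<mu> (cball z (e n))"
          by (rule nn_integral_cmult_indicator) (simp add: sets)
        also have "\<dots> \<le> (1 / V n) * (ennreal C * V n)"
          using le[OF e(1), of z n] by (intro mult_left_mono) (auto simp: V_eq)
        also have "\<dots> = ennreal C * (1 / V n * V n)" by (simp add: mult_ac)
        also have "\<dots> = ennreal C" using V[of n] by (simp add: ennreal_divide_times ennreal_divide_self less_top)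
        finally have "(\<integral>\<^sup>+y. \<kappa> n y z \<partial>\<mu>) \<le> ennreal C" .
        then show "(\<integral>\<^sup>+y. indicator U z * \<kappa> n y z \<partial>\<mu>) \<le> ennreal C * indicator U z"
          by (auto simp: indicator_def)
      qed
      also have "\<dots> = ennreal C * emeasure lborel U" by (rule nn_integral_cmult_indicator) simp
      finally show ?thesis .
    qed
    have "emeasure \<mu> U = (\<integral>\<^sup>+y. indicator U y \<partial>\<mu>)" by (simp add: sets)
    also have "\<dots> \<le> (\<integral>\<^sup>+y. liminf (\<lambda>n. \<phi> n y) \<partial>\<mu>)" by (intro nn_integral_mono lim)
    also have "\<dots> \<le> liminf (\<lambda>n. \<integral>\<^sup>+y. \<phi> n y \<partial>\<mu>)" by (rule nn_integral_liminf) measurable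
    also have "\<dots> \<le> ennreal C * emeasure lborel U"
      using int by (intro order_trans[OF Liminf_le_Limsup Limsup_bounded]) auto
    finally show ?thesis .
  qed
  show ?thesis
  proof (rule ennreal_le_epsilon)
    fix \<delta> :: real assume "0 < \<delta>"
    have pos: "\<delta> / (C + 1) > 0" using \<open>0 < \<delta>\<close> \<open>0 \<le> C\<close> by simp
    obtain U where U: "open U" "A \<subseteq> U" "emeasure lborel (U - A) < ennreal (\<delta> / (C + 1))"
      using outer_regular_lborel[OF A pos] by auto
    have [measurable]: "U \<in> sets borel" using U(1) by auto
    have "emeasure \<mu> A \<le> emeasure \<mu> U" using U(2) by (intro emeasure_mono) (auto simp: sets)
    also have "\<dots> \<le> ennreal C * emeasure lborel U" by (rule open_le[OF U(1)])
    also have "emeasure lborel U \<le> emeasure lborel A + emeasure lborel (U - A)"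
      by (rule order_trans[OF emeasure_mono emeasure_subadditive]) auto
    also have "ennreal C * (emeasure lborel A + emeasure lborel (U - A)) \<le> ennreal C * emeasure lborel A + ennreal C * ennreal (\<delta> / (C + 1))"
      unfolding distrib_left using U(3) by (intro add_left_mono mult_left_mono) auto
    also have "ennreal C * ennreal (\<delta> / (C + 1)) \<le> ennreal \<delta>"
      using \<open>0 \<le> C\<close> \<open>0 < \<delta>\<close> by (subst ennreal_mult[symmetric]) (auto intro!: ennreal_leI simp: field_simps)
    finally show "emeasure \<mu> A \<le> ennreal C * emeasure lborel A + ennreal \<delta>"
      by (simp add: mult_left_mono add_left_mono)
  qed
qed

section \<open>Product laws\<close>

lemma PiM_density_lborel:
  fixes g :: "'n::finite \<Rightarrow> 'a::euclidean_space \<Rightarrow> ennreal"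
  assumes [measurable]: "\<And>i. g i \<in> borel_measurable borel" and p: "\<And>i. prob_space (density lborel (g i))"
  shows "Pi\<^sub>M UNIV (\<lambda>i. density lborel (g i)) = density (Pi\<^sub>M UNIV (\<lambda>_. lborel)) (\<lambda>x. \<Prod>i\<in>UNIV. g i (x i))"
proof -
  interpret product_prob_space "\<lambda>i. density lborel (g i)" UNIV by (rule product_prob_spaceI) (rule p)
  let ?P = "Pi\<^sub>M UNIV (\<lambda>_::'n. lborel :: 'a measure)"
  have "density ?P (\<lambda>x. \<Prod>i\<in>UNIV. g i (x i)) = Pi\<^sub>M UNIV (\<lambda>i. density lborel (g i))"
  proof (rule PiM_eqI)
    show "sets (density ?P (\<lambda>x. \<Prod>i\<in>UNIV. g i (x i))) = sets (Pi\<^sub>M UNIV (\<lambda>i. density lborel (g i)))"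
      by (simp cong: sets_PiM_cong)
    fix A :: "'n \<Rightarrow> 'a set" assume "\<And>i. i \<in> UNIV \<Longrightarrow> A i \<in> sets (density lborel (g i))"
    then have A[measurable]: "A i \<in> sets borel" for i by simp
    have PA: "Pi\<^sub>E UNIV A \<in> sets ?P" by (intro sets_PiM_I_finite) auto
    have "emeasure (density ?P (\<lambda>x. \<Prod>i\<in>UNIV. g i (x i))) (Pi\<^sub>E UNIV A)
      = (\<integral>\<^sup>+x. (\<Prod>i\<in>UNIV. g i (x i)) * indicator (Pi\<^sub>E UNIV A) x \<partial>?P)"
      using PA by (subst emeasure_density) auto
    also have "\<dots> = (\<integral>\<^sup>+x. (\<Prod>i\<in>UNIV. g i (x i) * indicator (A i) (x i)) \<partial>?P)"
    proof (rule nn_integral_cong)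
      fix x :: "'n \<Rightarrow> 'a"
      have "indicator (Pi\<^sub>E UNIV A) x = (\<Prod>i\<in>UNIV. indicator (A i) (x i) :: ennreal)"
        by (auto simp: prod_indicator_UNIV indicator_def PiE_iff)
      then show "(\<Prod>i\<in>UNIV. g i (x i)) * indicator (Pi\<^sub>E UNIV A) x = (\<Prod>i\<in>UNIV. g i (x i) * indicator (A i) (x i))"
        by (simp only: prod.distrib)
    qed
    also have "\<dots> = (\<Prod>i\<in>UNIV. \<integral>\<^sup>+x. g i x * indicator (A i) x \<partial>lborel)"
      by (rule lborel_product.product_nn_integral_prod) auto
    also have "\<dots> = (\<Prod>i\<in>UNIV. emeasure (density lborel (g i)) (A i))"
      by (intro prod.cong) (auto simp: emeasure_density)
    finally show "emeasure (density ?P (\<lambda>x. \<Prod>i\<in>UNIV. g i (x i))) (Pi\<^sub>E UNIV A) = (\<Prod>i\<in>UNIV. emeasure (density lborel (g i)) (A i))" .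
  qed simp
  then show ?thesis ..
qed

text \<open>\<open>kron_id\<close> on families instead of vectors, so that it acts on product
  spaces; \<open>kron_slab\<close> is its preimage of a centred closed ball.\<close>

definition kron_map :: "real^'n^'k \<Rightarrow> ('n::finite \<Rightarrow> 'a::euclidean_space) \<Rightarrow> 'a^'k" where
  "kron_map A x = (\<chi> l. \<Sum>j\<in>UNIV. (A $ l $ j) *\<^sub>R x j)"

lemma kron_slab_iff: "x \<in> kron_slab A \<epsilon> \<longleftrightarrow> norm (kron_map A x) \<le> \<epsilon>"
  by (simp add: kron_slab_def kron_map_def)

lemma kron_map_add: "kron_map A (\<lambda>i. x i + y i) = kron_map A x + kron_map A y"
  by (simp add: kron_map_def vec_eq_iff scaleR_add_right sum.distrib)

lemma kron_map_scaleR: "kron_map A (\<lambda>i. c *\<^sub>R x i) = c *\<^sub>R kron_map A x"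
  by (simp add: kron_map_def vec_eq_iff scaleR_sum_right mult.commute)

text \<open>Projecting \<open>b\<close> to the range of the linear map only enlarges the set, and a shift inside the range can be
  absorbed into the arguments.\<close>

lemma kron_map_cball_subset_shift:
  fixes A :: "real^'n^'k" and b :: "'a::euclidean_space ^ 'k"
  obtains \<beta> where "\<And>x :: 'n \<Rightarrow> 'a. norm (kron_map A x - b) \<le> \<epsilon> \<Longrightarrow> (\<lambda>i. x i + \<beta> i) \<in> kron_slab A \<epsilon>"
proof -
  let ?R = "range (kron_map A :: ('n \<Rightarrow> 'a) \<Rightarrow> 'a^'k)"
  have sub: "subspace ?R"
    unfolding subspace_def
  proof (intro conjI ballI allI)
    show "0 \<in> ?R" by (rule range_eqI[of _ _ "\<lambda>_. 0"]) (simp add: kron_map_def vec_eq_iff)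
    show "x + y \<in> ?R" if "x \<in> ?R" "y \<in> ?R" for x y
      using that by (auto simp: kron_map_add[symmetric])
    show "c *\<^sub>R x \<in> ?R" if "x \<in> ?R" for c x
      using that by (auto simp: kron_map_scaleR[symmetric])
  qed
  obtain b0 z where b: "b0 \<in> span ?R" "\<And>w. w \<in> span ?R \<Longrightarrow> orthogonal z w" "b = b0 + z"
    using orthogonal_subspace_decomp_exists[of ?R b] by metis
  have span: "span ?R = ?R" using sub by (simp add: span_eq_iff)
  have "b0 \<in> ?R" using b(1) unfolding span .
  then obtain \<gamma> :: "'n \<Rightarrow> 'a" where \<gamma>: "b0 = kron_map A \<gamma>" by (rule rangeE)
  show thesis
  proof (rule that[of "\<lambda>i. (-1) *\<^sub>R \<gamma> i"])
    fix x :: "'n \<Rightarrow> 'a" assume x: "norm (kron_map A x - b) \<le> \<epsilon>"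
    let ?u = "kron_map A (\<lambda>i. x i + (-1) *\<^sub>R \<gamma> i)"
    have u: "?u = kron_map A x - b0" by (simp only: kron_map_add kron_map_scaleR \<gamma>) simp
    have "orthogonal z ?u" using b(2)[of ?u] span by auto
    then have "(norm (?u + (- z)))\<^sup>2 = (norm ?u)\<^sup>2 + (norm (- z))\<^sup>2"
      by (intro norm_add_Pythagorean) (simp add: orthogonal_def inner_commute)
    moreover have "kron_map A x - b = ?u + (- z)" unfolding u b(3) by simp
    ultimately have "(norm ?u)\<^sup>2 \<le> (norm (kron_map A x - b))\<^sup>2" by (simp only:) simp
    then have "norm ?u \<le> norm (kron_map A x - b)" by (rule power2_le_imp_le) simp
    with x show "(\<lambda>i. x i + (-1) *\<^sub>R \<gamma> i) \<in> kron_slab A \<epsilon>" by (simp only: kron_slab_iff)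
  qed
qed

lemma kron_map_measurable [measurable]:
  assumes "\<And>i. sets (N i) = sets borel"
  shows "kron_map (A :: real^'n^'k) \<in> borel_measurable (Pi\<^sub>M UNIV (N :: 'n::finite \<Rightarrow> 'a::euclidean_space measure))"
proof -
  have [measurable]: "(\<lambda>x. x j) \<in> borel_measurable (Pi\<^sub>M UNIV N)" for j
    using measurable_component_singleton[of j UNIV N] assms[of j] by (simp cong: measurable_cong_sets)
  show ?thesis
    unfolding kron_map_def[abs_def]
  proof (rule borel_measurable_euclidean_space[THEN iffD2], rule ballI)
    fix b :: "'a^'k" assume "b \<in> Basis"
    then obtain l c where b: "b = axis l c" by (auto simp: Basis_vec_def)
    show "(\<lambda>x. (\<chi> l. \<Sum>j\<in>UNIV. (A $ l $ j) *\<^sub>R x j) \<bullet> b) \<in> borel_measurable (Pi\<^sub>M UNIV N)"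
      unfolding b by (simp add: inner_axis) measurable
  qed
qed

text \<open>Multiplying \<open>g i\<close> by the volume \<open>V i\<close> of its ball gives values
  in [0, 1] and mass \<open>V i\<close>, which is also the mass of the ball indicator. The same
  constants \<open>1 / V i\<close> restore the probability densities on both sides.\<close>

lemma emeasure_PiM_density_kron_cball_le:
  fixes A :: "real^'n^'k" and g :: "'n \<Rightarrow> 'a::euclidean_space \<Rightarrow> ennreal"
  assumes [measurable]: "\<And>i. g i \<in> borel_measurable borel" and r: "\<And>i. 0 < r i"
    and g_le: "\<And>i x. g i x \<le> 1 / emeasure lborel (cball (0::'a) (r i))"
    and p: "\<And>i. prob_space (density lborel (g i))"
  shows "emeasure (Pi\<^sub>M UNIV (\<lambda>i. density lborel (g i))) {x. norm (kron_map A x - b) \<le> \<epsilon>}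
    \<le> emeasure (Pi\<^sub>M UNIV (\<lambda>i. uniform_measure lborel (cball (0::'a) (r i)))) {x. norm (kron_map A x) \<le> \<epsilon>}"
proof -
  let ?P = "Pi\<^sub>M UNIV (\<lambda>_::'n. lborel :: 'a measure)"
  define V where "V i = emeasure lborel (cball (0::'a) (r i))" for i
  have V: "V i \<noteq> 0" "V i \<noteq> top" for i
    using emeasure_lborel_cball_pos[OF r, of "0::'a" i] emeasure_lborel_cball_finite[of "0::'a" "r i"]
    by (auto simp: V_def)
  have V1: "V i / V i = 1" for i using V[of i] by (simp add: ennreal_divide_self less_top)
  obtain \<beta> where \<beta>: "\<And>x :: 'n \<Rightarrow> 'a. norm (kron_map A x - b) \<le> \<epsilon> \<Longrightarrow> (\<lambda>i. x i + \<beta> i) \<in> kron_slab A \<epsilon>"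
    using kron_map_cball_subset_shift by metis
  \<comment> \<open>The shift that removes the centre \<open>b\<close> is built into the densities;
    it changes neither their bound nor their mass.\<close>
  define f where "f i x = V i * g i (x - \<beta> i)" for i x
  have [measurable]: "f i \<in> borel_measurable borel" for i unfolding f_def[abs_def] by measurable
  have f1: "f i x \<le> 1" for i x
  proof -
    have "f i x \<le> V i * (1 / V i)" unfolding f_def V_def by (intro mult_left_mono g_le) simp
    then show ?thesis by (simp add: V1 ennreal_times_divide)
  qed
  have f_int: "(\<integral>\<^sup>+x. f i x \<partial>lborel) \<le> emeasure lborel (cball (0::'a) (r i))" for i
  proof -
    have "(\<integral>\<^sup>+x. f i x \<partial>lborel) = V i * (\<integral>\<^sup>+x. g i (x - \<beta> i) \<partial>lborel)"
      unfolding f_def by (rule nn_integral_cmult) measurable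
    also have "(\<integral>\<^sup>+x. g i (x - \<beta> i) \<partial>lborel) = (\<integral>\<^sup>+x. g i x \<partial>lborel)"
      using nn_integral_lborel_translate[of "g i" "- \<beta> i"] by simp
    also have "\<dots> = emeasure (density lborel (g i)) (space (density lborel (g i)))"
      by (simp add: emeasure_density)
    also have "\<dots> = 1" by (rule prob_space.emeasure_space_1[OF p])
    finally show ?thesis by (simp add: V_def)
  qed
  have g_eq: "g i x = f i (x + \<beta> i) / V i" for i x
  proof -
    have "f i (x + \<beta> i) / V i = g i x * (V i / V i)" by (simp add: f_def divide_ennreal_def mult_ac)
    then show ?thesis by (simp add: V1)
  qed
  have meas [measurable]: "{x. norm (kron_map A x - b) \<le> \<epsilon>} \<in> sets ?P" for b
  proof -
    have "{x \<in> space ?P. norm (kron_map A x - b) \<le> \<epsilon>} \<in> sets ?P" by measurable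
    then show ?thesis by (simp add: space_PiM)
  qed
  have unif: "uniform_measure lborel (cball 0 (r i)) = density lborel (\<lambda>x. indicator (cball (0::'a) (r i)) x / V i)" for i
    by (simp add: uniform_measure_def V_def)
  have unif_p: "prob_space (density lborel (\<lambda>x. indicator (cball (0::'a) (r i)) x / V i))" for i
    unfolding unif[symmetric] using V[of i] by (intro prob_space_uniform_measure) (auto simp: V_def)
  have eq0: "(kron_slab A \<epsilon> :: ('n \<Rightarrow> 'a) set) = {x. norm (kron_map A x) \<le> \<epsilon>}"
    by (auto simp: kron_slab_iff)
  have "emeasure (Pi\<^sub>M UNIV (\<lambda>i. density lborel (g i))) {x. norm (kron_map A x - b) \<le> \<epsilon>}
    = (\<integral>\<^sup>+x. (\<Prod>i\<in>UNIV. g i (x i)) * indicator {x. norm (kron_map A x - b) \<le> \<epsilon>} x \<partial>?P)"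
    by (subst PiM_density_lborel[OF _ p]) (auto simp: emeasure_density)
  also have "\<dots> \<le> (\<integral>\<^sup>+x. (\<Prod>i\<in>UNIV. g i (x i)) * indicator (kron_slab A \<epsilon>) (\<lambda>i. x i + \<beta> i) \<partial>?P)"
    using \<beta> by (intro nn_integral_mono mult_left_mono) (auto simp: indicator_def)
  also have "\<dots> = (\<integral>\<^sup>+x. (\<Prod>i\<in>UNIV. f i (x i + \<beta> i) / V i) * indicator (kron_slab A \<epsilon>) (\<lambda>i. x i + \<beta> i) \<partial>?P)"
    by (simp only: g_eq)
  also have "\<dots> = (\<integral>\<^sup>+x. (\<Prod>i\<in>UNIV. f i (x i) / V i) * indicator (kron_slab A \<epsilon>) x \<partial>?P)"
    by (rule nn_integral_PiM_lborel_translate[of "\<lambda>x. (\<Prod>i\<in>UNIV. f i (x i) / V i) * indicator (kron_slab A \<epsilon>) x"]) measurable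
  also have "\<dots> = (\<integral>\<^sup>+x. (\<Prod>i\<in>UNIV. 1 / V i) * (indicator (kron_slab A \<epsilon>) x * (\<Prod>i\<in>UNIV. f i (x i))) \<partial>?P)"
    by (intro nn_integral_cong) (simp add: divide_ennreal_def prod.distrib mult_ac)
  also have "\<dots> = (\<Prod>i\<in>UNIV. 1 / V i) * (\<integral>\<^sup>+x. indicator (kron_slab A \<epsilon>) x * (\<Prod>i\<in>UNIV. f i (x i)) \<partial>?P)"
    by (rule nn_integral_cmult) measurable
  also have "\<dots> \<le> (\<Prod>i\<in>UNIV. 1 / V i) * (\<integral>\<^sup>+x. indicator (kron_slab A \<epsilon>) x * (\<Prod>i\<in>UNIV. indicator (cball (0::'a) (r i)) (x i)) \<partial>?P)"
    by (intro mult_left_mono nn_integral_kron_slab_le f1 f_int) (use r in \<open>auto intro: less_imp_le\<close>)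
  also have "\<dots> = (\<integral>\<^sup>+x. (\<Prod>i\<in>UNIV. 1 / V i) * (indicator (kron_slab A \<epsilon>) x * (\<Prod>i\<in>UNIV. indicator (cball (0::'a) (r i)) (x i))) \<partial>?P)"
    by (rule nn_integral_cmult[symmetric]) measurable
  also have "\<dots> = (\<integral>\<^sup>+x. (\<Prod>i\<in>UNIV. indicator (cball (0::'a) (r i)) (x i) / V i) * indicator (kron_slab A \<epsilon>) x \<partial>?P)"
    by (intro nn_integral_cong) (simp add: divide_ennreal_def prod.distrib mult_ac)
  also have "\<dots> = emeasure (Pi\<^sub>M UNIV (\<lambda>i. uniform_measure lborel (cball (0::'a) (r i)))) {x. norm (kron_map A x) \<le> \<epsilon>}"
    unfolding unif eq0[symmetric] by (subst PiM_density_lborel[OF _ unif_p]) (auto simp: emeasure_density)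
  finally show ?thesis .
qed

text \<open>Fubini over the components outside \<open>I\<close>: once these are fixed, their
  contribution only moves the centre \<open>b\<close>.\<close>

lemma emeasure_PiM_kron_cball_split:
  fixes A :: "real^'n^'k" and N :: "'n \<Rightarrow> 'a::euclidean_space measure"
  assumes p: "\<And>i. prob_space (N i)" and s: "\<And>i. sets (N i) = sets borel"
  defines "L \<equiv> \<lambda>I x. (\<chi> l. \<Sum>j\<in>I. (A $ l $ j) *\<^sub>R x j)"
  shows "emeasure (Pi\<^sub>M UNIV N) {x. norm (kron_map A x - b) \<le> \<epsilon>}
    = (\<integral>\<^sup>+y. emeasure (Pi\<^sub>M I N) {x\<in>space (Pi\<^sub>M I N). norm (L I x - (b - L (- I) y)) \<le> \<epsilon>} \<partial>Pi\<^sub>M (- I) N)"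
proof -
  interpret product_prob_space N UNIV by (rule product_prob_spaceI) (rule p)
  have [measurable]: "kron_map A \<in> borel_measurable (Pi\<^sub>M UNIV N)" by (rule kron_map_measurable[OF s])
  have sp: "space (N i) = UNIV" for i using sets_eq_imp_space_eq[OF s[of i]] by simp
  let ?E = "{x. norm (kron_map A x - b) \<le> \<epsilon>}"
  have E: "?E \<in> sets (Pi\<^sub>M UNIV N)"
  proof -
    have "{x \<in> space (Pi\<^sub>M UNIV N). norm (kron_map A x - b) \<le> \<epsilon>} \<in> sets (Pi\<^sub>M UNIV N)" by measurable
    then show ?thesis by (simp add: space_PiM sp)
  qed
  have "emeasure (Pi\<^sub>M (- I \<union> I) N) ?E
    = (\<integral>\<^sup>+y. emeasure (Pi\<^sub>M I N) ((\<lambda>x. merge (- I) I (y, x)) -` ?E \<inter> space (Pi\<^sub>M I N)) \<partial>Pi\<^sub>M (- I) N)"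
    using E by (intro emeasure_fold_integral) (auto simp: Un_commute)
  also have "\<dots> = (\<integral>\<^sup>+y. emeasure (Pi\<^sub>M I N) {x\<in>space (Pi\<^sub>M I N). norm (L I x - (b - L (- I) y)) \<le> \<epsilon>} \<partial>Pi\<^sub>M (- I) N)"
  proof (intro nn_integral_cong arg_cong2[where f=emeasure])
    fix y
    have "kron_map A (merge (- I) I (y, x)) = L I x + L (- I) y" for x
    proof -
      have "(\<Sum>j\<in>UNIV. (A $ l $ j) *\<^sub>R merge (- I) I (y, x) j) = (\<Sum>j\<in>I. (A $ l $ j) *\<^sub>R x j) + (\<Sum>j\<in>- I. (A $ l $ j) *\<^sub>R y j)" for l
      proof -
        have "(\<Sum>j\<in>UNIV. (A $ l $ j) *\<^sub>R merge (- I) I (y, x) j) = (\<Sum>j\<in>I \<union> - I. (A $ l $ j) *\<^sub>R merge (- I) I (y, x) j)" by simp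
        also have "\<dots> = (\<Sum>j\<in>I. (A $ l $ j) *\<^sub>R merge (- I) I (y, x) j) + (\<Sum>j\<in>- I. (A $ l $ j) *\<^sub>R merge (- I) I (y, x) j)"
          by (rule sum.union_disjoint) auto
        finally show ?thesis by (simp add: merge_def)
      qed
      then show ?thesis by (simp add: kron_map_def L_def vec_eq_iff)
    qed
    then show "(\<lambda>x. merge (- I) I (y, x)) -` ?E \<inter> space (Pi\<^sub>M I N) = {x\<in>space (Pi\<^sub>M I N). norm (L I x - (b - L (- I) y)) \<le> \<epsilon>}"
      by (auto simp: algebra_simps)
  qed simp
  finally show ?thesis by simp
qed

text \<open>For fixed values of the components outside \<open>I\<close>, the comparison of bounded
  densities holds with a right side independent of the centre, so averaging over these values
  preserves it. Under \<open>N'\<close> the components outside \<open>I\<close> are almost surely 0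
  and move nothing.\<close>

lemma emeasure_PiM_kron_cball_le:
  fixes A :: "real^'n^'k" and N N' :: "'n \<Rightarrow> 'a::euclidean_space measure"
  assumes p: "\<And>i. prob_space (N i)" "\<And>i. prob_space (N' i)"
    and s: "\<And>i. sets (N i) = sets borel" "\<And>i. sets (N' i) = sets borel"
    and r: "\<And>i. i \<in> I \<Longrightarrow> 0 < r i"
    and N: "\<And>i. i \<in> I \<Longrightarrow> N i = density lborel (g i)"
    and g: "\<And>i. i \<in> I \<Longrightarrow> g i \<in> borel_measurable borel"
      "\<And>i x. i \<in> I \<Longrightarrow> g i x \<le> 1 / emeasure lborel (cball (0::'a) (r i))"
    and N': "\<And>i. i \<in> I \<Longrightarrow> N' i = uniform_measure lborel (cball 0 (r i))"
      "\<And>i. i \<notin> I \<Longrightarrow> N' i = return borel 0"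
  shows "emeasure (Pi\<^sub>M UNIV N) {x. norm (kron_map A x - b) \<le> \<epsilon>}
    \<le> emeasure (Pi\<^sub>M UNIV N') {x. norm (kron_map A x) \<le> \<epsilon>}"
proof -
  \<comment> \<open>Zero columns, together with a dummy uniform law on the unit ball, turn the
    problem on \<open>I\<close> into one indexed by the whole type, as the comparison of densities
    requires.\<close>
  define A' :: "real^'n^'k" where "A' = (\<chi> l j. if j \<in> I then A $ l $ j else 0)"
  define r' where "r' i = (if i \<in> I then r i else 1)" for i
  define u where "u x = indicator (cball 0 1) x / emeasure lborel (cball (0::'a) 1)" for x :: 'a
  define g' where "g' i = (if i \<in> I then g i else u)" for i
  define M where "M i = density lborel (g' i)" for i
  define M' where "M' i = uniform_measure lborel (cball (0::'a) (r' i))" for i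
  define L :: "'n set \<Rightarrow> ('n \<Rightarrow> 'a) \<Rightarrow> 'a^'k" where "L J x = (\<chi> l. \<Sum>j\<in>J. (A $ l $ j) *\<^sub>R x j)" for J x
  define H where "H N b = emeasure (Pi\<^sub>M I N) {x\<in>space (Pi\<^sub>M I N). norm (L I x - b) \<le> \<epsilon>}"
    for N :: "'n \<Rightarrow> 'a measure" and b
  have [measurable]: "u \<in> borel_measurable borel" unfolding u_def[abs_def] by measurable
  have r': "0 < r' i" for i using r by (simp add: r'_def)
  have pu: "prob_space (uniform_measure lborel (cball (0::'a) d))" if "0 < d" for d
    using emeasure_lborel_cball_pos[OF that, of "0::'a"] emeasure_lborel_cball_finite[of "0::'a" d]
    by (intro prob_space_uniform_measure) auto
  have u: "density lborel u = uniform_measure lborel (cball (0::'a) 1)"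
    by (simp add: uniform_measure_def u_def[abs_def])
  have pM: "prob_space (M i)" "prob_space (M' i)" for i
    using p(1)[of i] N[of i] pu r' by (auto simp: M_def g'_def M'_def u)
  have sM: "sets (M i) = sets borel" "sets (M' i) = sets borel" for i by (auto simp: M_def M'_def)
  have split: "emeasure (Pi\<^sub>M UNIV N) {x. norm (kron_map A x - b) \<le> \<epsilon>} = (\<integral>\<^sup>+y. H N (b - L (- I) y) \<partial>Pi\<^sub>M (- I) N)"
    if "\<And>i. prob_space (N i)" "\<And>i. sets (N i) = sets borel" for N and b
    unfolding H_def L_def by (rule emeasure_PiM_kron_cball_split[OF that])
  have split': "emeasure (Pi\<^sub>M UNIV N) {x. norm (kron_map A' x - b) \<le> \<epsilon>} = H N b"
    if N: "\<And>i. prob_space (N i)" "\<And>i. sets (N i) = sets borel" for N and b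
  proof -
    have "(\<chi> l. \<Sum>j\<in>I. (A' $ l $ j) *\<^sub>R x j) = L I x" "(\<chi> l. \<Sum>j\<in>- I. (A' $ l $ j) *\<^sub>R x j) = 0" for x :: "'n \<Rightarrow> 'a"
      by (simp_all add: A'_def L_def vec_eq_iff)
    then have "emeasure (Pi\<^sub>M UNIV N) {x. norm (kron_map A' x - b) \<le> \<epsilon>} = (\<integral>\<^sup>+y. H N b \<partial>Pi\<^sub>M (- I) N)"
      unfolding H_def by (subst emeasure_PiM_kron_cball_split[OF N, where A=A' and b=b and \<epsilon>=\<epsilon> and I=I]) simp
    also have "\<dots> = H N b"
      using prob_space.emeasure_space_1[OF prob_space_PiM[of "- I" N]] N(1) by simp
    finally show ?thesis .
  qed
  have H_cong: "H N b = H N2 b" if "\<And>i. i \<in> I \<Longrightarrow> N i = N2 i" for N N2 b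
  proof -
    have "Pi\<^sub>M I N = Pi\<^sub>M I N2" using that by (intro PiM_cong) auto
    then show ?thesis by (simp add: H_def)
  qed
  have main: "H N b \<le> H N' 0" for b
  proof -
    have "H N b = H M b" using N by (intro H_cong) (simp add: M_def g'_def)
    also have "\<dots> = emeasure (Pi\<^sub>M UNIV M) {x. norm (kron_map A' x - b) \<le> \<epsilon>}" by (rule split'[symmetric]) (rule pM sM)+
    also have "\<dots> \<le> emeasure (Pi\<^sub>M UNIV M') {x. norm (kron_map A' x) \<le> \<epsilon>}"
      unfolding M_def M'_def
    proof (rule emeasure_PiM_density_kron_cball_le)
      show "g' i \<in> borel_measurable borel" for i using g(1)[of i] by (simp add: g'_def)
      show "g' i x \<le> 1 / emeasure lborel (cball (0::'a) (r' i))" for i x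
        using g(2)[of i x] by (auto simp: g'_def r'_def u_def indicator_def)
      show "prob_space (density lborel (g' i))" for i using pM(1)[of i] by (simp add: M_def)
    qed (rule r')
    also have "\<dots> = H M' 0" using split'[OF pM(2) sM(2), where b=0] by simp
    also have "\<dots> = H N' 0" using N'(1) by (intro H_cong) (simp add: M'_def r'_def)
    finally show ?thesis .
  qed
  have "emeasure (Pi\<^sub>M UNIV N) {x. norm (kron_map A x - b) \<le> \<epsilon>} \<le> (\<integral>\<^sup>+y. H N' 0 \<partial>Pi\<^sub>M (- I) N)"
    unfolding split[OF p(1) s(1)] by (intro nn_integral_mono main)
  also have "\<dots> = H N' 0"
    using prob_space.emeasure_space_1[OF prob_space_PiM[of "- I" N]] p(1) by simp
  also have "\<dots> = (\<integral>\<^sup>+y. H N' 0 \<partial>Pi\<^sub>M (- I) N')"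
    using prob_space.emeasure_space_1[OF prob_space_PiM[of "- I" N']] p(2) by simp
  also have "\<dots> = (\<integral>\<^sup>+y. H N' (0 - L (- I) y) \<partial>Pi\<^sub>M (- I) N')"
  proof (rule nn_integral_cong_AE)
    have "AE y in Pi\<^sub>M (- I) N'. \<forall>i\<in>- I. y i = 0"
    proof (rule AE_finite_allI)
      fix i assume "i \<in> - I"
      then have "N' i = return borel 0" using N'(2) by simp
      then have "AE z in N' i. z = 0" by (simp only:) (subst AE_return, auto)
      with \<open>i \<in> - I\<close> p(2) show "AE y in Pi\<^sub>M (- I) N'. y i = 0"
        by (intro AE_PiM_component[where P="\<lambda>z. z = 0"]) auto
    qed simp
    then show "AE y in Pi\<^sub>M (- I) N'. H N' 0 = H N' (0 - L (- I) y)"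
    proof eventually_elim
      case (elim y)
      then have "L (- I) y = 0" by (simp add: L_def vec_eq_iff)
      then show ?case by simp
    qed
  qed
  also have "\<dots> = emeasure (Pi\<^sub>M UNIV N') {x. norm (kron_map A x) \<le> \<epsilon>}"
    using split[OF p(2) s(2), where b=0] by simp
  finally show ?thesis .
qed

text \<open>Probabilities under \<open>Z\<close> are volumes inside the ball divided by its volume.
  Through the equality of \<open>M\<close> for \<open>X\<^sub>i\<close> and \<open>Z\<^sub>i\<close>
  this becomes the bound on the density of \<open>X\<^sub>i\<close>.\<close>

lemma max_density_eq_uniform_ball_le:
  fixes Z :: "'v \<Rightarrow> 'a::euclidean_space"
  assumes [measurable]: "Z \<in> borel_measurable Q" and Z: "distr Q borel Z = uniform_measure lborel (cball 0 r)" and "0 < r"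
  shows "max_density Q Z \<le> 1 / emeasure lborel (cball (0::'a) r)"
  unfolding max_density_def
proof (rule SUP_least)
  fix A :: "'a set" assume "A \<in> {A \<in> sets borel. 0 < emeasure lborel A}"
  then have A: "A \<in> sets borel" "0 < emeasure lborel A" by auto
  have V: "emeasure lborel (cball (0::'a) r) \<noteq> 0" "emeasure lborel (cball (0::'a) r) \<noteq> top"
    using emeasure_lborel_cball_pos[OF \<open>0 < r\<close>, of "0::'a"] emeasure_lborel_cball_finite[of "0::'a" r] by auto
  have "emeasure Q (Z -` A \<inter> space Q) = emeasure (distr Q borel Z) A" using A by (simp add: emeasure_distr)
  also have "\<dots> = emeasure lborel (cball 0 r \<inter> A) / emeasure lborel (cball (0::'a) r)"
    unfolding Z using A by (subst emeasure_uniform_measure) auto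
  also have "\<dots> \<le> emeasure lborel A / emeasure lborel (cball (0::'a) r)"
    using A by (intro divide_right_mono_ennreal emeasure_mono) auto
  finally have "emeasure Q (Z -` A \<inter> space Q) \<le> 1 / emeasure lborel (cball (0::'a) r) * emeasure lborel A"
    by (simp add: divide_ennreal_def mult.commute)
  then show "emeasure Q (Z -` A \<inter> space Q) / emeasure lborel A \<le> 1 / emeasure lborel (cball (0::'a) r)"
    using A by (intro divide_le_posI_ennreal) (auto simp: mult.commute)
qed

theorem theorem1p4:
  fixes P :: "'w measure" and Q :: "'v measure"
    and X :: "'w \<Rightarrow> (real ^ 'd::finite) ^ 'n::finite"
    and Z :: "'v \<Rightarrow> (real ^ 'd) ^ 'n"
    and T :: "real ^ 'n \<Rightarrow> real ^ 'k::finite"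
  assumes "prob_space P" and "prob_space Q"
    and "prob_space.indep_vars P (\<lambda>_. borel) (\<lambda>i \<omega>. X \<omega> $ i) UNIV"
    and "prob_space.indep_vars Q (\<lambda>_. borel) (\<lambda>i \<omega>. Z \<omega> $ i) UNIV"
    and "\<And>i. max_density P (\<lambda>\<omega>. X \<omega> $ i) < \<infinity> \<Longrightarrow>
           \<exists>r>0. distr Q borel (\<lambda>\<omega>. Z \<omega> $ i) = uniform_measure lborel (cball 0 r) \<and>
                 max_density Q (\<lambda>\<omega>. Z \<omega> $ i) = max_density P (\<lambda>\<omega>. X \<omega> $ i)"
    and "\<And>i. max_density P (\<lambda>\<omega>. X \<omega> $ i) = \<infinity> \<Longrightarrow>
           distr Q borel (\<lambda>\<omega>. Z \<omega> $ i) = return borel 0"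
    and "linear T"
  shows "max_density P (\<lambda>\<omega>. kron_id T (X \<omega>)) \<le> max_density Q (\<lambda>\<omega>. kron_id T (Z \<omega>))"
proof -
  interpret P: prob_space P by fact
  interpret Q: prob_space Q by fact
  let ?E = "borel :: (real^'d) measure"
  define A where "A = matrix T"
  define N where "N i = distr P borel (\<lambda>\<omega>. X \<omega> $ i)" for i
  define N' where "N' i = distr Q borel (\<lambda>\<omega>. Z \<omega> $ i)" for i
  have X [measurable]: "(\<lambda>\<omega>. X \<omega> $ i) \<in> borel_measurable P" for i
    using assms(3) by (simp add: P.indep_vars_def)
  have Z [measurable]: "(\<lambda>\<omega>. Z \<omega> $ i) \<in> borel_measurable Q" for i
    using assms(4) by (simp add: Q.indep_vars_def)
  have law_X: "distr P (Pi\<^sub>M UNIV (\<lambda>_. ?E)) (\<lambda>\<omega> i. X \<omega> $ i) = Pi\<^sub>M UNIV N"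
    using P.indep_vars_iff_distr_eq_PiM[where I=UNIV and M'="\<lambda>_. borel" and X="\<lambda>i \<omega>. X \<omega> $ i"] assms(3) X
    by (simp add: N_def[abs_def] restrict_UNIV)
  have law_Z: "distr Q (Pi\<^sub>M UNIV (\<lambda>_. ?E)) (\<lambda>\<omega> i. Z \<omega> $ i) = Pi\<^sub>M UNIV N'"
    using Q.indep_vars_iff_distr_eq_PiM[where I=UNIV and M'="\<lambda>_. borel" and X="\<lambda>i \<omega>. Z \<omega> $ i"] assms(4) Z
    by (simp add: N'_def[abs_def] restrict_UNIV)
  have mX [measurable]: "(\<lambda>\<omega> i. X \<omega> $ i) \<in> measurable P (Pi\<^sub>M UNIV (\<lambda>_. ?E))"
    by (rule measurable_PiM_single') (auto simp: space_PiM)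
  have mZ [measurable]: "(\<lambda>\<omega> i. Z \<omega> $ i) \<in> measurable Q (Pi\<^sub>M UNIV (\<lambda>_. ?E))"
    by (rule measurable_PiM_single') (auto simp: space_PiM)
  have mA [measurable]: "kron_map A \<in> borel_measurable (Pi\<^sub>M UNIV (\<lambda>_. ?E))"
    by (rule kron_map_measurable) simp
  have kron: "kron_id T x = kron_map A (\<lambda>i. x $ i)" for x :: "(real^'d)^'n"
    by (simp add: kron_id_def kron_map_def A_def)
  have mKX: "(\<lambda>\<omega>. kron_id T (X \<omega>)) \<in> borel_measurable P"
    unfolding kron by (rule measurable_compose[OF mX mA])
  have cball_sets: "{x. norm (kron_map A x - b) \<le> e} \<in> sets (Pi\<^sub>M UNIV (\<lambda>_. ?E))" for b e
  proof -
    have "{x \<in> space (Pi\<^sub>M UNIV (\<lambda>_. ?E)). norm (kron_map A x - b) \<le> e} \<in> sets (Pi\<^sub>M UNIV (\<lambda>_. ?E))"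
      by measurable
    then show ?thesis by (simp add: space_PiM)
  qed
  have ball_X: "emeasure P ((\<lambda>\<omega>. kron_id T (X \<omega>)) -` cball b e \<inter> space P) = emeasure (Pi\<^sub>M UNIV N) {x. norm (kron_map A x - b) \<le> e}" for b e
    unfolding law_X[symmetric] using cball_sets
    by (subst emeasure_distr[OF mX]) (auto intro!: arg_cong[where f="emeasure P"] simp: kron dist_norm norm_minus_commute)
  have ball_Z: "emeasure Q ((\<lambda>\<omega>. kron_id T (Z \<omega>)) -` cball 0 e \<inter> space Q) = emeasure (Pi\<^sub>M UNIV N') {x. norm (kron_map A x) \<le> e}" for e
    unfolding law_Z[symmetric] using cball_sets[of 0]
    by (subst emeasure_distr[OF mZ]) (auto intro!: arg_cong[where f="emeasure Q"] simp: kron)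
  \<comment> \<open>The components of \<open>X\<close> with bounded density; outside
    \<open>I\<close> the components of \<open>Z\<close> are Dirac at 0.\<close>
  define I where "I = {i. max_density P (\<lambda>\<omega>. X \<omega> $ i) < \<infinity>}"
  have "\<exists>r g. i \<in> I \<longrightarrow> 0 < r \<and> N' i = uniform_measure lborel (cball 0 r) \<and> g \<in> borel_measurable borel \<and>
    N i = density lborel g \<and> (\<forall>x. g x \<le> 1 / emeasure lborel (cball (0::real^'d) r))" for i
  proof (cases "i \<in> I")
    case True
    then obtain r where r: "0 < r" "N' i = uniform_measure lborel (cball 0 r)"
      "max_density Q (\<lambda>\<omega>. Z \<omega> $ i) = max_density P (\<lambda>\<omega>. X \<omega> $ i)"
      using assms(5)[of i] by (auto simp: I_def N'_def)
    let ?V = "emeasure lborel (cball (0::real^'d) r)"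
    have le: "max_density P (\<lambda>\<omega>. X \<omega> $ i) \<le> 1 / ?V"
      using max_density_eq_uniform_ball_le[OF Z r(2)[unfolded N'_def] r(1)] r(3) by simp
    obtain V where V: "?V = ennreal V" "0 < V"
      using emeasure_lborel_cball_pos[OF r(1), of "0::real^'d"] emeasure_lborel_cball_finite[of "0::real^'d" r]
      by (cases ?V) auto
    have inv: "1 / ?V = ennreal (1 / V)"
      unfolding V(1) ennreal_1[symmetric] using V(2) by (intro divide_ennreal) auto
    obtain g where "g \<in> borel_measurable borel" "\<And>x. g x \<le> ennreal (1 / V)" "N i = density lborel g"
      using bounded_density_exists[OF X le[unfolded inv]] V(2) unfolding N_def by auto
    with r(1,2) have "0 < r \<and> N' i = uniform_measure lborel (cball 0 r) \<and> g \<in> borel_measurable borel \<and>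
      N i = density lborel g \<and> (\<forall>x. g x \<le> 1 / ?V)" unfolding inv by (intro conjI allI)
    then show ?thesis by (intro exI impI)
  qed simp
  then obtain r g where rg: "\<And>i. i \<in> I \<Longrightarrow> 0 < r i \<and> N' i = uniform_measure lborel (cball 0 (r i)) \<and> g i \<in> borel_measurable borel \<and>
    N i = density lborel (g i) \<and> (\<forall>x. g i x \<le> 1 / emeasure lborel (cball (0::real^'d) (r i)))"
    by metis
  have ball_le: "emeasure P ((\<lambda>\<omega>. kron_id T (X \<omega>)) -` cball b e \<inter> space P)
    \<le> emeasure Q ((\<lambda>\<omega>. kron_id T (Z \<omega>)) -` cball 0 e \<inter> space Q)" for b e
    unfolding ball_X ball_Z
  proof (rule emeasure_PiM_kron_cball_le[where I=I and r=r and g=g])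
    show "prob_space (N i)" "prob_space (N' i)" for i
      unfolding N_def N'_def by (rule P.prob_space_distr[OF X] Q.prob_space_distr[OF Z])+
    show "N' i = return borel 0" if "i \<notin> I" for i
      using assms(6)[of i] that by (simp add: I_def N'_def less_top[symmetric])
  qed (use rg in \<open>auto simp: N_def N'_def\<close>)
  show ?thesis
  \<comment> \<open>An infinite right side leaves nothing to prove. Otherwise \<open>C\<close>
    bounds the ratios for \<open>Z\<close> on centred balls, hence by \<open>ball_le\<close> those
    for \<open>X\<close> on all balls.\<close>
  proof (cases "max_density Q (\<lambda>\<omega>. kron_id T (Z \<omega>))")
    case (real C)
    interpret D: prob_space "distr P borel (\<lambda>\<omega>. kron_id T (X \<omega>))" by (rule P.prob_space_distr[OF mKX])
    have *: "emeasure (distr P borel (\<lambda>\<omega>. kron_id T (X \<omega>))) B \<le> ennreal C * emeasure lborel B" if "B \<in> sets borel" for B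
    proof (rule emeasure_le_if_cball_le)
      fix a :: "(real^'d)^'k" and e :: real assume "0 < e"
      have "emeasure P ((\<lambda>\<omega>. kron_id T (X \<omega>)) -` cball a e \<inter> space P)
        \<le> emeasure Q ((\<lambda>\<omega>. kron_id T (Z \<omega>)) -` cball 0 e \<inter> space Q)" by (rule ball_le)
      also have "\<dots> \<le> ennreal C * emeasure lborel (cball (0::(real^'d)^'k) e)"
        unfolding real(2)[symmetric]
        using emeasure_lborel_cball_pos[OF \<open>0 < e\<close>] emeasure_lborel_cball_finite
        by (intro emeasure_vimage_le_max_density) (auto simp: less_top[symmetric])
      also have "emeasure lborel (cball (0::(real^'d)^'k) e) = emeasure lborel (cball a e)"
        using \<open>0 < e\<close> by (simp add: emeasure_cball)
      finally show "emeasure (distr P borel (\<lambda>\<omega>. kron_id T (X \<omega>))) (cball a e) \<le> ennreal C * emeasure lborel (cball a e)"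
        using mKX by (simp add: emeasure_distr)
    qed (use real that D.finite_measure_axioms in auto)
    show ?thesis
      unfolding real(2)
      unfolding max_density_def
    proof (rule SUP_least)
      fix B :: "((real^'d)^'k) set" assume "B \<in> {A \<in> sets borel. 0 < emeasure lborel A}"
      then have B: "B \<in> sets borel" "0 < emeasure lborel B" by auto
      have "emeasure P ((\<lambda>\<omega>. kron_id T (X \<omega>)) -` B \<inter> space P) \<le> ennreal C * emeasure lborel B"
        using *[OF B(1)] mKX B(1) by (simp add: emeasure_distr)
      then show "emeasure P ((\<lambda>\<omega>. kron_id T (X \<omega>)) -` B \<inter> space P) / emeasure lborel B \<le> ennreal C"
        using B(2) by (intro divide_le_posI_ennreal) (auto simp: mult.commute)
    qed
  qed simp
qed

end
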